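(* Let $\alpha\in\mathcal R$ and let $f,g,f_1,f_2,\ldots:\mathbb T\to\mathbb C$ be measurable. Then: (1) (a) $|f|\le|g|$ implies $\alpha(f)\le\alpha(g)$; (b) $\alpha(fg)\le\alpha(f)\|g\|_\infty$; (c) $\alpha(f)\le\|f\|_\infty$. (2) $\alpha\in\mathcal R_c$ if and only if $\limsup_{m(E)\to0^+}\alpha(\chi_E)=0$. (3) $\liminf_{m(E)\to0^+}\alpha(\chi_E)=\inf\{\alpha(\chi_E):m(E)>0\}$. (4) If $t>0$, then $\liminf_{m(E)\to0^+}\alpha(\chi_E)\ge t$ if and only if $t\|f\|_\infty\le\alpha(f)\le\|f\|_\infty$ for every measurable $f$. (5) If $\alpha\in\mathcal S$, then $\alpha\notin\mathcal S_c$ if and only if $\alpha$ is equivalent to $\|\cdot\|_\infty$. (6) If $\alpha\in\mathcal S\cup\mathcal R_c$, $0\le f_1\le f_2\le\cdots$ and $f_n\to f$ a.e. $(m)$, then $\alpha(f_n)\to\alpha(f)$. (7) If $\alpha\in\mathcal R_c$, then the $\alpha$-closure of $C(\mathbb T)$ equals $L^\alpha(\mathbb T)$. (8) If $\alpha\in\mathcal S\cup\mathcal R_c$, then $\|f\|_1\le\alpha(f)$. (9) If $\alpha\in\mathcal S\cup\mathcal R_c$ and $\lambda\in\mathbb C$, then (a) $\alpha(f+g)\le\alpha(f)+\alpha(g)$; (b) $\alpha(\lambda f)=|\lambda|\alpha(f)$; (c) $\alpha$ is a norm on $\mathcal L^\alpha(\mathbb T)$. (10) If $\alpha\in\mathcal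 R_c$, then $(\mathcal L^\alpha(\mathbb T),\alpha)$ is a Banach space and $L^\infty(\mathbb T)\subset L^\alpha(\mathbb T)\subset\mathcal L^\alpha(\mathbb T)\subset L^1(\mathbb T)$.
   Context: $\mathbb T$ is the unit circle and $m$ is normalized arc length (Haar measure) on $\mathbb T$; functions equal a.e. are identified. For $f:\mathbb T\to\mathbb C$ and $w\in\mathbb T$, $f_w(z)=f(\overline wz)$. $\mathcal R$ is the set of rotationally symmetric seminorms, i.e. seminorms $\alpha$ on $L^\infty(\mathbb T)$ with $\alpha(1)=1$, $\alpha(|f|)=\alpha(f)$ and $\alpha(f_w)=\alpha(f)$ for all $f\in L^\infty(\mathbb T)$, $w\in\mathbb T$. $\mathcal S$ is the set of symmetric gauge seminorms, i.e. seminorms $\beta$ on $L^\infty(\mathbb T)$ with $\beta(1)=1$, $\beta(|f|)=\beta(f)$ and $\beta(f\circ\phi)=\beta(f)$ for all $f\in L^\infty(\mathbb T)$ and all invertible measure-preserving maps $\phi:\mathbb T\to\mathbb T$; thus $\mathcal S\subset\mathcal R$. Such a seminorm $\alpha$ is continuous if $\lim_{m(E)\to0^+}\alpha(\chi_E)=0$; $\mathcal R_c$ and $\mathcal S_c$ are the sets of continuous elements of $\mathcal R$ and $\mathcal S$. For any measurable $f:\mathbb T\to\mathbb C$ put $\alpha(f)=\sup\{\alpha(s):s\text{ a simple function},\ |s|\le|f|\}\in[0,\infty]$. $\mathcal L^\alpha(\mathbb T)$ is the set of measurable $f$ with $\alpha(f)<\infty$, and $L^\alpha(\mathbb T)$ is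 the $\alpha$-closure of $L^\infty(\mathbb T)$ in $\mathcal L^\alpha(\mathbb T)$. Norm values $+\infty$ are allowed for unbounded or nonintegrable functions; the right-hand side of (1)(b) is read as $+\infty$ when $\|g\|_\infty=\infty$. *)

theory Defs
  imports "HOL-Probability.Probability" "HOL-Library.Nonpos_Ints"
begin

text \<open>
  Functions on the unit circle are represented by functions on the complex plane of which only the
  values on the circle matter.  Identification of functions that agree almost everywhere is
  expressed by requiring, in every notion below, invariance under a.e.\ equality instead of passing
  to a quotient.
\<close>

abbreviation unit_circle :: "complex set" where
  "unit_circle \<equiv> sphere 0 1"

text \<open>Normalized arc length: the image of the uniform distribution on $[0, 2\pi)$ under
  $t \mapsto e^{it}$.\<close>

definition arc_measure :: "complex measure" where
  "arc_measure =
     distr (uniform_measure lborel {0..<2 * pi}) (restrict_space borel unit_circle) cis"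

lemma space_arc_measure: "space arc_measure = unit_circle"
  by (simp add: arc_measure_def space_restrict_space)

lemma sets_arc_measure: "sets arc_measure = sets (restrict_space borel unit_circle)"
  by (simp add: arc_measure_def)

lemma prob_space_arc_measure: "prob_space arc_measure"
proof -
  have "cis \<in> uniform_measure lborel {0..<2 * pi} \<rightarrow>\<^sub>M restrict_space borel unit_circle"
    by (intro measurable_restrict_space2)
       (auto simp: measurable_def[of "uniform_measure _ _"] space_uniform_measure
         intro!: measurable_sets_borel borel_measurable_continuous_onI continuous_intros)
  moreover have "prob_space (uniform_measure lborel {0..<2 * pi})"
    by (intro prob_space_uniform_measure) auto
  ultimately show ?thesis
    unfolding arc_measure_def by (intro prob_space.prob_space_distr)
qed

definition Linf_norm :: "(complex \<Rightarrow> complex) \<Rightarrow> ennreal" where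
  "Linf_norm f = esssup arc_measure (\<lambda>z. ennreal (norm (f z)))"

definition Linf :: "(complex \<Rightarrow> complex) set" where
  "Linf = {f \<in> borel_measurable arc_measure. Linf_norm f < \<infinity>}"

definition L1_norm :: "(complex \<Rightarrow> complex) \<Rightarrow> ennreal" where
  "L1_norm f = (\<integral>\<^sup>+ z. ennreal (norm (f z)) \<partial>arc_measure)"

definition L1 :: "(complex \<Rightarrow> complex) set" where
  "L1 = {f. integrable arc_measure f}"

definition continuous_functions :: "(complex \<Rightarrow> complex) set" where
  "continuous_functions = {f. continuous_on unit_circle f}"

text \<open>The first condition says that \<open>\<alpha>\<close> is defined on a.e.\ classes.  The values of \<open>\<alpha>\<close> outside
  \<^const>\<open>Linf\<close> are irrelevant.\<close>

definition seminorm_Linf :: "((complex \<Rightarrow> complex) \<Rightarrow> real) \<Rightarrow> bool" where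
  "seminorm_Linf \<alpha> \<longleftrightarrow>
     (\<forall>f\<in>Linf. \<forall>g\<in>Linf. (AE z in arc_measure. f z = g z) \<longrightarrow> \<alpha> f = \<alpha> g) \<and>
     (\<forall>f\<in>Linf. 0 \<le> \<alpha> f) \<and>
     (\<forall>f\<in>Linf. \<forall>g\<in>Linf. \<alpha> (\<lambda>z. f z + g z) \<le> \<alpha> f + \<alpha> g) \<and>
     (\<forall>f\<in>Linf. \<forall>c. \<alpha> (\<lambda>z. c * f z) = norm c * \<alpha> f)"

definition rotation_symmetric_seminorms :: "((complex \<Rightarrow> complex) \<Rightarrow> real) set" where
  "rotation_symmetric_seminorms =
     {\<alpha>. seminorm_Linf \<alpha> \<and>
         \<alpha> (\<lambda>z. 1) = 1 \<and>
         (\<forall>f\<in>Linf. \<alpha> (\<lambda>z. of_real (norm (f z))) = \<alpha> f) \<and>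
         (\<forall>f\<in>Linf. \<forall>w\<in>unit_circle. \<alpha> (\<lambda>z. f (cnj w * z)) = \<alpha> f)}"

definition invertible_measure_preserving :: "(complex \<Rightarrow> complex) \<Rightarrow> bool" where
  "invertible_measure_preserving \<phi> \<longleftrightarrow>
     \<phi> \<in> arc_measure \<rightarrow>\<^sub>M arc_measure \<and>
     bij_betw \<phi> unit_circle unit_circle \<and>
     the_inv_into unit_circle \<phi> \<in> arc_measure \<rightarrow>\<^sub>M arc_measure \<and>
     distr arc_measure arc_measure \<phi> = arc_measure"

definition symmetric_gauge_seminorms :: "((complex \<Rightarrow> complex) \<Rightarrow> real) set" where
  "symmetric_gauge_seminorms =
     {\<beta>. seminorm_Linf \<beta> \<and>
         \<beta> (\<lambda>z. 1) = 1 \<and>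
         (\<forall>f\<in>Linf. \<beta> (\<lambda>z. of_real (norm (f z))) = \<beta> f) \<and>
         (\<forall>f\<in>Linf. \<forall>\<phi>. invertible_measure_preserving \<phi> \<longrightarrow> \<beta> (f \<circ> \<phi>) = \<beta> f)}"

abbreviation char_fun :: "complex set \<Rightarrow> complex \<Rightarrow> complex" where
  "char_fun E \<equiv> indicator E"

text \<open>The filter on sets describing $m(E) \to 0^+$.\<close>

definition small_sets :: "complex set filter" where
  "small_sets =
     inf (filtercomap (measure arc_measure) (at_right 0)) (principal (sets arc_measure))"

lemma eventually_small_sets:
  "eventually P small_sets \<longleftrightarrow>
     (\<exists>\<delta>>0. \<forall>E\<in>sets arc_measure. 0 < measure arc_measure E \<and> measure arc_measure E < \<delta> \<longrightarrow> P E)"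
proof -
  have "eventually P small_sets \<longleftrightarrow>
      (\<exists>Q. (\<exists>\<delta>>0. \<forall>y>0. y < \<delta> \<longrightarrow> Q y) \<and>
           (\<forall>E. Q (measure arc_measure E) \<longrightarrow> E \<in> sets arc_measure \<longrightarrow> P E))"
    by (simp add: small_sets_def eventually_inf_principal eventually_filtercomap
        eventually_at_right_field)
  also have "\<dots> \<longleftrightarrow> (\<exists>\<delta>>0. \<forall>E\<in>sets arc_measure.
      0 < measure arc_measure E \<and> measure arc_measure E < \<delta> \<longrightarrow> P E)"
  proof safe
    fix \<delta> :: real
    assume "0 < \<delta>" and
      *: "\<forall>E\<in>sets arc_measure. 0 < measure arc_measure E \<and> measure arc_measure E < \<delta> \<longrightarrow> P E"
    then show "\<exists>Q. (\<exists>\<delta>>0. \<forall>y>0. y < \<delta> \<longrightarrow> Q y) \<and>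
           (\<forall>E. Q (measure arc_measure E) \<longrightarrow> E \<in> sets arc_measure \<longrightarrow> P E)"
      by (intro exI[of _ "\<lambda>y. 0 < y \<and> y < \<delta>"]) auto
  qed blast
  finally show ?thesis .
qed

definition continuous_seminorm :: "((complex \<Rightarrow> complex) \<Rightarrow> real) \<Rightarrow> bool" where
  "continuous_seminorm \<alpha> \<longleftrightarrow> ((\<lambda>E. \<alpha> (char_fun E)) \<longlongrightarrow> 0) small_sets"

definition continuous_rotation_symmetric_seminorms :: "((complex \<Rightarrow> complex) \<Rightarrow> real) set" where
  "continuous_rotation_symmetric_seminorms =
     {\<alpha> \<in> rotation_symmetric_seminorms. continuous_seminorm \<alpha>}"

definition continuous_symmetric_gauge_seminorms :: "((complex \<Rightarrow> complex) \<Rightarrow> real) set" where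
  "continuous_symmetric_gauge_seminorms =
     {\<beta> \<in> symmetric_gauge_seminorms. continuous_seminorm \<beta>}"

definition equivalent_to_Linf_norm :: "((complex \<Rightarrow> complex) \<Rightarrow> real) \<Rightarrow> bool" where
  "equivalent_to_Linf_norm \<alpha> \<longleftrightarrow>
     (\<exists>c>0. \<exists>C>0. \<forall>f\<in>Linf.
        ennreal c * Linf_norm f \<le> ennreal (\<alpha> f) \<and> ennreal (\<alpha> f) \<le> ennreal C * Linf_norm f)"

text \<open>The extension of \<open>\<alpha>\<close> to all measurable functions.\<close>

definition ext_seminorm :: "((complex \<Rightarrow> complex) \<Rightarrow> real) \<Rightarrow> (complex \<Rightarrow> complex) \<Rightarrow> ennreal" where
  "ext_seminorm \<alpha> f =
     (SUP s \<in> {s. simple_function arc_measure s \<and>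
                  (AE z in arc_measure. norm (s z) \<le> norm (f z))}. ennreal (\<alpha> s))"

definition calL :: "((complex \<Rightarrow> complex) \<Rightarrow> real) \<Rightarrow> (complex \<Rightarrow> complex) set" where
  "calL \<alpha> = {f \<in> borel_measurable arc_measure. ext_seminorm \<alpha> f < \<infinity>}"

definition seminorm_closure ::
  "((complex \<Rightarrow> complex) \<Rightarrow> real) \<Rightarrow> (complex \<Rightarrow> complex) set \<Rightarrow> (complex \<Rightarrow> complex) set" where
  "seminorm_closure \<alpha> A =
     {f \<in> calL \<alpha>. \<forall>e>0. \<exists>g\<in>A. ext_seminorm \<alpha> (\<lambda>z. f z - g z) < e}"

definition L_space :: "((complex \<Rightarrow> complex) \<Rightarrow> real) \<Rightarrow> (complex \<Rightarrow> complex) set" where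
  "L_space \<alpha> = seminorm_closure \<alpha> Linf"

text \<open>\<open>V\<close> is a complex vector space of functions and \<open>N\<close> induces a (finite-valued) norm on the
  space of a.e.\ classes of members of \<open>V\<close>.\<close>

definition norm_on ::
  "(complex \<Rightarrow> complex) set \<Rightarrow> ((complex \<Rightarrow> complex) \<Rightarrow> ennreal) \<Rightarrow> bool" where
  "norm_on V N \<longleftrightarrow>
     (\<lambda>z. 0) \<in> V \<and>
     (\<forall>f\<in>V. \<forall>g\<in>V. (\<lambda>z. f z + g z) \<in> V) \<and>
     (\<forall>f\<in>V. \<forall>c. (\<lambda>z. c * f z) \<in> V) \<and>
     (\<forall>f\<in>V. N f < \<infinity>) \<and>
     (\<forall>f\<in>V. \<forall>g\<in>V. (AE z in arc_measure. f z = g z) \<longrightarrow> N f = N g) \<and>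
     (\<forall>f\<in>V. N f = 0 \<longleftrightarrow> (AE z in arc_measure. f z = 0)) \<and>
     (\<forall>f\<in>V. \<forall>g\<in>V. N (\<lambda>z. f z + g z) \<le> N f + N g) \<and>
     (\<forall>f\<in>V. \<forall>c. N (\<lambda>z. c * f z) = ennreal (norm c) * N f)"

definition banach_space_on ::
  "(complex \<Rightarrow> complex) set \<Rightarrow> ((complex \<Rightarrow> complex) \<Rightarrow> ennreal) \<Rightarrow> bool" where
  "banach_space_on V N \<longleftrightarrow>
     norm_on V N \<and>
     (\<forall>F :: nat \<Rightarrow> complex \<Rightarrow> complex.
        (\<forall>n. F n \<in> V) \<and>
        (\<forall>e>0. \<exists>K. \<forall>i\<ge>K. \<forall>j\<ge>K. N (\<lambda>z. F i z - F j z) < e) \<longrightarrow>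
        (\<exists>h\<in>V. (\<lambda>n. N (\<lambda>z. F n z - h z)) \<longlonglongrightarrow> 0))"

end

theory Submission
  imports Defs
begin

text \<open>
  The key property is continuity under truncation: for simple \<open>s\<close>, \<open>\<alpha> (s * indicator (- A))\<close> tends
  to \<open>\<alpha> s\<close> as \<open>m(A) \<rightarrow> 0\<close>.  For continuous \<open>\<alpha>\<close> it is immediate.  For a symmetric gauge seminorm it
  is proved on one level set \<open>T\<close> of \<open>s\<close> at a time: if \<open>A \<subseteq> T\<close> and \<open>(n + 1) m(A) \<le> m(T)\<close>, there are
  \<open>n + 1\<close> measure-preserving involutions of \<open>T\<close> that move \<open>A\<close> to essentially disjoint sets, and
  averaging \<open>s * indicator (- A)\<close> over them costs at most the fraction \<open>1 / (n + 1)\<close> of \<open>s\<close>.  The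
  involutions are countable patchworks of rotations, found greedily from
  \<open>\<integral> m(A \<inter> w\<^sup>-\<^sup>1 B) dm(w) = m(A) m(B)\<close>.

  Truncation continuity yields Fatou's lemma for the extended seminorm, hence monotone convergence,
  the triangle inequality and completeness.  For the bound by the \<open>L\<^sup>1\<close> norm, a bounded
  function is averaged repeatedly with suitable rotates of itself; this does not increase \<open>\<alpha>\<close>, and
  the averages tend to the mean in \<open>L\<^sup>2\<close>, so they are almost at least the mean outside a small set.

  The exchange involutions also show that a discontinuous symmetric gauge seminorm is bounded below
  on all characteristic functions of sets of positive measure.
\<close>

section \<open>Rotation invariance of arc length\<close>

text \<open>The obstacle is that \<alpha> is bounded only by the essential supremum. Convergence
  almost everywhere is uniform only outside a set of small measure, and \<alpha> need not be small
  on functions living there, as the supremum norm shows. Truncation continuity asks only that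
  cutting such a set away does not lower \<alpha> much; for simple functions this holds even for the
  supremum norm.

  The involutions act inside a level set because s is unchanged by any rearrangement of points where
  it is constant: only the hole A moves, and almost every point lies in at most one of the n + 1
  holes. Rotations suffice as building blocks because the mean overlap of A with the rotates of B is
  positive whenever both have positive measure.

  For the L^1 bound a continuous \<alpha> need not be invariant under patchworks of rotations. Only
  rotations themselves may be used there, which is why convergence of the averages is measured by
  the variance.\<close>

interpretation arc: prob_space arc_measure
  by (rule prob_space_arc_measure)

declare space_arc_measure [simp]

lemma measurable_into_arc_measure:
  assumes "f \<in> borel_measurable N" "\<And>x. x \<in> space N \<Longrightarrow> f x \<in> unit_circle"
  shows "f \<in> N \<rightarrow>\<^sub>M arc_measure"
proof -
  have "f \<in> N \<rightarrow>\<^sub>M restrict_space borel unit_circle"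
    using assms by (intro measurable_restrict_space2) auto
  then show ?thesis
    by (simp add: measurable_cong_sets[OF refl sets_arc_measure])
qed

lemma borel_measurable_arc_measure:
  "f \<in> borel_measurable borel \<Longrightarrow> f \<in> borel_measurable arc_measure"
  by (simp add: measurable_cong_sets[OF sets_arc_measure refl] measurable_restrict_space1)

lemma ident_borel_measurable_arc_measure [measurable]: "(\<lambda>z. z) \<in> borel_measurable arc_measure"
  by (rule borel_measurable_arc_measure) simp

lemma borel_measurable_of_arc_measure:
  assumes "f \<in> N \<rightarrow>\<^sub>M arc_measure"
  shows "f \<in> borel_measurable N"
  using measurable_comp[OF assms ident_borel_measurable_arc_measure] by (simp add: comp_def)

lemma mult_measurable_arc_measure [measurable]:
  assumes "f \<in> N \<rightarrow>\<^sub>M arc_measure" "g \<in> N \<rightarrow>\<^sub>M arc_measure"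
  shows "(\<lambda>x. f x * g x) \<in> N \<rightarrow>\<^sub>M arc_measure"
proof (rule measurable_into_arc_measure)
  show "(\<lambda>x. f x * g x) \<in> borel_measurable N"
    using assms[THEN borel_measurable_of_arc_measure] by measurable
  show "f x * g x \<in> unit_circle" if "x \<in> space N" for x
    using that assms[THEN measurable_space] by (auto simp: norm_mult)
qed

lemma cis_measurable_arc_measure [measurable]: "cis \<in> borel \<rightarrow>\<^sub>M arc_measure"
  by (rule measurable_into_arc_measure)
     (auto intro!: borel_measurable_continuous_onI continuous_intros)

lemma emeasure_arc_measure:
  assumes "A \<in> sets arc_measure"
  shows "emeasure arc_measure A = emeasure lborel ({0..<2 * pi} \<inter> cis -` A) / ennreal (2 * pi)"
proof -
  let ?U = "uniform_measure lborel {0..<2 * pi}"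
  have cis: "cis \<in> ?U \<rightarrow>\<^sub>M restrict_space borel unit_circle"
    using cis_measurable_arc_measure
    by (simp add: measurable_cong_sets[OF refl sets_arc_measure]
        measurable_cong_sets[of ?U borel, OF _ refl])
  have "cis -` A \<in> sets borel"
    using measurable_sets[OF cis_measurable_arc_measure assms] by simp
  then show ?thesis
    using assms unfolding arc_measure_def
    by (subst emeasure_distr[OF cis]) (auto simp: space_uniform_measure)
qed

lemma emeasure_lborel_shift:
  assumes "X \<in> sets borel"
  shows "emeasure lborel ((\<lambda>t. t + c) -` X) = emeasure lborel (X :: real set)"
proof -
  have "emeasure lborel X = emeasure (distr lborel borel ((+) c)) X"
    using lborel_distr_plus[of c] by simp
  also have "\<dots> = emeasure lborel ((+) c -` X)"
    using assms by (subst emeasure_distr) auto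
  also have "(+) c -` X = (\<lambda>t. t + c) -` X"
    by (auto simp: add.commute)
  finally show ?thesis by simp
qed

text \<open>The window of angles shifted by \<theta> is
  \<open>{\<theta>..<\<theta> + 2 * pi}\<close>; its piece beyond 2 pi wraps around to
  \<open>{0..<\<theta>}\<close> by periodicity.\<close>

lemma emeasure_periodic_shift:
  assumes X: "X \<in> sets borel" and per: "\<And>t::real. t + 2 * pi \<in> X \<longleftrightarrow> t \<in> X"
    and \<theta>: "0 \<le> \<theta>" "\<theta> < 2 * pi"
  shows "emeasure lborel ({0..<2 * pi} \<inter> (\<lambda>t. t + \<theta>) -` X) = emeasure lborel ({0..<2 * pi} \<inter> X)"
proof -
  let ?\<mu> = "emeasure lborel"
  have "?\<mu> ({0..<2 * pi} \<inter> (\<lambda>t. t + \<theta>) -` X) = ?\<mu> ((\<lambda>t. t + \<theta>) -` ({\<theta>..<\<theta> + 2 * pi} \<inter> X))"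
    by (rule arg_cong[where f = ?\<mu>]) auto
  also have "\<dots> = ?\<mu> ({\<theta>..<\<theta> + 2 * pi} \<inter> X)"
    using X by (intro emeasure_lborel_shift) auto
  also have "{\<theta>..<\<theta> + 2 * pi} \<inter> X = ({\<theta>..<2 * pi} \<inter> X) \<union> ({2 * pi..<\<theta> + 2 * pi} \<inter> X)"
    using \<theta> by auto
  also have "?\<mu> \<dots> = ?\<mu> ({\<theta>..<2 * pi} \<inter> X) + ?\<mu> ({2 * pi..<\<theta> + 2 * pi} \<inter> X)"
    using X by (intro plus_emeasure[symmetric]) auto
  also have "?\<mu> ({2 * pi..<\<theta> + 2 * pi} \<inter> X)
      = ?\<mu> ((\<lambda>t. t + 2 * pi) -` ({2 * pi..<\<theta> + 2 * pi} \<inter> X))"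
    using X by (intro emeasure_lborel_shift[symmetric]) auto
  also have "(\<lambda>t. t + 2 * pi) -` ({2 * pi..<\<theta> + 2 * pi} \<inter> X) = {0..<\<theta>} \<inter> X"
    by (auto simp: per)
  also have "?\<mu> ({\<theta>..<2 * pi} \<inter> X) + ?\<mu> ({0..<\<theta>} \<inter> X)
      = ?\<mu> (({\<theta>..<2 * pi} \<inter> X) \<union> ({0..<\<theta>} \<inter> X))"
    using X by (intro plus_emeasure) auto
  also have "({\<theta>..<2 * pi} \<inter> X) \<union> ({0..<\<theta>} \<inter> X) = {0..<2 * pi} \<inter> X"
    using \<theta> by auto
  finally show ?thesis .
qed

lemma rotation_measurable [measurable]:
  "w \<in> unit_circle \<Longrightarrow> (\<lambda>z. w * z) \<in> arc_measure \<rightarrow>\<^sub>M arc_measure"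
  by (intro mult_measurable_arc_measure) auto

text \<open>With w = \<open>cis \<theta>\<close> the rotation becomes a translation of the angle by
  \<theta>, and preimages under \<open>cis\<close> are 2 pi-periodic, so
  \<open>emeasure_periodic_shift\<close> applies.\<close>

lemma distr_rotation:
  assumes w: "w \<in> unit_circle"
  shows "distr arc_measure arc_measure (\<lambda>z. w * z) = arc_measure"
proof (rule measure_eqI)
  fix A assume "A \<in> sets (distr arc_measure arc_measure ((*) w))"
  then have A: "A \<in> sets arc_measure" by simp
  have "(Re w)\<^sup>2 + (Im w)\<^sup>2 = 1"
    using w by (simp add: cmod_power2[symmetric])
  then obtain \<theta> where \<theta>: "0 \<le> \<theta>" "\<theta> < 2 * pi" "Re w = cos \<theta>" "Im w = sin \<theta>"
    using sincos_total_2pi by metis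
  then have w_eq: "w = cis \<theta>" by (simp add: complex_eq_iff)
  define B where "B = (\<lambda>z. w * z) -` A \<inter> unit_circle"
  have B: "B \<in> sets arc_measure"
    using measurable_sets[OF rotation_measurable[OF w] A] by (simp add: B_def)
  have "emeasure (distr arc_measure arc_measure (\<lambda>z. w * z)) A = emeasure arc_measure B"
    using A w by (subst emeasure_distr) (auto simp: B_def)
  also have "\<dots> = emeasure lborel ({0..<2 * pi} \<inter> cis -` B) / ennreal (2 * pi)"
    by (rule emeasure_arc_measure[OF B])
  also have "cis -` B = (\<lambda>t. t + \<theta>) -` (cis -` A)"
    by (auto simp: B_def w_eq cis_mult add.commute)
  also have "emeasure lborel ({0..<2 * pi} \<inter> \<dots>) = emeasure lborel ({0..<2 * pi} \<inter> cis -` A)"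
    using measurable_sets[OF cis_measurable_arc_measure A] \<theta>
    by (intro emeasure_periodic_shift) (auto simp flip: cis_mult)
  also have "\<dots> / ennreal (2 * pi) = emeasure arc_measure A"
    by (rule emeasure_arc_measure[OF A, symmetric])
  finally show "emeasure (distr arc_measure arc_measure ((*) w)) A = emeasure arc_measure A" .
qed simp

lemma emeasure_rotation:
  assumes "w \<in> unit_circle" "A \<in> sets arc_measure"
  shows "emeasure arc_measure {z \<in> unit_circle. w * z \<in> A} = emeasure arc_measure A"
proof -
  have "emeasure arc_measure A = emeasure (distr arc_measure arc_measure (\<lambda>z. w * z)) A"
    using assms by (simp add: distr_rotation)
  also have "\<dots> = emeasure arc_measure {z \<in> unit_circle. w * z \<in> A}"
    using assms by (subst emeasure_distr) (auto intro!: arg_cong[where f = "emeasure _"])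
  finally show ?thesis by simp
qed

lemma integral_rotation:
  assumes "w \<in> unit_circle" "f \<in> borel_measurable arc_measure"
  shows "(LINT z|arc_measure. f (w * z)) = (LINT z|arc_measure. f z :: real)"
  using integral_distr[OF rotation_measurable[OF assms(1)] assms(2)] assms(1)
  by (simp add: distr_rotation)

section \<open>Correlations with rotates, overlaps and small sets\<close>

lemma integrable_arc_measure_bounded:
  fixes u :: "complex \<Rightarrow> real"
  assumes "u \<in> borel_measurable arc_measure" "AE z in arc_measure. \<bar>u z\<bar> \<le> K"
  shows "integrable arc_measure u"
  by (rule arc.integrable_const_bound) (use assms in auto)

text \<open>Fubini: for fixed z, the function \<open>v (w * z)\<close> of w is the rotate of v by z,
  because multiplication commutes, so its integral does not depend on z. This identity takes the
  place of ergodicity of the rotations.\<close>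

lemma integral_correlation:
  fixes u v :: "complex \<Rightarrow> real"
  assumes u [measurable]: "u \<in> borel_measurable arc_measure"
    and v [measurable]: "v \<in> borel_measurable arc_measure"
    and bu: "\<And>z. z \<in> unit_circle \<Longrightarrow> \<bar>u z\<bar> \<le> K" and bv: "\<And>z. z \<in> unit_circle \<Longrightarrow> \<bar>v z\<bar> \<le> L"
  shows "integrable arc_measure (\<lambda>w. LINT z|arc_measure. u z * v (w * z))"
    and "(LINT w|arc_measure. LINT z|arc_measure. u z * v (w * z))
      = (LINT z|arc_measure. u z) * (LINT z|arc_measure. v z)"
proof -
  interpret pair_sigma_finite arc_measure arc_measure ..
  interpret P: finite_measure "arc_measure \<Otimes>\<^sub>M arc_measure"
    by (intro finite_measure_pair_measure) unfold_locales
  have mv: "(\<lambda>x. v (fst x * snd x)) \<in> borel_measurable (arc_measure \<Otimes>\<^sub>M arc_measure)"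
    by measurable
  have bnd: "\<bar>u (snd x) * v (fst x * snd x)\<bar> \<le> K * L"
    if "x \<in> space (arc_measure \<Otimes>\<^sub>M arc_measure)" for x
  proof -
    have c: "snd x \<in> unit_circle" "fst x * snd x \<in> unit_circle"
      using that by (auto simp: space_pair_measure norm_mult)
    show ?thesis
      unfolding abs_mult using bu[OF c(1)] bv[OF c(2)] by (intro mult_mono) auto
  qed
  have int: "integrable (arc_measure \<Otimes>\<^sub>M arc_measure) (\<lambda>x. u (snd x) * v (fst x * snd x))"
    using mv bnd by (intro P.integrable_const_bound[where B = "K * L"]) auto
  then have int': "integrable (arc_measure \<Otimes>\<^sub>M arc_measure) (\<lambda>(w, z). u z * v (w * z))"
    by (simp add: case_prod_beta')
  show "integrable arc_measure (\<lambda>w. LINT z|arc_measure. u z * v (w * z))"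
    using integrable_fst[OF int'] by simp
  have "(LINT w|arc_measure. LINT z|arc_measure. u z * v (w * z))
      = (LINT z|arc_measure. LINT w|arc_measure. u z * v (w * z))"
    using Fubini_integral[OF int'] by simp
  also have "\<dots> = (LINT z|arc_measure. u z * (LINT w|arc_measure. v w))"
  proof (rule Bochner_Integration.integral_cong[OF refl])
    fix z assume "z \<in> space arc_measure"
    then show "(LINT w|arc_measure. u z * v (w * z)) = u z * (LINT w|arc_measure. v w)"
      using integral_rotation[of z v] by (simp add: mult.commute)
  qed
  finally show "(LINT w|arc_measure. LINT z|arc_measure. u z * v (w * z))
      = (LINT z|arc_measure. u z) * (LINT z|arc_measure. v z)"
    by simp
qed

text \<open>Some w attains at least the mean overlap, which \<open>integral_correlation\<close>
  computes. The quantitative bound drives the greedy construction in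
  \<open>exchange_involution\<close>.\<close>

lemma exists_rotation_large_overlap:
  assumes [measurable]: "A \<in> sets arc_measure" "B \<in> sets arc_measure"
  obtains w where "w \<in> unit_circle"
    "measure arc_measure A * measure arc_measure B
      \<le> measure arc_measure {z \<in> A. w * z \<in> B}"
proof -
  let ?c = "\<lambda>w. LINT z|arc_measure. indicator A z * (indicator B (w * z) :: real)"
  note corr = integral_correlation[of "indicator A" "indicator B" 1 1]
  have int: "integrable arc_measure ?c"
    and eq: "(LINT w|arc_measure. ?c w) = measure arc_measure A * measure arc_measure B"
    using corr sets.Int_space_eq2[of _ arc_measure] assms by auto
  have "\<exists>w\<in>unit_circle. measure arc_measure A * measure arc_measure B \<le> ?c w"
  proof (rule ccontr)
    assume *: "\<not> ?thesis"
    have "(LINT w|arc_measure. ?c w) < measure arc_measure A * measure arc_measure B"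
      using * int by (intro arc.expectation_less) (auto simp: not_le)
    with eq show False by simp
  qed
  then obtain w where w: "w \<in> unit_circle" "measure arc_measure A * measure arc_measure B \<le> ?c w"
    by blast
  have "?c w = (LINT z|arc_measure. indicator {z \<in> A. w * z \<in> B} z)"
    by (intro Bochner_Integration.integral_cong) (auto simp: indicator_def)
  also have "\<dots> = measure arc_measure {z \<in> A. w * z \<in> B}"
    using sets.sets_into_space[of A arc_measure] by (auto intro!: arg_cong[where f = "measure _"])
  finally show thesis using that w by simp
qed

lemma exists_small_set:
  assumes "0 < \<delta>"
  obtains C where "C \<in> sets arc_measure" "0 < measure arc_measure C" "measure arc_measure C < \<delta>"
proof -
  \<comment> \<open>The cap at 1 keeps \<open>\<epsilon>\<close> below pi, where cos is
    decreasing.\<close>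
  define \<epsilon> where "\<epsilon> = min \<delta> 1"
  have \<epsilon>: "0 < \<epsilon>" "\<epsilon> \<le> 1" "\<epsilon> \<le> \<delta>" "\<epsilon> < pi" "\<epsilon> \<le> 2 * pi"
    using assms pi_gt3 by (auto simp: \<epsilon>_def)
  \<comment> \<open>The open arc of angles between 0 and \<open>\<epsilon>\<close>, written through
    Re and Im so that measurability is immediate.\<close>
  define C where "C = {z \<in> space arc_measure. cos \<epsilon> < Re z \<and> 0 < Im z}"
  have C: "C \<in> sets arc_measure"
    unfolding C_def by measurable
  have "{0..<2 * pi} \<inter> cis -` C = {0<..<\<epsilon>}"
  proof (rule set_eqI)
    fix t
    show "t \<in> {0..<2 * pi} \<inter> cis -` C \<longleftrightarrow> t \<in> {0<..<\<epsilon>}"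
    proof
      assume t: "t \<in> {0..<2 * pi} \<inter> cis -` C"
      then have "0 < sin t" "cos \<epsilon> < cos t" by (auto simp: C_def)
      moreover from this t have "t < pi"
        using sin_le_zero[of t] by (auto simp: not_le[symmetric])
      ultimately show "t \<in> {0<..<\<epsilon>}"
        using t \<epsilon> cos_monotone_0_pi_le[of \<epsilon> t] by (cases "t = 0") (auto simp: not_less[symmetric])
    next
      assume "t \<in> {0<..<\<epsilon>}"
      then show "t \<in> {0..<2 * pi} \<inter> cis -` C"
        using \<epsilon> cos_monotone_0_pi[of t \<epsilon>] by (auto simp: C_def intro!: sin_gt_zero)
    qed
  qed
  then have "emeasure arc_measure C = ennreal (\<epsilon> / (2 * pi))"
    using \<epsilon> by (simp add: emeasure_arc_measure[OF C] divide_ennreal)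
  then have "measure arc_measure C = \<epsilon> / (2 * pi)"
    using \<epsilon> by (simp add: measure_def)
  moreover have "\<epsilon> / (2 * pi) < \<epsilon>"
    using \<epsilon> pi_gt3 by (simp add: field_simps)
  ultimately show thesis
    using that[OF C] \<epsilon> by simp
qed

text \<open>A small arc C may miss A, but some rotate of it meets A in measure at least m(A) m(C) >
  0.\<close>

lemma exists_small_subset:
  assumes A: "A \<in> sets arc_measure" and pos: "0 < measure arc_measure A" and "0 < \<delta>"
  obtains B where "B \<in> sets arc_measure" "B \<subseteq> A" "0 < measure arc_measure B"
    "measure arc_measure B < \<delta>"
proof -
  obtain C where C: "C \<in> sets arc_measure" "0 < measure arc_measure C" "measure arc_measure C < \<delta>"
    using exists_small_set[OF \<open>0 < \<delta>\<close>] .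
  obtain w where w: "w \<in> unit_circle"
    "measure arc_measure A * measure arc_measure C \<le> measure arc_measure {z \<in> A. w * z \<in> C}"
    using exists_rotation_large_overlap[OF A C(1)] .
  have rot: "{z \<in> unit_circle. w * z \<in> C} \<in> sets arc_measure"
    using measurable_sets[OF rotation_measurable[OF w(1)] C(1)]
    by (simp add: vimage_def Int_def conj_commute)
  have eq: "{z \<in> A. w * z \<in> C} = A \<inter> {z \<in> unit_circle. w * z \<in> C}"
    using sets.sets_into_space[OF A] by auto
  show thesis
  proof
    show "{z \<in> A. w * z \<in> C} \<in> sets arc_measure"
      unfolding eq using A rot by auto
    show "0 < measure arc_measure {z \<in> A. w * z \<in> C}"
      using w(2) mult_pos_pos[OF pos C(2)] by linarith
    have "measure arc_measure {z \<in> A. w * z \<in> C} \<le> measure arc_measure {z \<in> unit_circle. w * z \<in> C}"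
      unfolding eq using rot by (intro arc.finite_measure_mono) auto
    also have "\<dots> = measure arc_measure C"
      using emeasure_rotation[OF w(1) C(1)] by (simp add: measure_def)
    finally show "measure arc_measure {z \<in> A. w * z \<in> C} < \<delta>"
      using C(3) by simp
  qed auto
qed

text \<open>Without this, statements that hold eventually along the filter would be vacuous, and a
  limit would not determine the upper limit.\<close>

lemma small_sets_neq_bot: "small_sets \<noteq> bot"
  unfolding trivial_limit_def eventually_small_sets
  by (metis exists_small_set)

text \<open>A measurable involution whose multipliers \<open>\<phi> z / z\<close> take countably many values is a
  countable patchwork of rotations.\<close>

lemma invertible_measure_preserving_piecewise_rotation:
  assumes \<phi> [measurable]: "\<phi> \<in> arc_measure \<rightarrow>\<^sub>M arc_measure"
    and inv: "\<And>z. z \<in> unit_circle \<Longrightarrow> \<phi> (\<phi> z) = z"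
    and W: "countable W" "W \<subseteq> unit_circle" "\<And>z. z \<in> unit_circle \<Longrightarrow> \<exists>w\<in>W. \<phi> z = w * z"
  shows "invertible_measure_preserving \<phi>"
proof -
  have space: "\<phi> z \<in> unit_circle" if "z \<in> unit_circle" for z
    using measurable_space[OF \<phi>] that by simp
  have bij: "bij_betw \<phi> unit_circle unit_circle"
    using inv space by (intro bij_betw_byWitness[where f' = \<phi>]) auto
  have inv_eq: "the_inv_into unit_circle \<phi> z = \<phi> z" if "z \<in> unit_circle" for z
    using bij inv space that by (auto simp: bij_betw_def intro!: the_inv_into_f_eq)
  have [measurable]: "\<phi> \<in> borel_measurable arc_measure"
    by (rule borel_measurable_of_arc_measure) measurable
  have "the_inv_into unit_circle \<phi> \<in> arc_measure \<rightarrow>\<^sub>M arc_measure"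
    using \<phi> by (subst measurable_cong[where g = \<phi>]) (simp_all add: inv_eq)
  moreover have "distr arc_measure arc_measure \<phi> = arc_measure"
  proof (rule measure_eqI)
    fix E assume "E \<in> sets (distr arc_measure arc_measure \<phi>)"
    then have E [measurable]: "E \<in> sets arc_measure" by simp
    have Ec: "E \<subseteq> unit_circle" using sets.sets_into_space[OF E] by simp
    \<comment> \<open>\<open>P w\<close> is the part of the preimage of E on which \<phi> is
      multiplication by w. Since \<phi> is an involution, the condition in \<open>Q w\<close> says
      that z is w times \<phi> z, so \<open>Q w\<close> is \<open>P w\<close> rotated by w. The
      \<open>P w\<close> partition the preimage of E, the \<open>Q w\<close> partition E.\<close>
    define P where "P w = {z \<in> space arc_measure. \<phi> z = w * z \<and> \<phi> z \<in> E}" for w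
    define Q where "Q w = {z \<in> space arc_measure. \<phi> (\<phi> z) = w * \<phi> z \<and> z \<in> E}" for w
    have [measurable]: "P w \<in> sets arc_measure" "Q w \<in> sets arc_measure" for w
      unfolding P_def Q_def using measurable_compose[OF \<phi> \<open>\<phi> \<in> borel_measurable arc_measure\<close>]
      by measurable
    have uniq: "w = w'" if "z \<in> unit_circle" "x = w * z" "x = w' * z" for x w w' z :: complex
      using that by auto
    have disjP: "disjoint_family_on P W"
      by (auto simp: disjoint_family_on_def P_def)
    have disjQ: "disjoint_family_on Q W"
    proof -
      have "w = w'" if "z \<in> Q w" "z \<in> Q w'" for w w' z
        using that space[of z] by (intro uniq[of "\<phi> z" "\<phi> (\<phi> z)" w w']) (simp_all add: Q_def)
      then show ?thesis by (auto simp: disjoint_family_on_def)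
    qed
    have PQ: "emeasure arc_measure (P w) = emeasure arc_measure (Q w)" if "w \<in> W" for w
    proof -
      have w: "w \<in> unit_circle" using that W by auto
      have "P w = {z \<in> unit_circle. w * z \<in> Q w}"
      proof safe
        fix z assume "z \<in> P w"
        then show "z \<in> unit_circle" "w * z \<in> Q w"
          using space[of z] inv[of z] by (auto simp: P_def Q_def)
      next
        fix z assume z: "z \<in> unit_circle" "w * z \<in> Q w"
        then have wz: "w * z \<in> unit_circle" "w * z \<in> E" "\<phi> (\<phi> (w * z)) = w * \<phi> (w * z)"
          by (auto simp: Q_def)
        then have "w * z = w * \<phi> (w * z)" using inv by simp
        then have "z = \<phi> (w * z)" using w by auto
        then have "\<phi> z = w * z" using inv wz(1) by metis
        then show "z \<in> P w" using z wz by (auto simp: P_def)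
      qed
      then show ?thesis using emeasure_rotation[OF w, of "Q w"] by simp
    qed
    have "emeasure (distr arc_measure arc_measure \<phi>) E
        = emeasure arc_measure (\<phi> -` E \<inter> space arc_measure)"
      by (simp add: emeasure_distr)
    also have "\<phi> -` E \<inter> space arc_measure = (\<Union>w\<in>W. P w)"
      using W(3) by (auto simp: P_def)
    also have "emeasure arc_measure \<dots> = (\<integral>\<^sup>+w. emeasure arc_measure (P w) \<partial>count_space W)"
      using W disjP by (intro emeasure_UN_countable) auto
    also have "\<dots> = (\<integral>\<^sup>+w. emeasure arc_measure (Q w) \<partial>count_space W)"
      by (intro nn_integral_cong) (simp add: PQ)
    also have "\<dots> = emeasure arc_measure (\<Union>w\<in>W. Q w)"
      using W disjQ by (intro emeasure_UN_countable[symmetric]) auto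
    also have "(\<Union>w\<in>W. Q w) = E"
      using W(3)[OF space] Ec by (fastforce simp: Q_def)
    finally show "emeasure (distr arc_measure arc_measure \<phi>) E = emeasure arc_measure E" .
  qed simp
  ultimately show ?thesis
    using bij by (simp add: invertible_measure_preserving_def)
qed

section \<open>Exchanging disjoint sets by a measure-preserving involution\<close>

text \<open>Each stage matches, by one rotation, part of what is left of A with part of what is left
  of B. The matched part has measure at least m(X) m(Y), and m(X) \<le> m(Y) persists because both
  sides lose the same amount. Hence the limit x of m(X) satisfies x \<le> x - x^2, and A is
  exhausted up to a null set. The last conclusion speaks of the preimage of A, as compositions with
  indicators require; it holds only almost everywhere because leftover points stay fixed.\<close>

lemma exchange_involution:
  assumes A: "A \<in> sets arc_measure" and B: "B \<in> sets arc_measure"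
    and disj: "A \<inter> B = {}" and le: "measure arc_measure A \<le> measure arc_measure B"
  obtains \<phi> where "invertible_measure_preserving \<phi>"
    "\<And>z. z \<in> unit_circle \<Longrightarrow> \<phi> (\<phi> z) = z"
    "\<And>z. z \<notin> A \<union> B \<Longrightarrow> \<phi> z = z"
    "AE z in arc_measure. \<phi> z \<in> A \<longrightarrow> z \<in> B"
proof -
  let ?m = "measure arc_measure"
  define W where "W X Y = (SOME w. w \<in> unit_circle \<and> ?m X * ?m Y \<le> ?m {z \<in> X. w * z \<in> Y})" for X Y
  have W: "W X Y \<in> unit_circle \<and> ?m X * ?m Y \<le> ?m {z \<in> X. W X Y * z \<in> Y}"
    if "X \<in> sets arc_measure" "Y \<in> sets arc_measure" for X Y
    unfolding W_def using exists_rotation_large_overlap[OF that] by (rule someI2_ex) blast+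
  \<comment> \<open>The state is the pair of still unmatched parts of A and B.\<close>
  define st where "st = rec_nat (A, B)
    (\<lambda>_ (X, Y). ({z \<in> X. W X Y * z \<notin> Y}, {z \<in> Y. cnj (W X Y) * z \<notin> X}))"
  define X where "X n = fst (st n)" for n
  define Y where "Y n = snd (st n)" for n
  define w where "w n = W (X n) (Y n)" for n
  have X0: "X 0 = A" and Y0: "Y 0 = B"
    by (simp_all add: X_def Y_def st_def)
  have XS: "X (Suc n) = {z \<in> X n. w n * z \<notin> Y n}" and YS: "Y (Suc n) = {z \<in> Y n. cnj (w n) * z \<notin> X n}"
    for n
    by (simp_all add: X_def Y_def st_def w_def split: prod.splits)
  \<comment> \<open>The parts matched at stage n: rotation by \<open>w n\<close> carries
    \<open>C n\<close> onto \<open>D n\<close>, and the conjugate carries it back.\<close>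
  define C where "C n = {z \<in> X n. w n * z \<in> Y n}" for n
  define D where "D n = {z \<in> Y n. cnj (w n) * z \<in> X n}" for n
  have overlap: "{z \<in> S. v * z \<in> T} \<in> sets arc_measure"
    if "S \<in> sets arc_measure" "T \<in> sets arc_measure" "v \<in> unit_circle" for S T v
  proof -
    have "{z \<in> S. v * z \<in> T} = S \<inter> ((\<lambda>z. v * z) -` T \<inter> space arc_measure)"
      using sets.sets_into_space[OF that(1)] by auto
    then show ?thesis
      using measurable_sets[OF rotation_measurable[OF that(3)] that(2)] that(1) by auto
  qed
  have XD: "X (Suc n) = X n - C n" and YD: "Y (Suc n) = Y n - D n" for n
    by (auto simp: XS YS C_def D_def)
  have meas: "X n \<in> sets arc_measure \<and> Y n \<in> sets arc_measure" for n
  proof (induction n)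
    case (Suc n)
    then have "w n \<in> unit_circle" "cnj (w n) \<in> unit_circle"
      using W[of "X n" "Y n"] by (simp_all add: w_def)
    with Suc show ?case
      unfolding XD YD C_def D_def by (intro conjI sets.Diff overlap) auto
  qed (simp add: X0 Y0 A B)
  have wc: "w n \<in> unit_circle" for n
    using W[of "X n" "Y n"] meas by (simp add: w_def)
  have ww: "cnj (w n) * (w n * z) = z" "w n * (cnj (w n) * z) = z" for n z
  proof -
    have "w n * cnj (w n) = 1" using wc[of n] by (simp add: complex_norm_square[symmetric])
    then show "cnj (w n) * (w n * z) = z" "w n * (cnj (w n) * z) = z"
      by (metis mult.assoc mult.commute mult_1)+
  qed
  have [measurable]: "X n \<in> sets arc_measure" "Y n \<in> sets arc_measure" for n
    using meas by auto
  have [measurable]: "C n \<in> sets arc_measure" "D n \<in> sets arc_measure" for n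
    unfolding C_def D_def using meas wc[of n] by (auto intro!: overlap)
  have subs: "X n \<subseteq> unit_circle" "Y n \<subseteq> unit_circle" for n
    using meas[of n] sets.sets_into_space[of _ arc_measure] by simp_all
  have CX: "C n \<subseteq> X n" "D n \<subseteq> Y n" for n
    by (auto simp: C_def D_def)
  have "decseq X" "decseq Y"
    by (auto intro!: decseq_SucI simp: XD YD)
  then have XA: "X n \<subseteq> A" and YB: "Y n \<subseteq> B" for n
    using decseqD[of X 0 n] decseqD[of Y 0 n] X0 Y0 by simp_all
  have CD: "z \<in> C n \<Longrightarrow> w n * z \<in> D n" "z \<in> D n \<Longrightarrow> cnj (w n) * z \<in> C n" for n z
    by (auto simp: C_def D_def ww)
  have mCD: "?m (C n) = ?m (D n)" for n
  proof -
    have "{z \<in> unit_circle. w n * z \<in> D n} = C n"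
      using subs[of n] by (auto simp: C_def D_def ww)
    then show ?thesis
      using emeasure_rotation[OF wc, of "D n" n] by (simp add: measure_def)
  qed
  have mX: "?m (X (Suc n)) = ?m (X n) - ?m (C n)" and mY: "?m (Y (Suc n)) = ?m (Y n) - ?m (D n)" for n
    unfolding XD YD by (intro arc.finite_measure_Diff; simp add: CX)+
  have diff: "?m (X n) \<le> ?m (Y n)" for n
    by (induction n) (auto simp: X0 Y0 le mX mY mCD)
  have step: "?m (X (Suc n)) \<le> ?m (X n) - ?m (X n) * ?m (X n)" for n
  proof -
    have "?m (X n) * ?m (X n) \<le> ?m (X n) * ?m (Y n)"
      by (intro mult_left_mono diff) auto
    also have "\<dots> \<le> ?m (C n)"
      using W[of "X n" "Y n"] by (simp add: C_def w_def)
    finally show ?thesis by (simp add: mX)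
  qed
  have lim: "(\<lambda>n. ?m (X n)) \<longlonglongrightarrow> ?m (\<Inter>n. X n)"
    using \<open>decseq X\<close> by (intro arc.finite_Lim_measure_decseq) auto
  \<comment> \<open>Passing to the limit in \<open>step\<close>: the measure of the leftover is at
    most itself minus its square, hence zero.\<close>
  have "?m (\<Inter>n. X n) \<le> ?m (\<Inter>n. X n) - ?m (\<Inter>n. X n) * ?m (\<Inter>n. X n)"
    by (intro LIMSEQ_le[OF LIMSEQ_Suc[OF lim] tendsto_diff[OF lim tendsto_mult[OF lim lim]]]
        exI[of _ 0] allI impI step)
  then have "?m (\<Inter>n. X n) * ?m (\<Inter>n. X n) \<le> 0" by simp
  then have "?m (\<Inter>n. X n) = 0"
    using not_square_less_zero by (simp add: mult_le_0_iff measure_le_0_iff)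
  then have "emeasure arc_measure (\<Inter>n. X n) = 0"
    by (simp only: arc.emeasure_eq_measure ennreal_0)
  then have null: "AE z in arc_measure. z \<notin> (\<Inter>n. X n)"
    by (intro AE_not_in null_setsI sets.countable_INT) (simp_all add: image_subset_iff meas)
  have disjC: "z \<notin> C b" if "a < b" "z \<in> C a" for a b z
  proof -
    have "X b \<subseteq> X (Suc a)" using decseqD[OF \<open>decseq X\<close>, of "Suc a" b] that(1) by simp
    moreover have "z \<notin> X (Suc a)" using that(2) unfolding XD by simp
    ultimately show ?thesis using CX(1)[of b] by (meson subsetD)
  qed
  have uniqC: "m = n" if "z \<in> C m" "z \<in> C n" for m n z
    using disjC[of m n z] disjC[of n m z] that by (metis linorder_neqE_nat)
  have disjD: "z \<notin> D b" if "a < b" "z \<in> D a" for a b z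
  proof -
    have "Y b \<subseteq> Y (Suc a)" using decseqD[OF \<open>decseq Y\<close>, of "Suc a" b] that(1) by simp
    moreover have "z \<notin> Y (Suc a)" using that(2) unfolding YD by simp
    ultimately show ?thesis using CX(2)[of b] by (meson subsetD)
  qed
  have uniqD: "m = n" if "z \<in> D m" "z \<in> D n" for m n z
    using disjD[of m n z] disjD[of n m z] that by (metis linorder_neqE_nat)
  have CA: "C n \<subseteq> A" "D n \<subseteq> B" for n
    by (rule subset_trans[OF CX(1) XA], rule subset_trans[OF CX(2) YB])
  \<comment> \<open>The unique stage at which z is matched; for unmatched z it is a default that
    \<open>\<phi>\<close> never reads.\<close>
  define N where "N z = (LEAST n. z \<in> C n \<or> z \<in> D n)" for z
  define \<phi> where "\<phi> z = (if \<exists>n. z \<in> C n \<or> z \<in> D n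
    then (if z \<in> A then w (N z) * z else cnj (w (N z)) * z) else z)" for z
  have NC: "N z = n" if "z \<in> C n" for z n
    unfolding N_def
  proof (rule Least_equality)
    show "n \<le> m" if "z \<in> C m \<or> z \<in> D m" for m
      using that \<open>z \<in> C n\<close> uniqC[of z m n] CA disj by blast
  qed (use that in auto)
  have ND: "N z = n" if "z \<in> D n" for z n
    unfolding N_def
  proof (rule Least_equality)
    show "n \<le> m" if "z \<in> C m \<or> z \<in> D m" for m
      using that \<open>z \<in> D n\<close> uniqD[of z m n] CA disj by blast
  qed (use that in auto)
  have \<phi>C: "\<phi> z = w n * z" if "z \<in> C n" for z n
  proof -
    have "z \<in> A" using that CA(1)[of n] by (rule subsetD[rotated])
    then show ?thesis using that NC[OF that] by (auto simp: \<phi>_def)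
  qed
  have \<phi>D: "\<phi> z = cnj (w n) * z" if "z \<in> D n" for z n
  proof -
    have "z \<notin> A" using that CA(2)[of n] disj by (auto dest: subsetD)
    then show ?thesis using that ND[OF that] by (auto simp: \<phi>_def)
  qed
  have \<phi>id: "\<phi> z = z" if "\<And>n. z \<notin> C n" "\<And>n. z \<notin> D n" for z
    using that by (simp add: \<phi>_def)
  have inv: "\<phi> (\<phi> z) = z" for z
  proof -
    consider n where "z \<in> C n" | n where "z \<in> D n" | "\<And>n. z \<notin> C n" "\<And>n. z \<notin> D n" by blast
    then show ?thesis
    proof cases
      case (1 n)
      then show ?thesis using \<phi>D[OF CD(1)[OF 1]] by (simp add: \<phi>C ww)
    next
      case (2 n)
      then show ?thesis using \<phi>C[OF CD(2)[OF 2]] by (simp add: \<phi>D ww)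
    next
      case 3
      then show ?thesis by (simp add: \<phi>id)
    qed
  qed
  have [measurable]: "N \<in> arc_measure \<rightarrow>\<^sub>M count_space UNIV"
    unfolding N_def by measurable
  have "\<phi> \<in> borel_measurable arc_measure"
  proof -
    have wN: "(\<lambda>z. v (N z)) \<in> borel_measurable arc_measure" for v :: "nat \<Rightarrow> complex"
      by (rule measurable_compose[OF \<open>N \<in> arc_measure \<rightarrow>\<^sub>M count_space UNIV\<close>]) simp
    have A_c: "A \<subseteq> space arc_measure" and C_c: "C n \<subseteq> space arc_measure" "D n \<subseteq> space arc_measure" for n
      using sets.sets_into_space A \<open>C n \<in> _\<close> \<open>D n \<in> _\<close> by blast+
    have "{z \<in> space arc_measure. z \<in> A} = A" "{z \<in> space arc_measure. \<exists>n. z \<in> C n \<or> z \<in> D n} = (\<Union>n. C n \<union> D n)"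
      using A_c C_c by blast+
    then have "{z \<in> space arc_measure. z \<in> A} \<in> sets arc_measure"
      "{z \<in> space arc_measure. \<exists>n. z \<in> C n \<or> z \<in> D n} \<in> sets arc_measure"
      using A by simp_all
    then show ?thesis
      unfolding \<phi>_def
      by (intro measurable_If borel_measurable_times wN ident_borel_measurable_arc_measure)
  qed
  then have "\<phi> \<in> arc_measure \<rightarrow>\<^sub>M arc_measure"
    by (rule measurable_into_arc_measure) (use wc in \<open>auto simp: \<phi>_def norm_mult\<close>)
  then have imp: "invertible_measure_preserving \<phi>"
  proof (rule invertible_measure_preserving_piecewise_rotation[OF _ inv])
    \<comment> \<open>The multipliers of \<open>\<phi>\<close> are the chosen rotations, their
      inverses, and 1 for unmatched points.\<close>
    show "countable ({1} \<union> range w \<union> range (\<lambda>n. cnj (w n)))" by auto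
    show "{1} \<union> range w \<union> range (\<lambda>n. cnj (w n)) \<subseteq> unit_circle" using wc by auto
    show "\<exists>v\<in>{1} \<union> range w \<union> range (\<lambda>n. cnj (w n)). \<phi> z = v * z" for z
      by (auto simp: \<phi>_def)
  qed
  show thesis
  proof (rule that[OF imp inv])
    show "\<phi> z = z" if "z \<notin> A \<union> B" for z
      using that CA by (intro \<phi>id) (auto dest: subsetD)
    show "AE z in arc_measure. \<phi> z \<in> A \<longrightarrow> z \<in> B"
      using null
    proof eventually_elim
      case (elim z)
      show ?case
      proof
        assume A: "\<phi> z \<in> A"
        have nC: "z \<notin> C n" for n
        proof
          assume "z \<in> C n"
          then have "\<phi> z \<in> B" using \<phi>C[of z n] CD(1)[of z n] CA(2)[of n] by (simp add: subsetD)
          then show False using A disj by blast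
        qed
        show "z \<in> B"
        proof (rule ccontr)
          assume "z \<notin> B"
          then have "\<phi> z = z" using nC CA(2) by (intro \<phi>id) (auto dest: subsetD)
          then have "z \<in> A" using A by simp
          have "z \<in> X n" for n
            by (induction n) (use \<open>z \<in> A\<close> nC in \<open>auto simp: X0 XD\<close>)
          with elim show False by auto
        qed
      qed
    qed
  qed
qed

section \<open>Essentially bounded functions\<close>

lemma Linf_norm_le_iff:
  assumes [measurable]: "f \<in> borel_measurable arc_measure"
  shows "Linf_norm f \<le> K \<longleftrightarrow> (AE z in arc_measure. ennreal (norm (f z)) \<le> K)"
proof
  assume "Linf_norm f \<le> K"
  then show "AE z in arc_measure. ennreal (norm (f z)) \<le> K"
    using esssup_AE[of "\<lambda>z. ennreal (norm (f z))" arc_measure]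
    unfolding Linf_norm_def by (auto elim: eventually_mono)
qed (auto simp: Linf_norm_def intro!: esssup_I)

lemma LinfI:
  assumes [measurable]: "f \<in> borel_measurable arc_measure"
    and "AE z in arc_measure. norm (f z) \<le> K"
  shows "f \<in> Linf"
proof -
  have "Linf_norm f \<le> ennreal K"
    using assms(2) by (subst Linf_norm_le_iff) (auto elim!: eventually_mono intro!: ennreal_leI)
  then show ?thesis
    unfolding Linf_def by (auto intro: le_less_trans)
qed

lemma Linf_measurable: "f \<in> Linf \<Longrightarrow> f \<in> borel_measurable arc_measure"
  by (simp add: Linf_def)

lemma LinfE:
  assumes "f \<in> Linf"
  obtains K where "0 < K" "AE z in arc_measure. norm (f z) \<le> K"
proof -
  have meas: "f \<in> borel_measurable arc_measure" and fin: "Linf_norm f < \<infinity>"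
    using assms by (auto simp: Linf_def)
  obtain K where K: "Linf_norm f = ennreal K" "0 \<le> K"
    using fin by (cases "Linf_norm f") auto
  have "AE z in arc_measure. ennreal (norm (f z)) \<le> ennreal K"
    using Linf_norm_le_iff[OF meas, of "ennreal K"] K by simp
  then have "AE z in arc_measure. norm (f z) \<le> K + 1"
    by eventually_elim (use K in \<open>simp add: ennreal_le_iff\<close>)
  then show thesis using that[of "K + 1"] K by simp
qed

lemma Linf_add:
  assumes "f \<in> Linf" "g \<in> Linf"
  shows "(\<lambda>z. f z + g z) \<in> Linf"
proof -
  note [measurable] = assms[THEN Linf_measurable]
  obtain K where K: "AE z in arc_measure. norm (f z) \<le> K" using LinfE[OF assms(1)] by metis
  obtain L where L: "AE z in arc_measure. norm (g z) \<le> L" using LinfE[OF assms(2)] by metis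
  show ?thesis
  proof (rule LinfI)
    show "AE z in arc_measure. norm (f z + g z) \<le> K + L"
      using K L by eventually_elim (meson add_mono norm_triangle_le)
  qed measurable
qed

lemma Linf_mult:
  assumes "f \<in> Linf" "g \<in> Linf"
  shows "(\<lambda>z. f z * g z) \<in> Linf"
proof -
  note [measurable] = assms[THEN Linf_measurable]
  obtain K where K: "0 < K" "AE z in arc_measure. norm (f z) \<le> K" using LinfE[OF assms(1)] by metis
  obtain L where L: "AE z in arc_measure. norm (g z) \<le> L" using LinfE[OF assms(2)] by metis
  show ?thesis
  proof (rule LinfI)
    show "AE z in arc_measure. norm (f z * g z) \<le> K * L"
      using K(2) L by eventually_elim (use K(1) in \<open>auto simp: norm_mult intro!: mult_mono\<close>)
  qed measurable
qed

lemma Linf_const: "(\<lambda>z. c) \<in> Linf"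
  by (rule LinfI[where K = "norm c"]) auto

lemma Linf_cmult: "f \<in> Linf \<Longrightarrow> (\<lambda>z. c * f z) \<in> Linf"
  by (rule Linf_mult[OF Linf_const])

lemma Linf_diff: "f \<in> Linf \<Longrightarrow> g \<in> Linf \<Longrightarrow> (\<lambda>z. f z - g z) \<in> Linf"
  using Linf_add[of f "\<lambda>z. -1 * g z"] Linf_cmult[of g "-1"] by simp

lemma Linf_sum: "(\<And>i. i \<in> I \<Longrightarrow> F i \<in> Linf) \<Longrightarrow> (\<lambda>z. \<Sum>i\<in>I. F i z) \<in> Linf"
  by (induction I rule: infinite_finite_induct) (auto intro: Linf_const Linf_add)

lemma Linf_indicator: "A \<in> sets arc_measure \<Longrightarrow> indicator A \<in> Linf"
  by (rule LinfI[where K = 1]) (auto simp: indicator_def)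

lemma Linf_bounded_mono:
  assumes "g \<in> Linf" "f \<in> borel_measurable arc_measure"
    and "AE z in arc_measure. norm (f z) \<le> norm (g z)"
  shows "f \<in> Linf"
proof -
  obtain K where K: "AE z in arc_measure. norm (g z) \<le> K" using LinfE[OF assms(1)] by metis
  show ?thesis
    using assms(2) by (rule LinfI[where K = K]) (use assms(3) K in eventually_elim, simp)
qed

lemma Linf_norm_fun: "f \<in> Linf \<Longrightarrow> (\<lambda>z. of_real (norm (f z))) \<in> Linf"
  by (rule Linf_bounded_mono[of f]) (auto intro!: borel_measurable_of_real borel_measurable_norm
      dest: Linf_measurable)

lemma Linf_simple:
  assumes "simple_function arc_measure s"
  shows "s \<in> Linf"
proof (rule LinfI)
  have fin: "finite (s ` unit_circle)"
    using simple_functionD(1)[OF assms] by simp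
  show "AE z in arc_measure. norm (s z) \<le> Max (norm ` s ` unit_circle)"
    by (rule AE_I2) (use fin in auto)
  show "s \<in> borel_measurable arc_measure"
    using assms by (rule borel_measurable_simple_function)
qed

lemma Linf_indicator_mult:
  assumes "f \<in> Linf" "A \<in> sets arc_measure"
  shows "(\<lambda>z. f z * indicator A z) \<in> Linf" "(\<lambda>z. f z * indicator (- A) z) \<in> Linf"
proof -
  show "(\<lambda>z. f z * indicator A z) \<in> Linf"
    using assms by (intro Linf_mult Linf_indicator)
  have "(\<lambda>z. f z - f z * indicator A z) \<in> Linf"
    using assms by (intro Linf_diff Linf_mult Linf_indicator)
  also have "(\<lambda>z. f z - f z * indicator A z) = (\<lambda>z. f z * indicator (- A) z)"
    by (auto simp: indicator_def)
  finally show "(\<lambda>z. f z * indicator (- A) z) \<in> Linf" .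
qed

lemma Linf_comp:
  assumes "f \<in> Linf" "invertible_measure_preserving \<phi>"
  shows "f \<circ> \<phi> \<in> Linf"
proof -
  have \<phi> [measurable]: "\<phi> \<in> arc_measure \<rightarrow>\<^sub>M arc_measure" and d: "distr arc_measure arc_measure \<phi> = arc_measure"
    using assms(2) by (auto simp: invertible_measure_preserving_def)
  note [measurable] = Linf_measurable[OF assms(1)]
  obtain K where K: "AE z in arc_measure. norm (f z) \<le> K" using LinfE[OF assms(1)] by metis
  have "AE z in distr arc_measure arc_measure \<phi>. norm (f z) \<le> K"
    using K unfolding d .
  then have "AE z in arc_measure. norm ((f \<circ> \<phi>) z) \<le> K"
    using AE_distrD[OF \<phi>] by fastforce
  then show ?thesis
    by (intro LinfI) (auto simp: comp_def)
qed

text \<open>Rounding real and imaginary parts towards zero to multiples of a step gives at once a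
  minorant of |f|, as the supremum in \<open>ext_seminorm\<close> demands, and a uniform error,
  which the seminorm can control.\<close>

lemma simple_approximation:
  assumes "f \<in> Linf" "0 < \<epsilon>"
  obtains s where "simple_function arc_measure s" "\<And>z. norm (s z) \<le> norm (f z)"
    "AE z in arc_measure. norm (f z - s z) \<le> \<epsilon>"
proof -
  note [measurable] = Linf_measurable[OF assms(1)]
  obtain K where K: "0 < K" "AE z in arc_measure. norm (f z) \<le> K" using LinfE[OF assms(1)] .
  \<comment> \<open>Half of \<open>\<epsilon>\<close>, since the errors of the two parts
    add.\<close>
  define \<delta> where "\<delta> = \<epsilon> / 2"
  have \<delta>: "0 < \<delta>" using assms(2) by (simp add: \<delta>_def)
  define q where "q x = (if 0 \<le> x then \<lfloor>x\<rfloor> else \<lceil>x\<rceil>)" for x :: real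
  have q: "\<bar>of_int (q x)\<bar> \<le> \<bar>x\<bar>" "\<bar>x - of_int (q x)\<bar> \<le> 1" for x :: real
  proof -
    have "0 \<le> x \<Longrightarrow> 0 \<le> \<lfloor>x\<rfloor>" "\<not> 0 \<le> x \<Longrightarrow> \<lceil>x\<rceil> \<le> 0"
      by (simp_all add: ceiling_le_iff)
    then have "0 \<le> x \<Longrightarrow> 0 \<le> real_of_int \<lfloor>x\<rfloor>" "\<not> 0 \<le> x \<Longrightarrow> real_of_int \<lceil>x\<rceil> \<le> 0"
      by simp_all
    moreover have "real_of_int \<lfloor>x\<rfloor> \<le> x" "x \<le> real_of_int \<lfloor>x\<rfloor> + 1"
      "x \<le> real_of_int \<lceil>x\<rceil>" "real_of_int \<lceil>x\<rceil> \<le> x + 1"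
      by linarith+
    ultimately have "0 \<le> x \<Longrightarrow> \<bar>of_int \<lfloor>x\<rfloor>\<bar> \<le> \<bar>x\<bar> \<and> \<bar>x - of_int \<lfloor>x\<rfloor>\<bar> \<le> 1"
      "\<not> 0 \<le> x \<Longrightarrow> \<bar>of_int \<lceil>x\<rceil>\<bar> \<le> \<bar>x\<bar> \<and> \<bar>x - of_int \<lceil>x\<rceil>\<bar> \<le> 1"
      by linarith+
    then show "\<bar>of_int (q x)\<bar> \<le> \<bar>x\<bar>" "\<bar>x - of_int (q x)\<bar> \<le> 1"
      by (simp_all add: q_def split: if_split)
  qed
  have [measurable]: "q \<in> borel \<rightarrow>\<^sub>M count_space UNIV"
    unfolding q_def by (intro measurable_If measurable_real_floor measurable_real_ceiling) simp
  define t where "t x = \<delta> * of_int (q (x / \<delta>))" for x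
  have t1: "\<bar>t x\<bar> \<le> \<bar>x\<bar>" for x
    using q(1)[of "x / \<delta>"] \<delta> by (simp add: t_def abs_mult field_simps)
  have t2: "\<bar>x - t x\<bar> \<le> \<delta>" for x
  proof -
    have "x - t x = \<delta> * (x / \<delta> - of_int (q (x / \<delta>)))"
      using \<delta> by (simp add: t_def right_diff_distrib)
    then show ?thesis
      using mult_left_mono[OF q(2)[of "x / \<delta>"], of \<delta>] \<delta> by (simp add: abs_mult)
  qed
  have [measurable]: "t \<in> borel_measurable borel"
    unfolding t_def by measurable
  \<comment> \<open>The value 0 where |f| exceeds its essential bound makes the range finite; this
    affects only a null set.\<close>
  define s where "s z = (if norm (f z) \<le> K then Complex (t (Re (f z))) (t (Im (f z))) else 0)" for z
  have s_eq: "s z = (if norm (f z) \<le> K then of_real (t (Re (f z))) + \<i> * of_real (t (Im (f z))) else 0)" for z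
    by (simp add: s_def complex_eq_iff)
  have meas: "s \<in> borel_measurable arc_measure"
    unfolding s_eq by measurable
  have le: "norm (s z) \<le> norm (f z)" for z
  proof -
    have "(t (Re (f z)))\<^sup>2 + (t (Im (f z)))\<^sup>2 \<le> (Re (f z))\<^sup>2 + (Im (f z))\<^sup>2"
      using t1 by (intro add_mono abs_le_square_iff[THEN iffD1])
    then have "norm (Complex (t (Re (f z))) (t (Im (f z)))) \<le> norm (f z)"
      unfolding cmod_def by (intro real_sqrt_le_mono) simp
    then show ?thesis by (simp add: s_def)
  qed
  define T where "T = (\<lambda>i. \<delta> * of_int i) ` {-\<lceil>K / \<delta>\<rceil>..\<lceil>K / \<delta>\<rceil>}"
  have tT: "t x \<in> T" if "\<bar>x\<bar> \<le> K" for x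
  proof -
    have "\<bar>x / \<delta>\<bar> \<le> K / \<delta>" using that \<delta> by (simp add: divide_right_mono)
    then have "\<bar>of_int (q (x / \<delta>))\<bar> \<le> K / \<delta>" using q(1)[of "x / \<delta>"] by linarith
    then have "-\<lceil>K / \<delta>\<rceil> \<le> q (x / \<delta>)" "q (x / \<delta>) \<le> \<lceil>K / \<delta>\<rceil>" by linarith+
    then have "q (x / \<delta>) \<in> {-\<lceil>K / \<delta>\<rceil>..\<lceil>K / \<delta>\<rceil>}" by simp
    then show ?thesis unfolding T_def t_def by (rule imageI)
  qed
  have "s ` space arc_measure \<subseteq> insert 0 ((\<lambda>(x, y). Complex x y) ` (T \<times> T))"
  proof (rule image_subsetI)
    fix z
    show "s z \<in> insert 0 ((\<lambda>(x, y). Complex x y) ` (T \<times> T))"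
    proof (cases "norm (f z) \<le> K")
      case True
      then have "t (Re (f z)) \<in> T" "t (Im (f z)) \<in> T"
        using abs_Re_le_cmod[of "f z"] abs_Im_le_cmod[of "f z"] by (intro tT; linarith)+
      then have "s z = (\<lambda>(x, y). Complex x y) (t (Re (f z)), t (Im (f z)))"
        "(t (Re (f z)), t (Im (f z))) \<in> T \<times> T"
        using True by (simp_all add: s_def)
      then show ?thesis by (metis image_eqI insertCI)
    qed (simp add: s_def)
  qed
  then have "finite (s ` space arc_measure)"
    by (rule finite_subset) (simp add: T_def)
  then have simple: "simple_function arc_measure s"
    using meas by (intro simple_function_borel_measurable)
  have "AE z in arc_measure. norm (f z - s z) \<le> \<epsilon>"
    using K(2)
  proof eventually_elim
    case (elim z)
    have "norm (f z - s z) \<le> \<bar>Re (f z - s z)\<bar> + \<bar>Im (f z - s z)\<bar>"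
      by (rule cmod_le)
    also have "\<dots> \<le> \<delta> + \<delta>"
      using elim t2[of "Re (f z)"] t2[of "Im (f z)"] by (simp add: s_def add_mono)
    finally show ?case by (simp add: \<delta>_def)
  qed
  with simple le show thesis by (rule that)
qed

section \<open>Rotationally symmetric seminorms and their extensions\<close>

locale rotation_seminorm =
  fixes \<alpha> :: "(complex \<Rightarrow> complex) \<Rightarrow> real"
  assumes R: "\<alpha> \<in> rotation_symmetric_seminorms"
begin

lemma is_seminorm: "seminorm_Linf \<alpha>"
  using R unfolding rotation_symmetric_seminorms_def by blast

lemma seminorm_cong:
  "f \<in> Linf \<Longrightarrow> g \<in> Linf \<Longrightarrow> AE z in arc_measure. f z = g z \<Longrightarrow> \<alpha> f = \<alpha> g"
  using is_seminorm unfolding seminorm_Linf_def by blast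

lemma seminorm_nonneg: "f \<in> Linf \<Longrightarrow> 0 \<le> \<alpha> f"
  using is_seminorm unfolding seminorm_Linf_def by blast

lemma seminorm_triangle: "f \<in> Linf \<Longrightarrow> g \<in> Linf \<Longrightarrow> \<alpha> (\<lambda>z. f z + g z) \<le> \<alpha> f + \<alpha> g"
  using is_seminorm unfolding seminorm_Linf_def by blast

lemma seminorm_cmult: "f \<in> Linf \<Longrightarrow> \<alpha> (\<lambda>z. c * f z) = norm c * \<alpha> f"
  using is_seminorm unfolding seminorm_Linf_def by blast

lemma seminorm_norm: "f \<in> Linf \<Longrightarrow> \<alpha> (\<lambda>z. of_real (norm (f z))) = \<alpha> f"
  using R unfolding rotation_symmetric_seminorms_def by blast

lemma seminorm_rotation: "f \<in> Linf \<Longrightarrow> w \<in> unit_circle \<Longrightarrow> \<alpha> (\<lambda>z. f (cnj w * z)) = \<alpha> f"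
  using R unfolding rotation_symmetric_seminorms_def by blast

lemma seminorm_const: "\<alpha> (\<lambda>z. c) = norm c"
  using seminorm_cmult[OF Linf_const[of 1], of c] R unfolding rotation_symmetric_seminorms_def by simp

lemma seminorm_sum:
  assumes "\<And>i. i \<in> I \<Longrightarrow> F i \<in> Linf"
  shows "\<alpha> (\<lambda>z. \<Sum>i\<in>I. F i z) \<le> (\<Sum>i\<in>I. \<alpha> (F i))"
  using assms
proof (induction I rule: infinite_finite_induct)
  case (insert i I)
  then have "\<alpha> (\<lambda>z. F i z + (\<Sum>i\<in>I. F i z)) \<le> \<alpha> (F i) + \<alpha> (\<lambda>z. \<Sum>i\<in>I. F i z)"
    by (intro seminorm_triangle Linf_sum) auto
  with insert show ?case by simp
qed (simp_all add: seminorm_const)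

text \<open>A number of modulus at most \<open>r\<close> is the mean of two numbers of modulus \<open>r\<close>.\<close>

lemma seminorm_mono:
  assumes f: "f \<in> Linf" and g: "g \<in> Linf"
    and le: "AE z in arc_measure. norm (f z) \<le> norm (g z)"
  shows "\<alpha> f \<le> \<alpha> g"
proof -
  note [measurable] = f[THEN Linf_measurable] g[THEN Linf_measurable]
  \<comment> \<open>The other leg of a right triangle with hypotenuse |g| and leg |f|: both |f| + i
    b and |f| - i b have modulus |g|, and their mean is |f|.\<close>
  define b where "b z = sqrt ((norm (g z))\<^sup>2 - (norm (f z))\<^sup>2)" for z
  define u where "u c z = complex_of_real (norm (f z)) + c * complex_of_real (b z)" for c z
  have [measurable]: "b \<in> borel_measurable arc_measure" "u c \<in> borel_measurable arc_measure" for c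
    unfolding b_def u_def by measurable
  have norm_u: "AE z in arc_measure. norm (u c z) = norm (g z)" if "c = \<i> \<or> c = -\<i>" for c
    using le
  proof eventually_elim
    case (elim z)
    then have "(norm (f z))\<^sup>2 \<le> (norm (g z))\<^sup>2" by (intro power_mono) auto
    then show ?case
      using that by (auto simp: u_def b_def cmod_def)
  qed
  have uL: "u c \<in> Linf" if "c = \<i> \<or> c = -\<i>" for c
    using norm_u[OF that] by (intro Linf_bounded_mono[OF g]) (auto elim: eventually_mono)
  have \<alpha>u: "\<alpha> (u c) = \<alpha> g" if "c = \<i> \<or> c = -\<i>" for c
  proof -
    have "\<alpha> (\<lambda>z. of_real (norm (u c z))) = \<alpha> (\<lambda>z. of_real (norm (g z)))"
      using norm_u[OF that] uL[OF that] g
      by (intro seminorm_cong Linf_norm_fun) (auto elim: eventually_mono)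
    then show ?thesis using seminorm_norm uL[OF that] g by simp
  qed
  have "\<alpha> f = \<alpha> (\<lambda>z. of_real (norm (f z)))"
    using seminorm_norm[OF f] by simp
  also have "(\<lambda>z. of_real (norm (f z))) = (\<lambda>z. 1 / 2 * (u \<i> z + u (-\<i>) z))"
    by (auto simp: u_def)
  also have "\<alpha> \<dots> = 1 / 2 * \<alpha> (\<lambda>z. u \<i> z + u (-\<i>) z)"
    using uL by (subst seminorm_cmult) (auto intro: Linf_add)
  also have "\<dots> \<le> 1 / 2 * (\<alpha> (u \<i>) + \<alpha> (u (-\<i>)))"
    using uL by (intro mult_left_mono seminorm_triangle) auto
  also have "\<dots> = \<alpha> g"
    using \<alpha>u by simp
  finally show ?thesis .
qed

lemma seminorm_le_const:
  assumes "f \<in> Linf" "AE z in arc_measure. norm (f z) \<le> K"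
  shows "\<alpha> f \<le> K"
proof -
  have "AE z in arc_measure. 0 \<le> K"
    using assms(2) by eventually_elim (rule order_trans[OF norm_ge_zero])
  then have K: "0 \<le> K" by simp
  have "\<alpha> f \<le> \<alpha> (\<lambda>z. of_real K)"
    using assms K by (intro seminorm_mono Linf_const) auto
  with K show ?thesis by (simp add: seminorm_const)
qed

section \<open>The extended seminorm without truncation continuity\<close>

lemma ext_seminorm_mono:
  assumes "AE z in arc_measure. norm (f z) \<le> norm (g z)"
  shows "ext_seminorm \<alpha> f \<le> ext_seminorm \<alpha> g"
  unfolding ext_seminorm_def
proof (rule SUP_subset_mono[OF Collect_mono order_refl], rule impI, erule conjE, rule conjI, assumption)
  fix s :: "complex \<Rightarrow> complex" assume "AE z in arc_measure. norm (s z) \<le> norm (f z)"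
  then show "AE z in arc_measure. norm (s z) \<le> norm (g z)"
    using assms by eventually_elim (rule order_trans)
qed

lemma ext_seminorm_upper:
  "simple_function arc_measure s \<Longrightarrow> AE z in arc_measure. norm (s z) \<le> norm (f z) \<Longrightarrow>
    ennreal (\<alpha> s) \<le> ext_seminorm \<alpha> f"
  unfolding ext_seminorm_def by (rule SUP_upper) auto

text \<open>Simple minorants of f lie below by \<open>seminorm_mono\<close>. Conversely, a simple
  minorant with uniform error e loses at most e, because \<open>seminorm_le_const\<close> bounds
  \<alpha> by the essential supremum.\<close>

lemma ext_seminorm_Linf:
  assumes f: "f \<in> Linf"
  shows "ext_seminorm \<alpha> f = ennreal (\<alpha> f)"
proof (rule antisym)
  show "ext_seminorm \<alpha> f \<le> ennreal (\<alpha> f)"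
    unfolding ext_seminorm_def
    using f by (auto intro!: SUP_least ennreal_leI seminorm_mono Linf_simple)
  show "ennreal (\<alpha> f) \<le> ext_seminorm \<alpha> f"
  proof (rule ennreal_le_epsilon)
    fix e :: real assume "0 < e"
    then obtain s where s: "simple_function arc_measure s" "\<And>z. norm (s z) \<le> norm (f z)"
      "AE z in arc_measure. norm (f z - s z) \<le> e"
      using simple_approximation[OF f] by metis
    have sL: "s \<in> Linf" using s(1) by (rule Linf_simple)
    have "\<alpha> f = \<alpha> (\<lambda>z. s z + (f z - s z))" by simp
    also have "\<dots> \<le> \<alpha> s + \<alpha> (\<lambda>z. f z - s z)"
      using f sL by (intro seminorm_triangle Linf_diff)
    also have "\<alpha> (\<lambda>z. f z - s z) \<le> e"
      using f sL s(3) by (intro seminorm_le_const Linf_diff)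
    finally have "ennreal (\<alpha> f) \<le> ennreal (\<alpha> s + e)"
      by (simp add: ennreal_leI)
    also have "\<dots> = ennreal (\<alpha> s) + ennreal e"
      using \<open>0 < e\<close> seminorm_nonneg[OF sL] by simp
    also have "\<dots> \<le> ext_seminorm \<alpha> f + ennreal e"
      using s by (intro add_right_mono ext_seminorm_upper) auto
    finally show "ennreal (\<alpha> f) \<le> ext_seminorm \<alpha> f + ennreal e" .
  qed
qed

text \<open>For nonzero c, division by c turns simple minorants of c f into those of f, which gives
  one inequality; applied to the inverse of c it gives the other.\<close>

lemma ext_seminorm_cmult: "ext_seminorm \<alpha> (\<lambda>z. c * f z) = ennreal (norm c) * ext_seminorm \<alpha> f"
proof -
  have le: "ext_seminorm \<alpha> (\<lambda>z. c * f z) \<le> ennreal (norm c) * ext_seminorm \<alpha> f" if "c \<noteq> 0" for c f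
    unfolding ext_seminorm_def[of _ "\<lambda>z. c * f z"]
  proof (rule SUP_least, safe)
    fix s :: "complex \<Rightarrow> complex" assume s: "simple_function arc_measure s" "AE z in arc_measure. norm (s z) \<le> norm (c * f z)"
    have "s = (\<lambda>z. c * (inverse c * s z))" using that by auto
    then have "\<alpha> s = norm c * \<alpha> (\<lambda>z. inverse c * s z)"
      using seminorm_cmult[OF Linf_cmult[OF Linf_simple[OF s(1)]], of c "inverse c"] by simp
    then have "ennreal (\<alpha> s) = ennreal (norm c) * ennreal (\<alpha> (\<lambda>z. inverse c * s z))"
      by (simp add: ennreal_mult')
    also have "\<dots> \<le> ennreal (norm c) * ext_seminorm \<alpha> f"
    proof (intro mult_left_mono ext_seminorm_upper)
      show "simple_function arc_measure (\<lambda>z. inverse c * s z)"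
        using s(1) by (rule simple_function_compose1)
      show "AE z in arc_measure. norm (inverse c * s z) \<le> norm (f z)"
        using s(2)
      proof eventually_elim
        case (elim z)
        have "norm (inverse c * s z) = norm (s z) / norm c"
          by (simp only: norm_mult norm_inverse divide_inverse mult.commute)
        also have "\<dots> \<le> norm (f z)"
          using elim that by (simp only: norm_mult) (simp add: divide_le_eq mult.commute)
        finally show ?case .
      qed
    qed simp
    finally show "ennreal (\<alpha> s) \<le> ennreal (norm c) * ext_seminorm \<alpha> f" .
  qed
  show ?thesis
  proof (cases "c = 0")
    \<comment> \<open>In \<open>ennreal\<close> 0 times infinity is 0, so an infinite
      \<open>ext_seminorm \<alpha> f\<close> is covered as well.\<close>
    case True
    then show ?thesis
      using ext_seminorm_Linf[OF Linf_const[of 0]] by (simp add: seminorm_const)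
  next
    case False
    have "ennreal (norm c) * ext_seminorm \<alpha> f
        = ennreal (norm c) * ext_seminorm \<alpha> (\<lambda>z. inverse c * (c * f z))"
      using False by (simp add: mult.assoc[symmetric])
    also have "\<dots> \<le> ennreal (norm c) * (ennreal (norm (inverse c)) * ext_seminorm \<alpha> (\<lambda>z. c * f z))"
      using False by (intro mult_left_mono le) auto
    also have "\<dots> = ext_seminorm \<alpha> (\<lambda>z. c * f z)"
      using False by (simp add: mult.assoc[symmetric] ennreal_mult'[symmetric] norm_inverse)
    finally show ?thesis using le[OF False] by (intro antisym)
  qed
qed

lemma ext_seminorm_le_Linf_norm:
  assumes [measurable]: "f \<in> borel_measurable arc_measure"
  shows "ext_seminorm \<alpha> f \<le> Linf_norm f"
proof (cases "Linf_norm f")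
  case (real K)
  then have "AE z in arc_measure. norm (f z) \<le> K"
    using Linf_norm_le_iff[of f "ennreal K"] by (simp add: ennreal_le_iff)
  moreover from this have "f \<in> Linf" by (intro LinfI) auto
  ultimately show ?thesis
    using real by (simp add: ext_seminorm_Linf ennreal_leI seminorm_le_const)
qed simp

text \<open>A finite norm lets g be replaced by a constant. Infinite norm is excluded because
  \<open>ennreal\<close> evaluates 0 times infinity to 0, not to the intended value
  +infinity.\<close>

lemma ext_seminorm_mult_le:
  assumes [measurable]: "g \<in> borel_measurable arc_measure" and fin: "Linf_norm g \<noteq> \<infinity>"
  shows "ext_seminorm \<alpha> (\<lambda>z. f z * g z) \<le> ext_seminorm \<alpha> f * Linf_norm g"
proof (cases "Linf_norm g")
  case (real K)
  then have K: "AE z in arc_measure. norm (g z) \<le> K"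
    using Linf_norm_le_iff[of g "ennreal K"] by (simp add: ennreal_le_iff)
  have "ext_seminorm \<alpha> (\<lambda>z. f z * g z) \<le> ext_seminorm \<alpha> (\<lambda>z. of_real K * f z)"
    using K by (intro ext_seminorm_mono, eventually_elim)
      (use real in \<open>auto simp: norm_mult mult.commute[of K] intro!: mult_left_mono\<close>)
  also have "\<dots> = ext_seminorm \<alpha> f * Linf_norm g"
    using real by (simp add: ext_seminorm_cmult mult.commute)
  finally show ?thesis .
qed (use fin in simp)

end

section \<open>Truncation outside small sets\<close>

lemma invertible_measure_preserving_ident: "invertible_measure_preserving (\<lambda>z. z)"
  by (rule invertible_measure_preserving_piecewise_rotation[where W = "{1}"]) auto

lemma measure_preimage:
  assumes "invertible_measure_preserving \<phi>" and A: "A \<in> sets arc_measure"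
  shows "{z \<in> unit_circle. \<phi> z \<in> A} \<in> sets arc_measure"
    and "measure arc_measure {z \<in> unit_circle. \<phi> z \<in> A} = measure arc_measure A"
proof -
  have \<phi>: "\<phi> \<in> arc_measure \<rightarrow>\<^sub>M arc_measure" and d: "distr arc_measure arc_measure \<phi> = arc_measure"
    using assms(1) by (auto simp: invertible_measure_preserving_def)
  have eq: "{z \<in> unit_circle. \<phi> z \<in> A} = \<phi> -` A \<inter> space arc_measure"
    by auto
  show "{z \<in> unit_circle. \<phi> z \<in> A} \<in> sets arc_measure"
    unfolding eq using \<phi> A by (rule measurable_sets)
  show "measure arc_measure {z \<in> unit_circle. \<phi> z \<in> A} = measure arc_measure A"
    unfolding eq using measure_distr[OF \<phi> A] by (simp only: d)
qed

text \<open>Induction on n: the union U of the preimages of A found so far has measure at most (n +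
  1) m(A), so T - U has room for one more copy, and A is exchanged with part of it. Disjointness is
  expressed by the sum of indicators, the form in which the averaging uses it.\<close>

lemma disjoint_copies:
  assumes A: "A \<in> sets arc_measure" and T: "T \<in> sets arc_measure" and "A \<subseteq> T"
    and "real (Suc n) * measure arc_measure A \<le> measure arc_measure T"
  shows "\<exists>\<phi>. \<phi> 0 = (\<lambda>z. z) \<and>
    (\<forall>j\<le>n. invertible_measure_preserving (\<phi> j) \<and>
      (\<forall>z\<in>unit_circle. (\<phi> j z \<in> T \<longleftrightarrow> z \<in> T) \<and> (z \<notin> T \<longrightarrow> \<phi> j z = z))) \<and>
    (AE z in arc_measure. (\<Sum>j\<le>n. indicator A (\<phi> j z)) \<le> (1 :: real))"
  using assms(4)
proof (induction n)
  case 0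
  show ?case
    by (intro exI[of _ "\<lambda>_ z. z"]) (auto simp: invertible_measure_preserving_ident indicator_def)
next
  case (Suc n)
  let ?m = "measure arc_measure"
  have "real (Suc n) * ?m A \<le> real (Suc (Suc n)) * ?m A"
    by (intro mult_right_mono) auto
  then have "real (Suc n) * ?m A \<le> ?m T"
    using Suc.prems by (rule order_trans)
  from Suc.IH[OF this] obtain \<phi> where \<phi>0: "\<phi> 0 = (\<lambda>z. z)"
    and \<phi>: "\<forall>j\<le>n. invertible_measure_preserving (\<phi> j) \<and>
      (\<forall>z\<in>unit_circle. (\<phi> j z \<in> T \<longleftrightarrow> z \<in> T) \<and> (z \<notin> T \<longrightarrow> \<phi> j z = z))"
    and sum: "AE z in arc_measure. (\<Sum>j\<le>n. indicator A (\<phi> j z)) \<le> (1 :: real)"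
    by (elim exE conjE)
  have imp: "invertible_measure_preserving (\<phi> j)" if "j \<le> n" for j
    using \<phi> that by blast
  have \<phi>T: "\<phi> j z \<in> T \<longleftrightarrow> z \<in> T" and \<phi>id: "z \<notin> T \<Longrightarrow> \<phi> j z = z"
    if "j \<le> n" "z \<in> unit_circle" for j z
    using \<phi> that by blast+
  have Tc: "T \<subseteq> unit_circle" using sets.sets_into_space[OF T] by simp
  define U where "U = (\<Union>j\<le>n. {z \<in> unit_circle. \<phi> j z \<in> A})"
  have U: "U \<in> sets arc_measure"
    unfolding U_def using measure_preimage(1)[OF imp A] by (intro sets.finite_UN) auto
  have "?m U \<le> (\<Sum>j\<le>n. ?m {z \<in> unit_circle. \<phi> j z \<in> A})"
    unfolding U_def using measure_preimage(1)[OF imp A]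
    by (intro arc.finite_measure_subadditive_finite) auto
  also have "\<dots> = (\<Sum>j\<le>n. ?m A)"
    by (intro sum.cong refl measure_preimage(2)[OF imp A]) simp
  finally have mU: "?m U \<le> real (Suc n) * ?m A" by simp
  have UT: "U \<subseteq> T" using \<phi>T \<open>A \<subseteq> T\<close> by (auto simp: U_def)
  \<comment> \<open>Here \<open>\<phi> 0\<close> being the identity matters: A itself is one of the
    copies, so A is disjoint from T - U and can be exchanged into it.\<close>
  have AU: "A \<subseteq> U"
  proof
    fix z assume "z \<in> A"
    then have "z \<in> {z \<in> unit_circle. \<phi> 0 z \<in> A}" using \<open>A \<subseteq> T\<close> Tc \<phi>0 by auto
    then show "z \<in> U" unfolding U_def by blast
  qed
  have "?m (T - U) = ?m T - ?m U"
    using T U UT by (intro arc.finite_measure_Diff)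
  with mU Suc.prems have le: "?m A \<le> ?m (T - U)"
    by (simp add: algebra_simps)
  have "A \<inter> (T - U) = {}" using AU by auto
  then obtain \<psi> where \<psi>: "invertible_measure_preserving \<psi>"
    and inv: "\<And>z. z \<in> unit_circle \<Longrightarrow> \<psi> (\<psi> z) = z"
    and \<psi>id: "\<And>z. z \<notin> A \<union> (T - U) \<Longrightarrow> \<psi> z = z"
    and \<psi>A: "AE z in arc_measure. \<psi> z \<in> A \<longrightarrow> z \<in> T - U"
    using exchange_involution[OF A sets.Diff[OF T U] _ le] by blast
  have \<psi>T: "\<psi> z \<in> T \<longleftrightarrow> z \<in> T" if "z \<in> unit_circle" for z
  proof
    assume "\<psi> z \<in> T" then show "z \<in> T"
      using \<psi>id[of z] \<open>A \<subseteq> T\<close> by (cases "z \<in> A \<union> (T - U)") auto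
  next
    assume "z \<in> T"
    show "\<psi> z \<in> T"
    proof (rule ccontr)
      assume "\<psi> z \<notin> T"
      then have "\<psi> (\<psi> z) = \<psi> z" using \<open>A \<subseteq> T\<close> by (intro \<psi>id) auto
      then show False using inv[OF that] \<open>z \<in> T\<close> \<open>\<psi> z \<notin> T\<close> by simp
    qed
  qed
  have sum': "AE z in arc_measure.
      (\<Sum>j\<le>Suc n. indicator A ((\<phi>(Suc n := \<psi>)) j z)) \<le> (1 :: real)"
    using sum \<psi>A AE_space
  proof eventually_elim
    case (elim z)
    have eq: "(\<Sum>j\<le>Suc n. indicator A ((\<phi>(Suc n := \<psi>)) j z))
        = (\<Sum>j\<le>n. indicator A (\<phi> j z)) + (indicator A (\<psi> z) :: real)"
      by simp
    show ?case
    proof (cases "\<psi> z \<in> A")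
      case True
      then have "z \<notin> U" using elim by simp
      then have "(\<Sum>j\<le>n. indicator A (\<phi> j z)) = (0 :: real)"
        using elim(3) by (intro sum.neutral) (auto simp: U_def)
      then show ?thesis unfolding eq by (simp add: indicator_def)
    next
      case False
      then show ?thesis unfolding eq using elim(1) by simp
    qed
  qed
  show ?case
  proof (intro exI[of _ "\<phi>(Suc n := \<psi>)"] conjI allI impI ballI sum')
    show "(\<phi>(Suc n := \<psi>)) 0 = (\<lambda>z. z)" using \<phi>0 by simp
    fix j assume j: "j \<le> Suc n"
    show "invertible_measure_preserving ((\<phi>(Suc n := \<psi>)) j)"
      using j \<psi> imp by (cases "j = Suc n") auto
    fix z assume z: "z \<in> unit_circle"
    show "((\<phi>(Suc n := \<psi>)) j z \<in> T) = (z \<in> T)"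
      using j \<psi>T[OF z] \<phi>T[OF _ z] by (cases "j = Suc n") auto
    assume "z \<notin> T"
    then show "(\<phi>(Suc n := \<psi>)) j z = z"
      using j \<psi>id[of z] \<phi>id[OF _ z] \<open>A \<subseteq> T\<close> by (cases "j = Suc n") auto
  qed
qed

context rotation_seminorm
begin

lemma seminorm_comp:
  "\<alpha> \<in> symmetric_gauge_seminorms \<Longrightarrow> f \<in> Linf \<Longrightarrow> invertible_measure_preserving \<phi> \<Longrightarrow>
    \<alpha> (f \<circ> \<phi>) = \<alpha> f"
  unfolding symmetric_gauge_seminorms_def by simp

text \<open>Averaging the truncated function over maps that carry \<open>n + 1\<close> disjoint subsets of \<open>T\<close> onto
  \<open>A\<close> recovers at least the fraction \<open>n / (n + 1)\<close> of \<open>h\<close>.\<close>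

lemma seminorm_remove_subset:
  assumes S: "\<alpha> \<in> symmetric_gauge_seminorms" and h: "h \<in> Linf"
    and A: "A \<in> sets arc_measure" and T: "T \<in> sets arc_measure" and "A \<subseteq> T"
    and const: "\<And>z. z \<in> T \<Longrightarrow> h z = c"
    and le: "real (Suc n) * measure arc_measure A \<le> measure arc_measure T"
  shows "real n * \<alpha> h \<le> real (Suc n) * \<alpha> (\<lambda>z. h z * indicator (- A) z)"
proof -
  from disjoint_copies[OF A T \<open>A \<subseteq> T\<close> le] obtain \<phi> where
    \<phi>: "\<forall>j\<le>n. invertible_measure_preserving (\<phi> j) \<and>
      (\<forall>z\<in>unit_circle. (\<phi> j z \<in> T \<longleftrightarrow> z \<in> T) \<and> (z \<notin> T \<longrightarrow> \<phi> j z = z))"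
    and sum: "AE z in arc_measure. (\<Sum>j\<le>n. indicator A (\<phi> j z)) \<le> (1 :: real)"
    by (elim exE conjE)
  have imp: "invertible_measure_preserving (\<phi> j)" if "j \<le> n" for j
    using \<phi> that by blast
  have \<phi>T: "\<phi> j z \<in> T \<longleftrightarrow> z \<in> T" and \<phi>id: "z \<notin> T \<Longrightarrow> \<phi> j z = z"
    if "j \<le> n" "z \<in> unit_circle" for j z
    using \<phi> that by blast+
  define k where "k z = h z * indicator (- A) z" for z
  have k: "k \<in> Linf"
    unfolding k_def using h A by (rule Linf_indicator_mult)
  have kL: "k \<circ> \<phi> j \<in> Linf" if "j \<le> n" for j
    using k imp[OF that] by (rule Linf_comp)
  \<comment> \<open>\<open>\<phi> j\<close> maps T into itself, where h is constant, and fixes the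
    other points of the circle.\<close>
  have h\<phi>: "h (\<phi> j z) = h z" if "j \<le> n" "z \<in> unit_circle" for j z
    using const[of z] const[of "\<phi> j z"] \<phi>T[OF that] \<phi>id[OF that] by (cases "z \<in> T") auto
  have "real n * \<alpha> h = \<alpha> (\<lambda>z. of_nat n * h z)"
    using h by (simp add: seminorm_cmult)
  also have "\<dots> \<le> \<alpha> (\<lambda>z. \<Sum>j\<le>n. (k \<circ> \<phi> j) z)"
  proof (rule seminorm_mono)
    show "(\<lambda>z. of_nat n * h z) \<in> Linf" using h by (rule Linf_cmult)
    show "(\<lambda>z. \<Sum>j\<le>n. (k \<circ> \<phi> j) z) \<in> Linf" by (intro Linf_sum kL) simp
    show "AE z in arc_measure. norm (of_nat n * h z) \<le> norm (\<Sum>j\<le>n. (k \<circ> \<phi> j) z)"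
      using sum AE_space
    proof eventually_elim
      case (elim z)
      have "(\<Sum>j\<le>n. (k \<circ> \<phi> j) z) = (\<Sum>j\<le>n. h z * of_real (1 - indicator A (\<phi> j z)))"
        using elim(2) h\<phi> by (intro sum.cong) (auto simp: k_def indicator_def)
      also have "\<dots> = h z * of_real (real (Suc n) - (\<Sum>j\<le>n. indicator A (\<phi> j z)))"
        by (simp add: sum_distrib_left[symmetric] sum_subtractf)
      finally have "norm (\<Sum>j\<le>n. (k \<circ> \<phi> j) z)
          = norm (h z) * \<bar>real (Suc n) - (\<Sum>j\<le>n. indicator A (\<phi> j z))\<bar>"
        by (simp add: norm_mult del: of_real_diff)
      \<comment> \<open>At most one of the n + 1 summands is cut off at z, so at least n of them
        survive.\<close>
      moreover have "real n \<le> \<bar>real (Suc n) - (\<Sum>j\<le>n. indicator A (\<phi> j z))\<bar>"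
        using elim(1) by linarith
      ultimately show ?case
        by (simp add: norm_mult mult.commute[of "real n"] mult_left_mono)
    qed
  qed
  also have "\<dots> \<le> (\<Sum>j\<le>n. \<alpha> (k \<circ> \<phi> j))"
    by (intro seminorm_sum kL) simp
  also have "\<dots> = (\<Sum>j\<le>n. \<alpha> k)"
    using seminorm_comp[OF S k imp] by (intro sum.cong) auto
  also have "\<dots> = real (Suc n) * \<alpha> k" by simp
  finally show ?thesis unfolding k_def[abs_def] .
qed

text \<open>Only simple s occur because the supremum in \<open>ext_seminorm\<close> runs over simple
  functions. The inequality is one-sided because the other direction is
  \<open>seminorm_mono\<close>.\<close>

definition truncation_continuous :: bool where
  "truncation_continuous \<longleftrightarrow>
     (\<forall>s \<epsilon>. simple_function arc_measure s \<longrightarrow> 0 < \<epsilon> \<longrightarrow>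
       (\<exists>\<delta>>0. \<forall>A\<in>sets arc_measure. measure arc_measure A < \<delta> \<longrightarrow>
          \<alpha> s - \<epsilon> \<le> \<alpha> (\<lambda>z. s z * indicator (- A) z)))"

lemma truncation_continuous_symmetric:
  assumes S: "\<alpha> \<in> symmetric_gauge_seminorms"
  shows "truncation_continuous"
  unfolding truncation_continuous_def
proof (intro allI impI)
  fix s :: "complex \<Rightarrow> complex" and \<epsilon> :: real assume s: "simple_function arc_measure s" and "0 < \<epsilon>"
  let ?m = "measure arc_measure"
  have sL: "s \<in> Linf" using s by (rule Linf_simple)
  define T where "T v = s -` {v} \<inter> space arc_measure" for v
  have T: "T v \<in> sets arc_measure" for v
    unfolding T_def using s by (rule simple_functionD)
  have fin: "finite (s ` unit_circle)"
    using simple_functionD(1)[OF s] by simp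
  \<comment> \<open>V is the set of values whose level sets are being cut by A. The error is
    arbitrary in the induction because each step leaves half of it to the induction
    hypothesis.\<close>
  have "\<exists>\<delta>>0. \<forall>A\<in>sets arc_measure. ?m A < \<delta> \<longrightarrow>
      \<alpha> s - \<epsilon> \<le> \<alpha> (\<lambda>z. s z * indicator (- (A \<inter> (\<Union>v\<in>V. T v))) z)"
    if "finite V" "0 < \<epsilon>" for V and \<epsilon> :: real
    using that
  proof (induction V arbitrary: \<epsilon>)
    case empty
    then show ?case by (intro exI[of _ 1]) auto
  next
    case (insert v V)
    obtain \<delta> where \<delta>: "0 < \<delta>" "\<And>A. A \<in> sets arc_measure \<Longrightarrow> ?m A < \<delta> \<Longrightarrow>
        \<alpha> s - \<epsilon> / 2 \<le> \<alpha> (\<lambda>z. s z * indicator (- (A \<inter> (\<Union>v\<in>V. T v))) z)"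
      using insert.IH[of "\<epsilon> / 2"] insert.prems by auto
    \<comment> \<open>Cutting one more level set costs at most the fraction 1 / (n + 1) of
      \<open>\<alpha> h\<close>, and \<open>\<alpha> h \<le> \<alpha> s\<close>; this n keeps the
      cost below half of the error.\<close>
    obtain n :: nat where n: "2 * \<alpha> s / \<epsilon> < real n"
      using reals_Archimedean2 by blast
    \<comment> \<open>Measure below \<open>\<eta>\<close> leaves room for n + 1 copies of the cut
      inside \<open>T v\<close>. If \<open>T v\<close> is null, so is the cut, and any positive
      value serves.\<close>
    define \<eta> where "\<eta> = (if ?m (T v) = 0 then 1 else ?m (T v) / real (Suc n))"
    have "0 < \<eta>"
      using measure_nonneg[of arc_measure "T v"] by (auto simp: \<eta>_def less_le)
    show ?case
    proof (intro exI[of _ "min \<delta> \<eta>"] conjI ballI impI)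
      show "0 < min \<delta> \<eta>" using \<delta> \<open>0 < \<eta>\<close> by simp
      fix A assume A: "A \<in> sets arc_measure" and small: "?m A < min \<delta> \<eta>"
      define h where "h z = s z * indicator (- (A \<inter> (\<Union>v\<in>V. T v))) z" for z
      have AV: "A \<inter> (\<Union>v\<in>V. T v) \<in> sets arc_measure"
        using A T insert.hyps(1) by (intro sets.Int sets.finite_UN) auto
      have h: "h \<in> Linf" unfolding h_def using sL AV by (rule Linf_indicator_mult)
      \<comment> \<open>The previous cuts lie in other level sets, so h still has the value v on all
        of \<open>T v\<close>.\<close>
      have hv: "h z = v" if "z \<in> T v" for z
        using that insert.hyps(2) by (auto simp: h_def T_def indicator_def)
      have sub: "?m (A \<inter> T v) \<le> ?m A" "?m (A \<inter> T v) \<le> ?m (T v)"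
        using A T[of v] by (auto intro!: arc.finite_measure_mono)
      have le: "real (Suc n) * ?m (A \<inter> T v) \<le> ?m (T v)"
      proof (cases "?m (T v) = 0")
        case True
        then have "?m (A \<inter> T v) = 0" using sub(2) by (simp add: measure_le_0_iff)
        then show ?thesis by simp
      next
        case False
        then have "?m (A \<inter> T v) \<le> ?m (T v) / real (Suc n)"
          using sub(1) small by (simp add: \<eta>_def)
        then show ?thesis by (simp add: pos_le_divide_eq mult.commute del: of_nat_Suc)
      qed
      have eq: "(\<lambda>z. s z * indicator (- (A \<inter> (\<Union>v\<in>insert v V. T v))) z)
          = (\<lambda>z. h z * indicator (- (A \<inter> T v)) z)"
        by (auto simp: h_def indicator_def)
      have le_s: "\<alpha> h \<le> \<alpha> s"
        using h sL by (intro seminorm_mono) (auto simp: h_def norm_mult indicator_def)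
      have large: "\<alpha> s \<le> real (Suc n) * (\<epsilon> / 2)"
        using n insert.prems by (simp add: field_simps)
      have "real (Suc n) * (\<alpha> s - \<epsilon>) = real (Suc n) * (\<alpha> s - \<epsilon> / 2) - real (Suc n) * (\<epsilon> / 2)"
        by (simp add: field_simps)
      also have "\<dots> \<le> real (Suc n) * \<alpha> h - \<alpha> h"
      proof (rule diff_mono)
        show "real (Suc n) * (\<alpha> s - \<epsilon> / 2) \<le> real (Suc n) * \<alpha> h"
          unfolding h_def using small by (intro mult_left_mono \<delta>(2) A) simp_all
      qed (use le_s large in linarith)
      also have "\<dots> = real n * \<alpha> h"
        by (simp add: algebra_simps)
      also have "\<dots> \<le> real (Suc n) * \<alpha> (\<lambda>z. h z * indicator (- (A \<inter> T v)) z)"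
        using A T[of v] by (intro seminorm_remove_subset[OF S h _ _ _ hv le]) auto
      finally show "\<alpha> s - \<epsilon> \<le> \<alpha> (\<lambda>z. s z * indicator (- (A \<inter> (\<Union>v\<in>insert v V. T v))) z)"
        unfolding eq
        by (rule mult_left_le_imp_le) simp
    qed
  qed
  from this[OF fin \<open>0 < \<epsilon>\<close>] obtain \<delta> where \<delta>: "0 < \<delta>" "\<And>A. A \<in> sets arc_measure \<Longrightarrow> ?m A < \<delta> \<Longrightarrow>
      \<alpha> s - \<epsilon> \<le> \<alpha> (\<lambda>z. s z * indicator (- (A \<inter> (\<Union>v\<in>s ` unit_circle. T v))) z)"
    by auto
  have eq: "A \<inter> (\<Union>v\<in>s ` unit_circle. T v) = A" if "A \<in> sets arc_measure" for A
    using sets.sets_into_space[OF that] by (auto simp: T_def)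
  show "\<exists>\<delta>>0. \<forall>A\<in>sets arc_measure. ?m A < \<delta> \<longrightarrow> \<alpha> s - \<epsilon> \<le> \<alpha> (\<lambda>z. s z * indicator (- A) z)"
  proof (intro exI[of _ \<delta>] conjI ballI impI \<delta>(1))
    fix A assume A: "A \<in> sets arc_measure" "?m A < \<delta>"
    show "\<alpha> s - \<epsilon> \<le> \<alpha> (\<lambda>z. s z * indicator (- A) z)"
      using \<delta>(2)[OF A] unfolding eq[OF A(1)] .
  qed
qed

text \<open>The filter \<open>small_sets\<close> sees only sets of positive measure; null sets are
  added here, since their indicators vanish almost everywhere.\<close>

lemma continuous_seminormD:
  assumes "continuous_seminorm \<alpha>" "0 < \<eta>"
  obtains \<delta> where "0 < \<delta>"
    "\<And>A. A \<in> sets arc_measure \<Longrightarrow> measure arc_measure A < \<delta> \<Longrightarrow> \<alpha> (indicator A) < \<eta>"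
proof -
  have "eventually (\<lambda>E. dist (\<alpha> (indicator E)) 0 < \<eta>) small_sets"
    using assms unfolding continuous_seminorm_def by (rule tendstoD)
  then obtain \<delta> where \<delta>: "0 < \<delta>" "\<And>E. E \<in> sets arc_measure \<Longrightarrow> 0 < measure arc_measure E \<Longrightarrow>
      measure arc_measure E < \<delta> \<Longrightarrow> dist (\<alpha> (indicator E)) 0 < \<eta>"
    unfolding eventually_small_sets by blast
  show thesis
  proof (rule that[OF \<delta>(1)])
    fix A assume A: "A \<in> sets arc_measure" "measure arc_measure A < \<delta>"
    show "\<alpha> (indicator A) < \<eta>"
    proof (cases "measure arc_measure A = 0")
      case True
      then have "AE z in arc_measure. z \<notin> A"
        using A by (intro AE_not_in null_setsI) (simp_all add: arc.emeasure_eq_measure)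
      then have "AE z in arc_measure. indicator A z = (0 :: complex)"
        by eventually_elim simp
      then have "\<alpha> (indicator A) = \<alpha> (\<lambda>z. 0)"
        using A by (intro seminorm_cong Linf_indicator Linf_const)
      then show ?thesis using assms(2) by (simp add: seminorm_const)
    next
      case False
      then have "0 < measure arc_measure A"
        using measure_nonneg[of arc_measure A] by linarith
      then show ?thesis using \<delta>(2)[of A] A by simp
    qed
  qed
qed

lemma truncation_continuous_continuous:
  assumes cont: "continuous_seminorm \<alpha>"
  shows "truncation_continuous"
  unfolding truncation_continuous_def
proof (intro allI impI)
  fix s :: "complex \<Rightarrow> complex" and \<epsilon> :: real assume s: "simple_function arc_measure s" and "0 < \<epsilon>"
  have sL: "s \<in> Linf" using s by (rule Linf_simple)
  obtain K where K: "0 < K" "AE z in arc_measure. norm (s z) \<le> K" using LinfE[OF sL] .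
  obtain \<delta> where \<delta>: "0 < \<delta>"
    "\<And>A. A \<in> sets arc_measure \<Longrightarrow> measure arc_measure A < \<delta> \<Longrightarrow> \<alpha> (indicator A) < \<epsilon> / K"
    using continuous_seminormD[OF cont, of "\<epsilon> / K"] K \<open>0 < \<epsilon>\<close> by auto
  show "\<exists>\<delta>>0. \<forall>A\<in>sets arc_measure. measure arc_measure A < \<delta> \<longrightarrow>
      \<alpha> s - \<epsilon> \<le> \<alpha> (\<lambda>z. s z * indicator (- A) z)"
  proof (intro exI[of _ \<delta>] conjI ballI impI \<delta>(1))
    fix A assume A: "A \<in> sets arc_measure" "measure arc_measure A < \<delta>"
    have "\<alpha> s = \<alpha> (\<lambda>z. s z * indicator (- A) z + s z * indicator A z)"
      by (rule arg_cong[where f = \<alpha>]) (auto simp: indicator_def)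
    also have "\<dots> \<le> \<alpha> (\<lambda>z. s z * indicator (- A) z) + \<alpha> (\<lambda>z. s z * indicator A z)"
      using sL A by (intro seminorm_triangle Linf_indicator_mult)
    also have "\<alpha> (\<lambda>z. s z * indicator A z) \<le> \<alpha> (\<lambda>z. of_real K * indicator A z)"
      using sL A K
      by (intro seminorm_mono Linf_indicator_mult Linf_cmult Linf_indicator)
        (auto simp: norm_mult indicator_def elim: eventually_mono)
    also have "\<dots> = K * \<alpha> (indicator A)"
      using seminorm_cmult[OF Linf_indicator[OF A(1)], of "of_real K"] K by simp
    also have "\<dots> \<le> \<epsilon>"
      using \<delta>(2)[OF A] K by (simp add: field_simps)
    finally show "\<alpha> s - \<epsilon> \<le> \<alpha> (\<lambda>z. s z * indicator (- A) z)" by simp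
  qed
qed

end

section \<open>Consequences of truncation continuity\<close>

text \<open>Dominated convergence for the indicators. It turns pointwise convergence into smallness
  of the exceptional sets, which is what truncation continuity asks for.\<close>

lemma measure_tendsto_0:
  assumes [measurable]: "\<And>n :: nat. A n \<in> sets arc_measure"
    and "AE z in arc_measure. \<forall>\<^sub>F n in sequentially. z \<notin> A n"
  shows "(\<lambda>n. measure arc_measure (A n)) \<longlonglongrightarrow> 0"
proof -
  have "(\<lambda>n. LINT z|arc_measure. indicator (A n) z :: real) \<longlonglongrightarrow> (LINT z|arc_measure. 0)"
  proof (rule integral_dominated_convergence[where w = "\<lambda>_. 1"])
    show "AE z in arc_measure. (\<lambda>n. indicator (A n) z :: real) \<longlonglongrightarrow> 0"
      using assms(2)
    proof eventually_elim
      case (elim z)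
      then show ?case
        by (rule tendsto_eventually[OF eventually_mono]) simp
    qed
  qed (auto simp: indicator_def)
  then show ?thesis
    using sets.Int_space_eq2[of _ arc_measure] by simp
qed

text \<open>A multiplicative and an additive loss are removed together; in both uses one of them
  comes from truncation and the other from a pointwise comparison.\<close>

lemma le_of_one_minus_mult_le:
  fixes a b :: real
  assumes "\<And>\<epsilon>. 0 < \<epsilon> \<Longrightarrow> \<epsilon> < 1 \<Longrightarrow> (1 - \<epsilon>) * (a - \<epsilon>) \<le> b"
  shows "a \<le> b"
proof -
  have "((\<lambda>\<epsilon>. (1 - \<epsilon>) * (a - \<epsilon>)) \<longlongrightarrow> (1 - 0) * (a - 0)) (at_right 0)"
    by (intro tendsto_intros)
  moreover have "\<forall>\<^sub>F \<epsilon> in at_right 0. (1 - \<epsilon>) * (a - \<epsilon>) \<le> b"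
    unfolding eventually_at_right_field using assms by (intro exI[of _ 1]) auto
  ultimately have "(1 - 0) * (a - 0) \<le> b"
    by (intro tendsto_upperbound) auto
  then show ?thesis by simp
qed

context rotation_seminorm
begin

lemma truncation_continuousD:
  assumes truncation_continuous "simple_function arc_measure s" "0 < \<epsilon>"
  obtains \<delta> where "0 < \<delta>"
    "\<forall>A\<in>sets arc_measure. measure arc_measure A < \<delta> \<longrightarrow>
      \<alpha> s - \<epsilon> \<le> \<alpha> (\<lambda>z. s z * indicator (- A) z)"
  using assms(1)[unfolded truncation_continuous_def, rule_format, OF assms(2,3)] that by auto

text \<open>Where s is nonzero, |F n| eventually exceeds (1 - \<epsilon>) |s|, so the set where it
  is smaller has measure tending to 0. Cutting this set out of s costs little, and 1 - \<epsilon>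
  times the remainder lies below F n.\<close>

lemma ext_seminorm_Fatou:
  assumes tc: truncation_continuous
    and [measurable]: "\<And>n :: nat. F n \<in> borel_measurable arc_measure"
    and lim: "AE z in arc_measure. (\<lambda>n. F n z) \<longlonglongrightarrow> f z"
    and bound: "\<forall>\<^sub>F n in sequentially. ext_seminorm \<alpha> (F n) \<le> C"
  shows "ext_seminorm \<alpha> f \<le> C"
  unfolding ext_seminorm_def[of _ f]
proof (rule SUP_least, elim CollectE conjE)
  fix s :: "complex \<Rightarrow> complex"
  assume s: "simple_function arc_measure s" and le: "AE z in arc_measure. norm (s z) \<le> norm (f z)"
  have sL: "s \<in> Linf" using s by (rule Linf_simple)
  note [measurable] = Linf_measurable[OF sL]
  show "ennreal (\<alpha> s) \<le> C"
  proof (cases C)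
    case (real c)
    have "\<alpha> s \<le> c"
    proof (rule le_of_one_minus_mult_le)
      fix \<epsilon> :: real assume \<epsilon>: "0 < \<epsilon>" "\<epsilon> < 1"
      obtain \<delta> where "0 < \<delta>" and small: "\<forall>A\<in>sets arc_measure. measure arc_measure A < \<delta> \<longrightarrow>
          \<alpha> s - \<epsilon> \<le> \<alpha> (\<lambda>z. s z * indicator (- A) z)"
        using truncation_continuousD[OF tc s \<epsilon>(1)] .
      note \<delta> = small[rule_format]
      define A where "A n = {z \<in> space arc_measure. norm (F n z) < (1 - \<epsilon>) * norm (s z)}" for n
      have A: "A n \<in> sets arc_measure" for n
        unfolding A_def by measurable
      have "AE z in arc_measure. \<forall>\<^sub>F n in sequentially. z \<notin> A n"
        using lim le
      proof eventually_elim
        case (elim z)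
        show ?case
        proof (cases "s z = 0")
          case True
          then show ?thesis by (simp add: A_def)
        next
          case False
          have "(1 - \<epsilon>) * norm (s z) < norm (s z)" using \<epsilon> False by simp
          then have "(1 - \<epsilon>) * norm (s z) < norm (f z)" using elim(2) by (rule less_le_trans)
          with tendsto_norm[OF elim(1)]
          have "\<forall>\<^sub>F n in sequentially. (1 - \<epsilon>) * norm (s z) < norm (F n z)"
            by (rule order_tendstoD)
          then show ?thesis by eventually_elim (simp add: A_def)
        qed
      qed
      then have "(\<lambda>n. measure arc_measure (A n)) \<longlonglongrightarrow> 0"
        by (intro measure_tendsto_0 A)
      then have "\<forall>\<^sub>F n in sequentially. measure arc_measure (A n) < \<delta>"
        using \<open>0 < \<delta>\<close> by (rule order_tendstoD)
      with bound have "\<forall>\<^sub>F n in sequentially. ext_seminorm \<alpha> (F n) \<le> C \<and> measure arc_measure (A n) < \<delta>"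
        by (rule eventually_conj)
      then obtain n where n: "ext_seminorm \<alpha> (F n) \<le> C" "measure arc_measure (A n) < \<delta>"
        using eventually_happens'[OF sequentially_bot] by blast
      define t where "t z = s z * indicator (- A n) z" for z
      have t: "t \<in> Linf" unfolding t_def using sL A by (rule Linf_indicator_mult)
      have "(1 - \<epsilon>) * (\<alpha> s - \<epsilon>) \<le> (1 - \<epsilon>) * \<alpha> t"
        unfolding t_def using \<epsilon> by (intro mult_left_mono \<delta> A n) simp
      also have "\<dots> = \<alpha> (\<lambda>z. of_real (1 - \<epsilon>) * t z)"
        using \<epsilon> by (simp only: seminorm_cmult[OF t] norm_of_real)
      also have "\<dots> \<le> c"
      proof -
        have "ennreal (\<alpha> (\<lambda>z. of_real (1 - \<epsilon>) * t z)) = ext_seminorm \<alpha> (\<lambda>z. of_real (1 - \<epsilon>) * t z)"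
          by (rule ext_seminorm_Linf[OF Linf_cmult[OF t], symmetric])
        also have "\<dots> \<le> ext_seminorm \<alpha> (F n)"
        proof (rule ext_seminorm_mono, rule AE_I2)
          fix z assume "z \<in> space arc_measure"
          then show "norm (of_real (1 - \<epsilon>) * t z) \<le> norm (F n z)"
            using \<epsilon> unfolding norm_mult norm_of_real by (auto simp: t_def A_def indicator_def)
        qed
        also have "\<dots> \<le> ennreal c" using n real by simp
        finally show ?thesis using real by (simp add: ennreal_le_iff)
      qed
      finally show "(1 - \<epsilon>) * (\<alpha> s - \<epsilon>) \<le> c" .
    qed
    then show ?thesis using real by (simp add: ennreal_leI)
  qed simp
qed

text \<open>A simple minorant of f + g need not split into minorants of f and g. It is cut down to a
  set where both are bounded by n; there f and g become members of \<open>Linf\<close>, and the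
  triangle inequality of \<alpha> itself applies. The set removed is small because f and g are
  finite everywhere.\<close>

lemma ext_seminorm_triangle:
  assumes tc: truncation_continuous
    and [measurable]: "f \<in> borel_measurable arc_measure" "g \<in> borel_measurable arc_measure"
  shows "ext_seminorm \<alpha> (\<lambda>z. f z + g z) \<le> ext_seminorm \<alpha> f + ext_seminorm \<alpha> g"
  unfolding ext_seminorm_def[of _ "\<lambda>z. f z + g z"]
proof (rule SUP_least, elim CollectE conjE)
  fix s :: "complex \<Rightarrow> complex"
  assume s: "simple_function arc_measure s"
    and le: "AE z in arc_measure. norm (s z) \<le> norm (f z + g z)"
  have sL: "s \<in> Linf" using s by (rule Linf_simple)
  show "ennreal (\<alpha> s) \<le> ext_seminorm \<alpha> f + ext_seminorm \<alpha> g"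
  proof (rule ennreal_le_epsilon)
    fix e :: real assume "0 < e"
    obtain \<delta> where "0 < \<delta>" and small: "\<forall>A\<in>sets arc_measure. measure arc_measure A < \<delta> \<longrightarrow>
        \<alpha> s - e \<le> \<alpha> (\<lambda>z. s z * indicator (- A) z)"
      using truncation_continuousD[OF tc s \<open>0 < e\<close>] .
    note \<delta> = small[rule_format]
    define A where "A n = {z \<in> space arc_measure. real n < norm (f z) \<or> real n < norm (g z)}" for n
    have A: "A n \<in> sets arc_measure" for n
      unfolding A_def by measurable
    have "\<forall>\<^sub>F n in sequentially. z \<notin> A n" for z
      using eventually_ge_at_top[of "nat \<lceil>max (norm (f z)) (norm (g z))\<rceil>"]
      by eventually_elim (auto simp: A_def nat_le_iff ceiling_le_iff not_less)
    then have "(\<lambda>n. measure arc_measure (A n)) \<longlonglongrightarrow> 0"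
      by (intro measure_tendsto_0 A) auto
    then have "\<forall>\<^sub>F n in sequentially. measure arc_measure (A n) < \<delta>"
      using \<open>0 < \<delta>\<close> by (rule order_tendstoD)
    then obtain n where n: "measure arc_measure (A n) < \<delta>"
      using eventually_happens'[OF sequentially_bot] by blast
    define F where "F z = f z * indicator (space arc_measure - A n) z" for z
    define G where "G z = g z * indicator (space arc_measure - A n) z" for z
    have FG: "F \<in> borel_measurable arc_measure" "G \<in> borel_measurable arc_measure"
      unfolding F_def G_def
      by (intro borel_measurable_times borel_measurable_indicator sets.Diff sets.top A assms)+
    have F: "F \<in> Linf" and G: "G \<in> Linf"
      by (rule LinfI[OF FG(1), of "real n"], simp add: F_def A_def indicator_def not_less,
          rule LinfI[OF FG(2), of "real n"], simp add: G_def A_def indicator_def not_less)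
    have "ennreal (\<alpha> s) \<le> ennreal (\<alpha> (\<lambda>z. s z * indicator (- A n) z) + e)"
      using \<delta>[OF A n] by (intro ennreal_leI) simp
    also have "\<dots> \<le> ennreal (\<alpha> F + \<alpha> G + e)"
    proof (intro ennreal_leI add_right_mono)
      have "\<alpha> (\<lambda>z. s z * indicator (- A n) z) \<le> \<alpha> (\<lambda>z. of_real (norm (F z)) + of_real (norm (G z)))"
      proof (rule seminorm_mono)
        show "(\<lambda>z. s z * indicator (- A n) z) \<in> Linf"
          using sL A by (rule Linf_indicator_mult)
        show "(\<lambda>z. of_real (norm (F z)) + of_real (norm (G z))) \<in> Linf"
          using F G by (intro Linf_add Linf_norm_fun)
        show "AE z in arc_measure. norm (s z * indicator (- A n) z)
            \<le> norm (complex_of_real (norm (F z)) + of_real (norm (G z)))"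
          using le AE_space
        proof eventually_elim
          case (elim z)
          have "norm (complex_of_real (norm (F z)) + of_real (norm (G z))) = norm (F z) + norm (G z)"
            unfolding of_real_add[symmetric] norm_of_real by simp
          then show ?case
            using elim norm_triangle_ineq[of "f z" "g z"] by (simp add: F_def G_def indicator_def)
        qed
      qed
      also have "\<dots> \<le> \<alpha> F + \<alpha> G"
        using seminorm_triangle[OF Linf_norm_fun[OF F] Linf_norm_fun[OF G]]
        by (simp add: seminorm_norm F G)
      finally show "\<alpha> (\<lambda>z. s z * indicator (- A n) z) \<le> \<alpha> F + \<alpha> G" .
    qed
    also have "\<dots> = ext_seminorm \<alpha> F + ext_seminorm \<alpha> G + ennreal e"
      using F G \<open>0 < e\<close> by (simp add: ext_seminorm_Linf seminorm_nonneg)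
    also have "\<dots> \<le> ext_seminorm \<alpha> f + ext_seminorm \<alpha> g + ennreal e"
      by (intro add_right_mono add_mono ext_seminorm_mono)
        (auto simp: F_def G_def indicator_def)
    finally show "ennreal (\<alpha> s) \<le> ext_seminorm \<alpha> f + ext_seminorm \<alpha> g + ennreal e" .
  qed
qed

text \<open>By \<open>integral_correlation\<close> some rotation makes \<open>H - c\<close> and its rotate nonpositively
  correlated, so averaging the two at least halves the variance.\<close>

lemma averaging_step:
  fixes H :: "complex \<Rightarrow> real"
  assumes H [measurable]: "H \<in> borel_measurable arc_measure"
    and bound: "\<And>z. z \<in> unit_circle \<Longrightarrow> \<bar>H z\<bar> \<le> K"
  defines "c \<equiv> LINT z|arc_measure. H z"
  obtains G where "G \<in> borel_measurable arc_measure" "\<And>z. z \<in> unit_circle \<Longrightarrow> \<bar>G z\<bar> \<le> K"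
    "(LINT z|arc_measure. G z) = c" "\<alpha> (\<lambda>z. of_real (G z)) \<le> \<alpha> (\<lambda>z. of_real (H z))"
    "2 * (LINT z|arc_measure. (G z - c)\<^sup>2) \<le> (LINT z|arc_measure. (H z - c)\<^sup>2)"
proof -
  define u where "u z = H z - c" for z
  have [measurable]: "u \<in> borel_measurable arc_measure" unfolding u_def by measurable
  have ub: "\<bar>u z\<bar> \<le> K + \<bar>c\<bar>" if "z \<in> unit_circle" for z
    using bound[OF that] by (simp add: u_def)
  have intH: "integrable arc_measure H"
    using bound by (intro integrable_arc_measure_bounded[where K = K]) auto
  \<comment> \<open>Centring makes the mean of the correlations \<open>C w\<close> vanish, so one of
    them is at most 0.\<close>
  have u0: "(LINT z|arc_measure. u z) = 0"
    using intH arc.prob_space by (simp add: u_def c_def)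
  define C where "C w = (LINT z|arc_measure. u z * u (w * z))" for w
  have intC: "integrable arc_measure C" and C0: "(LINT w|arc_measure. C w) = 0"
    using integral_correlation[of u u "K + \<bar>c\<bar>" "K + \<bar>c\<bar>"] ub u0
    by (simp_all add: C_def[abs_def])
  have "\<exists>w\<in>unit_circle. C w \<le> 0"
  proof (rule ccontr)
    assume "\<not> ?thesis"
    then have "AE w in arc_measure. 0 < C w" by (auto simp: not_le)
    then have "0 < (LINT w|arc_measure. C w)" by (intro arc.expectation_greater intC)
    with C0 show False by simp
  qed
  then obtain w where w: "w \<in> unit_circle" "C w \<le> 0" by blast
  have [measurable]: "(\<lambda>z. H (w * z)) \<in> borel_measurable arc_measure"
    "(\<lambda>z. u (w * z)) \<in> borel_measurable arc_measure"
    by (rule measurable_compose[OF rotation_measurable[OF w(1)]]; measurable)+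
  have wz: "w * z \<in> unit_circle" if "z \<in> unit_circle" for z
    using w(1) that by (simp add: norm_mult)
  define G where "G z = (H z + H (w * z)) / 2" for z
  have [measurable]: "G \<in> borel_measurable arc_measure" unfolding G_def by measurable
  have intHw: "integrable arc_measure (\<lambda>z. H (w * z))"
    using bound wz by (intro integrable_arc_measure_bounded[where K = K]) auto
  have Gc: "(LINT z|arc_measure. G z) = c"
    using intH intHw integral_rotation[OF w(1) H] by (simp add: G_def c_def)
  have HL: "(\<lambda>z. complex_of_real (H z)) \<in> Linf"
    using bound by (intro LinfI[where K = K]) auto
  have HwL: "(\<lambda>z. complex_of_real (H (w * z))) \<in> Linf"
    using bound wz by (intro LinfI[where K = K]) auto
  \<comment> \<open>\<open>seminorm_rotation\<close> rotates by the conjugate of its argument, hence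
    the instance \<open>cnj w\<close>.\<close>
  have \<alpha>w: "\<alpha> (\<lambda>z. of_real (H (w * z))) = \<alpha> (\<lambda>z. of_real (H z))"
    using seminorm_rotation[OF HL, of "cnj w"] w(1) by simp
  have "(\<lambda>z. complex_of_real (G z)) = (\<lambda>z. 1 / 2 * (of_real (H z) + of_real (H (w * z))))"
    by (simp add: G_def)
  then have "\<alpha> (\<lambda>z. of_real (G z)) = 1 / 2 * \<alpha> (\<lambda>z. of_real (H z) + of_real (H (w * z)))"
    using seminorm_cmult[OF Linf_add[OF HL HwL], of "1 / 2"] by simp
  also have "\<dots> \<le> \<alpha> (\<lambda>z. of_real (H z))"
    using seminorm_triangle[OF HL HwL] by (simp add: \<alpha>w)
  finally have \<alpha>G: "\<alpha> (\<lambda>z. of_real (G z)) \<le> \<alpha> (\<lambda>z. of_real (H z))" .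
  have sq: "\<bar>(u z)\<^sup>2\<bar> \<le> (K + \<bar>c\<bar>)\<^sup>2" if "z \<in> unit_circle" for z
    using power_mono[OF ub[OF that], of 2] by simp
  have uu: "\<bar>u z * u (w * z)\<bar> \<le> (K + \<bar>c\<bar>)\<^sup>2" if "z \<in> unit_circle" for z
    unfolding abs_mult power2_eq_square
    using ub[OF that] ub[OF wz[OF that]] by (intro mult_mono) auto
  have i1: "integrable arc_measure (\<lambda>z. (u z)\<^sup>2)"
    using sq by (intro integrable_arc_measure_bounded[where K = "(K + \<bar>c\<bar>)\<^sup>2"]) auto
  have i2: "integrable arc_measure (\<lambda>z. (u (w * z))\<^sup>2)"
    using sq wz by (intro integrable_arc_measure_bounded[where K = "(K + \<bar>c\<bar>)\<^sup>2"]) auto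
  have i3: "integrable arc_measure (\<lambda>z. u z * u (w * z))"
    using uu by (intro integrable_arc_measure_bounded[where K = "(K + \<bar>c\<bar>)\<^sup>2"]) auto
  \<comment> \<open>G - c is the mean of u and its rotate. Both squares have the same integral, so
    together they contribute half the variance, and the cross term contributes \<open>C w\<close> /
    2 \<le> 0.\<close>
  have "(LINT z|arc_measure. (G z - c)\<^sup>2)
      = (LINT z|arc_measure. 1 / 4 * ((u z)\<^sup>2 + (u (w * z))\<^sup>2) + 1 / 2 * (u z * u (w * z)))"
    by (intro Bochner_Integration.integral_cong)
      (auto simp: G_def u_def power2_eq_square field_simps)
  also have "\<dots> = 1 / 4 * ((LINT z|arc_measure. (u z)\<^sup>2) + (LINT z|arc_measure. (u (w * z))\<^sup>2)) + 1 / 2 * C w"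
    using i1 i2 i3 by (simp add: C_def)
  also have "(LINT z|arc_measure. (u (w * z))\<^sup>2) = (LINT z|arc_measure. (u z)\<^sup>2)"
    using integral_rotation[OF w(1), of "\<lambda>z. (u z)\<^sup>2"] by simp
  finally have var: "2 * (LINT z|arc_measure. (G z - c)\<^sup>2) \<le> (LINT z|arc_measure. (H z - c)\<^sup>2)"
    using w(2) by (simp add: u_def)
  show thesis
  proof (rule that[OF _ _ Gc \<alpha>G var])
    show "\<bar>G z\<bar> \<le> K" if "z \<in> unit_circle" for z
      using bound[OF that] bound[OF wz[OF that]] by (simp add: G_def)
  qed measurable
qed

lemma averaging:
  fixes H :: "complex \<Rightarrow> real"
  assumes "H \<in> borel_measurable arc_measure"
    and "\<And>z. z \<in> unit_circle \<Longrightarrow> \<bar>H z\<bar> \<le> K"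
  defines "c \<equiv> LINT z|arc_measure. H z"
  shows "\<exists>G. G \<in> borel_measurable arc_measure \<and> (\<forall>z\<in>unit_circle. \<bar>G z\<bar> \<le> K) \<and>
    (LINT z|arc_measure. G z) = c \<and> \<alpha> (\<lambda>z. of_real (G z)) \<le> \<alpha> (\<lambda>z. of_real (H z)) \<and>
    2 ^ n * (LINT z|arc_measure. (G z - c)\<^sup>2) \<le> (LINT z|arc_measure. (H z - c)\<^sup>2)"
proof (induction n)
  case 0
  then show ?case using assms by (intro exI[of _ H]) auto
next
  case (Suc n)
  then obtain G where G: "G \<in> borel_measurable arc_measure" "\<And>z. z \<in> unit_circle \<Longrightarrow> \<bar>G z\<bar> \<le> K"
    "(LINT z|arc_measure. G z) = c" "\<alpha> (\<lambda>z. of_real (G z)) \<le> \<alpha> (\<lambda>z. of_real (H z))"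
    "2 ^ n * (LINT z|arc_measure. (G z - c)\<^sup>2) \<le> (LINT z|arc_measure. (H z - c)\<^sup>2)"
    by blast
  obtain G' where G': "G' \<in> borel_measurable arc_measure" "\<And>z. z \<in> unit_circle \<Longrightarrow> \<bar>G' z\<bar> \<le> K"
    "(LINT z|arc_measure. G' z) = c" "\<alpha> (\<lambda>z. of_real (G' z)) \<le> \<alpha> (\<lambda>z. of_real (G z))"
    "2 * (LINT z|arc_measure. (G' z - c)\<^sup>2) \<le> (LINT z|arc_measure. (G z - c)\<^sup>2)"
    using averaging_step[OF G(1,2), unfolded G(3)] by blast
  have "2 ^ Suc n * (LINT z|arc_measure. (G' z - c)\<^sup>2) = 2 ^ n * (2 * (LINT z|arc_measure. (G' z - c)\<^sup>2))"
    by simp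
  also have "\<dots> \<le> 2 ^ n * (LINT z|arc_measure. (G z - c)\<^sup>2)"
    by (intro mult_left_mono G') simp
  also have "\<dots> \<le> (LINT z|arc_measure. (H z - c)\<^sup>2)" by (rule G)
  finally show ?case using G' order_trans[OF G'(4) G(4)] by blast
qed

text \<open>Truncation continuity enters only for the constant 1: the indicator of the complement of
  a small set has value at least 1 - \<epsilon>. With A the set where an averaged G falls below c -
  \<epsilon>, Chebyshev's inequality makes A small, and c - \<epsilon> times that indicator lies
  below G when c exceeds \<epsilon>.\<close>

lemma integral_le_seminorm:
  fixes H :: "complex \<Rightarrow> real"
  assumes tc: truncation_continuous and H: "H \<in> borel_measurable arc_measure"
    and bound: "\<And>z. z \<in> unit_circle \<Longrightarrow> \<bar>H z\<bar> \<le> K"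
  shows "(LINT z|arc_measure. H z) \<le> \<alpha> (\<lambda>z. of_real (H z))"
proof -
  define c where "c = (LINT z|arc_measure. H z)"
  define V where "V = (LINT z|arc_measure. (H z - c)\<^sup>2)"
  have "c \<le> \<alpha> (\<lambda>z. of_real (H z))"
  proof (rule le_of_one_minus_mult_le)
    fix \<epsilon> :: real assume \<epsilon>: "0 < \<epsilon>" "\<epsilon> < 1"
    obtain \<delta> where "0 < \<delta>" and small: "\<forall>A\<in>sets arc_measure. measure arc_measure A < \<delta> \<longrightarrow>
        \<alpha> (\<lambda>z. 1) - \<epsilon> \<le> \<alpha> (\<lambda>z. 1 * indicator (- A) z)"
      using truncation_continuousD[OF tc simple_function_const \<epsilon>(1)] .
    note \<delta> = small[rule_format]
    \<comment> \<open>Chosen so that Chebyshev's bound V / (2^n \<epsilon>^2) for the measure of A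
      falls below \<open>\<delta>\<close>.\<close>
    obtain n where n: "V / (\<epsilon>\<^sup>2 * \<delta>) < 2 ^ n"
      using real_arch_pow[of 2 "V / (\<epsilon>\<^sup>2 * \<delta>)"] by auto
    obtain G where G [measurable]: "G \<in> borel_measurable arc_measure"
      and Gb: "\<And>z. z \<in> unit_circle \<Longrightarrow> \<bar>G z\<bar> \<le> K"
      and G\<alpha>: "\<alpha> (\<lambda>z. of_real (G z)) \<le> \<alpha> (\<lambda>z. of_real (H z))"
      and GV: "2 ^ n * (LINT z|arc_measure. (G z - c)\<^sup>2) \<le> V"
      using averaging[OF H bound, of n] unfolding c_def V_def by blast
    define A where "A = {z \<in> space arc_measure. G z < c - \<epsilon>}"
    have A [measurable]: "A \<in> sets arc_measure" unfolding A_def by measurable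
    have bd: "\<bar>(G z - c)\<^sup>2\<bar> \<le> (K + \<bar>c\<bar>)\<^sup>2" if "z \<in> unit_circle" for z
      using power_mono[of "\<bar>G z - c\<bar>" "K + \<bar>c\<bar>" 2] Gb[OF that] by simp
    have "\<epsilon>\<^sup>2 * measure arc_measure A = (LINT z|arc_measure. \<epsilon>\<^sup>2 * indicator A z)"
      using sets.Int_space_eq2[OF A] by simp
    also have "\<dots> \<le> (LINT z|arc_measure. (G z - c)\<^sup>2)"
    proof (rule integral_mono)
      show "integrable arc_measure (\<lambda>z. \<epsilon>\<^sup>2 * indicator A z)"
        by (intro integrable_arc_measure_bounded[where K = "\<epsilon>\<^sup>2"]) (auto simp: indicator_def)
      show "integrable arc_measure (\<lambda>z. (G z - c)\<^sup>2)"
        using bd by (intro integrable_arc_measure_bounded[where K = "(K + \<bar>c\<bar>)\<^sup>2"]) auto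
      show "\<epsilon>\<^sup>2 * indicator A z \<le> (G z - c)\<^sup>2" for z
        using \<epsilon> power_mono[of \<epsilon> "c - G z" 2]
        by (auto simp: indicator_def A_def power2_commute[of "G z"])
    qed
    finally have "2 ^ n * (\<epsilon>\<^sup>2 * measure arc_measure A) \<le> 2 ^ n * (LINT z|arc_measure. (G z - c)\<^sup>2)"
      by (intro mult_left_mono) auto
    also note GV
    also have "V < 2 ^ n * (\<epsilon>\<^sup>2 * \<delta>)"
      using n \<epsilon> \<open>0 < \<delta>\<close> by (simp add: pos_divide_less_eq)
    finally have mA: "measure arc_measure A < \<delta>"
      using \<epsilon> by simp
    have GL: "(\<lambda>z. complex_of_real (G z)) \<in> Linf"
      using Gb by (intro LinfI[where K = K]) auto
    have iL: "(\<lambda>z. 1 * indicator (- A) z) \<in> Linf"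
      by (rule Linf_indicator_mult[OF Linf_const A])
    show "(1 - \<epsilon>) * (c - \<epsilon>) \<le> \<alpha> (\<lambda>z. of_real (H z))"
    \<comment> \<open>If c is at most \<open>\<epsilon>\<close>, the left side is nonpositive;
      otherwise c - \<epsilon> is positive and moves into \<alpha> as a scalar.\<close>
    proof (cases "c \<le> \<epsilon>")
      case True
      then have "(1 - \<epsilon>) * (c - \<epsilon>) \<le> 0" using \<epsilon> by (intro mult_nonneg_nonpos) auto
      also have "0 \<le> \<alpha> (\<lambda>z. of_real (H z))"
        using seminorm_nonneg[OF GL] G\<alpha> by (rule order_trans)
      finally show ?thesis .
    next
      case False
      have "(1 - \<epsilon>) * (c - \<epsilon>) \<le> \<alpha> (\<lambda>z. 1 * indicator (- A) z) * (c - \<epsilon>)"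
        using \<delta>[OF A mA] False by (intro mult_right_mono) (simp_all add: seminorm_const)
      also have "\<dots> = \<alpha> (\<lambda>z. of_real (c - \<epsilon>) * (1 * indicator (- A) z))"
        using False by (simp only: seminorm_cmult[OF iL] norm_of_real) simp
      also have "\<dots> \<le> \<alpha> (\<lambda>z. of_real (G z))"
      proof (rule seminorm_mono[OF Linf_cmult[OF iL] GL], rule AE_I2)
        fix z assume "z \<in> space arc_measure"
        then show "norm (complex_of_real (c - \<epsilon>) * (1 * indicator (- A) z)) \<le> norm (complex_of_real (G z))"
          using False unfolding norm_mult norm_of_real by (auto simp: A_def indicator_def)
      qed
      also note G\<alpha>
      finally show ?thesis .
    qed
  qed
  then show ?thesis by (simp add: c_def)
qed

text \<open>\<open>integral_le_seminorm\<close> speaks of bounded functions, so |f| is truncated at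
  height n, and monotone convergence removes the truncation.\<close>

lemma L1_norm_le_ext_seminorm:
  assumes tc: truncation_continuous and [measurable]: "f \<in> borel_measurable arc_measure"
  shows "L1_norm f \<le> ext_seminorm \<alpha> f"
proof -
  define H where "H n z = min (norm (f z)) (real n)" for n z
  have [measurable]: "H n \<in> borel_measurable arc_measure" for n
    unfolding H_def by measurable
  have H0: "0 \<le> H n z" "\<bar>H n z\<bar> \<le> real n" "H n z \<le> norm (f z)" for n z
    by (auto simp: H_def)
  have le: "(\<integral>\<^sup>+z. ennreal (H n z) \<partial>arc_measure) \<le> ext_seminorm \<alpha> f" for n
  proof -
    have "integrable arc_measure (H n)"
      using H0 by (intro integrable_arc_measure_bounded[where K = "real n"]) auto
    then have "(\<integral>\<^sup>+z. ennreal (H n z) \<partial>arc_measure) = ennreal (LINT z|arc_measure. H n z)"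
      using H0 by (intro nn_integral_eq_integral) auto
    also have "\<dots> \<le> ennreal (\<alpha> (\<lambda>z. of_real (H n z)))"
      using H0 by (intro ennreal_leI integral_le_seminorm[OF tc, where K = "real n"]) auto
    also have "\<dots> = ext_seminorm \<alpha> (\<lambda>z. of_real (H n z))"
      using H0 by (intro ext_seminorm_Linf[symmetric] LinfI[where K = "real n"]) auto
    also have "\<dots> \<le> ext_seminorm \<alpha> f"
      using H0 by (intro ext_seminorm_mono) auto
    finally show ?thesis .
  qed
  have "(\<lambda>n. \<integral>\<^sup>+z. ennreal (H n z) \<partial>arc_measure) \<longlonglongrightarrow> (\<integral>\<^sup>+z. ennreal (norm (f z)) \<partial>arc_measure)"
  proof (rule nn_integral_LIMSEQ)
    show "incseq (\<lambda>n z. ennreal (H n z))"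
      by (auto simp: incseq_def le_fun_def H_def intro!: ennreal_leI)
    show "(\<lambda>n. ennreal (H n z)) \<longlonglongrightarrow> ennreal (norm (f z))" for z
    proof (rule tendsto_eventually)
      show "\<forall>\<^sub>F n in sequentially. ennreal (H n z) = ennreal (norm (f z))"
        using eventually_ge_at_top[of "nat \<lceil>norm (f z)\<rceil>"]
        by eventually_elim (simp add: H_def nat_le_iff ceiling_le_iff)
    qed
  qed measurable
  then show ?thesis
    unfolding L1_norm_def by (rule LIMSEQ_le_const2) (use le in auto)
qed

end

section \<open>Characteristic functions of small sets\<close>

lemma eventually_small_sets_measurable:
  "\<forall>\<^sub>F E in small_sets. E \<in> sets arc_measure \<and> 0 < measure arc_measure E"
  unfolding eventually_small_sets by (intro exI[of _ 1]) auto

lemma Linf_norm_indicator_ge: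
  assumes E: "E \<in> sets arc_measure" "0 < measure arc_measure E"
  shows "1 \<le> Linf_norm (indicator E)"
proof (rule ccontr)
  assume "\<not> 1 \<le> Linf_norm (indicator E)"
  then have lt: "Linf_norm (indicator E) < 1" by simp
  have "AE z in arc_measure. ennreal (norm (indicator E z :: complex)) \<le> Linf_norm (indicator E)"
    using Linf_norm_le_iff[OF Linf_measurable[OF Linf_indicator[OF E(1)]]] by blast
  then have "AE z in arc_measure. z \<notin> E"
  proof eventually_elim
    case (elim z)
    show ?case
    proof
      assume "z \<in> E"
      with elim lt show False by simp
    qed
  qed
  then have "measure arc_measure E = 0"
    by (simp only: arc.prob_eq_0[OF E(1)])
  with E(2) show False by simp
qed

context rotation_seminorm
begin

lemma continuous_seminorm_iff_Limsup:
  "continuous_seminorm \<alpha> \<longleftrightarrow> Limsup small_sets (\<lambda>E. ennreal (\<alpha> (indicator E))) = 0"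
proof
  assume "continuous_seminorm \<alpha>"
  then have "((\<lambda>E. ennreal (\<alpha> (indicator E))) \<longlongrightarrow> ennreal 0) small_sets"
    unfolding continuous_seminorm_def by (rule tendsto_ennrealI)
  then show "Limsup small_sets (\<lambda>E. ennreal (\<alpha> (indicator E))) = 0"
    using lim_imp_Limsup[OF small_sets_neq_bot] by simp
next
  assume L: "Limsup small_sets (\<lambda>E. ennreal (\<alpha> (indicator E))) = 0"
  show "continuous_seminorm \<alpha>"
    unfolding continuous_seminorm_def
  proof (rule tendstoI)
    fix e :: real assume "0 < e"
    then have "Limsup small_sets (\<lambda>E. ennreal (\<alpha> (indicator E))) < ennreal e"
      unfolding L by simp
    then have "\<forall>\<^sub>F E in small_sets. ennreal (\<alpha> (indicator E)) < ennreal e"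
      by (rule Limsup_lessD)
    then show "\<forall>\<^sub>F E in small_sets. dist (\<alpha> (indicator E)) 0 < e"
      using eventually_small_sets_measurable
    proof eventually_elim
      case (elim E)
      then show ?case
        using seminorm_nonneg[OF Linf_indicator, of E] by (simp add: ennreal_less_iff)
    qed
  qed
qed

text \<open>The value at an indicator is monotone in the set, and every set of positive measure
  contains subsets of arbitrarily small positive measure; so no set can stay strictly below the
  values on all small sets.\<close>

lemma Liminf_small_sets:
  "Liminf small_sets (\<lambda>E. ennreal (\<alpha> (indicator E))) =
    (INF E \<in> {E \<in> sets arc_measure. 0 < measure arc_measure E}. ennreal (\<alpha> (indicator E)))"
    (is "?L = ?I")
proof (rule antisym)
  show "?I \<le> ?L"
    by (rule Liminf_bounded, rule eventually_mono[OF eventually_small_sets_measurable])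
      (auto intro: INF_lower)
  show "?L \<le> ?I"
  proof (rule INF_greatest, elim CollectE conjE, rule ccontr)
    fix E assume E: "E \<in> sets arc_measure" "0 < measure arc_measure E"
      and "\<not> ?L \<le> ennreal (\<alpha> (indicator E))"
    then have "\<forall>\<^sub>F F in small_sets. ennreal (\<alpha> (indicator E)) < ennreal (\<alpha> (indicator F))"
      by (intro less_LiminfD) simp
    then obtain \<delta> where \<delta>: "0 < \<delta>" "\<And>F. F \<in> sets arc_measure \<Longrightarrow> 0 < measure arc_measure F \<Longrightarrow>
        measure arc_measure F < \<delta> \<Longrightarrow> ennreal (\<alpha> (indicator E)) < ennreal (\<alpha> (indicator F))"
      unfolding eventually_small_sets by blast
    obtain F where F: "F \<in> sets arc_measure" "F \<subseteq> E" "0 < measure arc_measure F"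
      "measure arc_measure F < \<delta>"
      using exists_small_subset[OF E \<delta>(1)] .
    have "\<alpha> (indicator F) \<le> \<alpha> (indicator E)"
      using E F by (intro seminorm_mono Linf_indicator) (auto simp: indicator_def)
    then have "ennreal (\<alpha> (indicator F)) \<le> ennreal (\<alpha> (indicator E))"
      by (rule ennreal_leI)
    with \<delta>(2)[OF F(1,3,4)] show False by simp
  qed
qed

text \<open>Let x be the extended seminorm of h. If the norm of h exceeded x / t, a number y between
  them would give a set E of positive measure with |h| > y, and then x would be at least y times
  \<open>\<alpha> (indicator E)\<close>, hence at least y t > x.\<close>

lemma Linf_norm_lower_bound:
  assumes "0 < t"
    and lower: "\<And>E. E \<in> sets arc_measure \<Longrightarrow> 0 < measure arc_measure E \<Longrightarrow> t \<le> \<alpha> (indicator E)"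
    and h [measurable]: "h \<in> borel_measurable arc_measure"
  shows "ennreal t * Linf_norm h \<le> ext_seminorm \<alpha> h"
proof (cases "ext_seminorm \<alpha> h")
  case (real x)
  have "Linf_norm h \<le> ennreal (x / t)"
  proof (rule ccontr)
    assume "\<not> ?thesis"
    then obtain y' where y': "ennreal (x / t) < y'" "y' < Linf_norm h"
      using dense by (metis not_le)
    then obtain y where y: "y' = ennreal y" "0 \<le> y"
      by (cases y') auto
    then have xy: "x / t < y"
      using y'(1) real \<open>0 < t\<close> by (simp add: ennreal_less_iff)
    define E where "E = {z \<in> space arc_measure. ennreal y < ennreal (norm (h z))}"
    have E: "E \<in> sets arc_measure" unfolding E_def by measurable
    have "0 < emeasure arc_measure E"
      unfolding E_def using y' y by (intro esssup_pos_measure) (auto simp: Linf_norm_def)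
    then have "0 < measure arc_measure E"
      by (simp add: arc.emeasure_eq_measure)
    then have "t \<le> \<alpha> (indicator E)" using E by (rule lower[rotated])
    then have "ennreal (y * t) \<le> ennreal (y * \<alpha> (indicator E))"
      using y by (intro ennreal_leI mult_left_mono)
    also have "\<dots> = ext_seminorm \<alpha> (\<lambda>z. of_real y * indicator E z)"
      using y ext_seminorm_Linf[OF Linf_cmult[OF Linf_indicator[OF E]]]
      by (simp add: seminorm_cmult[OF Linf_indicator[OF E]])
    also have "\<dots> \<le> ext_seminorm \<alpha> h"
      using y by (intro ext_seminorm_mono AE_I2)
        (auto simp: E_def ennreal_less_iff norm_mult indicator_def)
    finally have "y * t \<le> x"
      using real by (simp add: ennreal_le_iff)
    with xy \<open>0 < t\<close> show False by (simp add: pos_divide_less_eq)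
  qed
  then have "ennreal t * Linf_norm h \<le> ennreal t * ennreal (x / t)"
    by (rule mult_left_mono) simp
  also have "\<dots> = ennreal x"
    using \<open>0 < t\<close> real by (simp add: ennreal_mult'[symmetric])
  finally show ?thesis using real by simp
qed simp

lemma Liminf_small_sets_ge_iff:
  assumes "0 < t"
  shows "ennreal t \<le> Liminf small_sets (\<lambda>E. ennreal (\<alpha> (indicator E))) \<longleftrightarrow>
    (\<forall>h \<in> borel_measurable arc_measure.
      ennreal t * Linf_norm h \<le> ext_seminorm \<alpha> h \<and> ext_seminorm \<alpha> h \<le> Linf_norm h)"
proof
  assume L: "ennreal t \<le> Liminf small_sets (\<lambda>E. ennreal (\<alpha> (indicator E)))"
  have "t \<le> \<alpha> (indicator E)" if E: "E \<in> sets arc_measure" "0 < measure arc_measure E" for E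
  proof -
    have "ennreal t \<le> ennreal (\<alpha> (indicator E))"
      using L E unfolding Liminf_small_sets le_INF_iff by auto
    then show ?thesis
      using seminorm_nonneg[OF Linf_indicator[OF E(1)]] by (simp add: ennreal_le_iff)
  qed
  then show "\<forall>h \<in> borel_measurable arc_measure.
      ennreal t * Linf_norm h \<le> ext_seminorm \<alpha> h \<and> ext_seminorm \<alpha> h \<le> Linf_norm h"
    using Linf_norm_lower_bound[OF \<open>0 < t\<close>] ext_seminorm_le_Linf_norm by blast
next
  assume *: "\<forall>h \<in> borel_measurable arc_measure.
      ennreal t * Linf_norm h \<le> ext_seminorm \<alpha> h \<and> ext_seminorm \<alpha> h \<le> Linf_norm h"
  have "ennreal t \<le> ennreal (\<alpha> (indicator E))"
    if E: "E \<in> sets arc_measure" "0 < measure arc_measure E" for E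
  proof -
    have "ennreal t = ennreal t * 1" by simp
    also have "\<dots> \<le> ennreal t * Linf_norm (indicator E)"
      by (intro mult_left_mono Linf_norm_indicator_ge E) simp
    also have "\<dots> \<le> ext_seminorm \<alpha> (indicator E)"
      using * Linf_measurable[OF Linf_indicator[OF E(1)]] by blast
    also have "\<dots> = ennreal (\<alpha> (indicator E))"
      by (rule ext_seminorm_Linf[OF Linf_indicator[OF E(1)]])
    finally show ?thesis .
  qed
  then show "ennreal t \<le> Liminf small_sets (\<lambda>E. ennreal (\<alpha> (indicator E)))"
    unfolding Liminf_small_sets le_INF_iff by auto
qed

text \<open>Exchanging E - F into F - E and fixing E \<inter> F carries E into F up to a null set.
  In particular the value at an indicator depends only on the measure of the set.\<close>

lemma seminorm_indicator_mono_measure: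
  assumes S: "\<alpha> \<in> symmetric_gauge_seminorms"
    and E: "E \<in> sets arc_measure" and F: "F \<in> sets arc_measure"
    and le: "measure arc_measure E \<le> measure arc_measure F"
  shows "\<alpha> (indicator E) \<le> \<alpha> (indicator F)"
proof -
  let ?m = "measure arc_measure"
  have "?m (E - F) = ?m E - ?m (E \<inter> F)" "?m (F - E) = ?m F - ?m (E \<inter> F)"
    using E F arc.finite_measure_Diff'[of E F] arc.finite_measure_Diff'[of F E]
    by (simp_all add: Int_commute)
  with le have le': "?m (E - F) \<le> ?m (F - E)" by simp
  have "(E - F) \<inter> (F - E) = {}" by auto
  then obtain \<phi> where imp: "invertible_measure_preserving \<phi>"
    and inv: "\<And>z. z \<in> unit_circle \<Longrightarrow> \<phi> (\<phi> z) = z"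
    and ident: "\<And>z. z \<notin> (E - F) \<union> (F - E) \<Longrightarrow> \<phi> z = z"
    and AE: "AE z in arc_measure. \<phi> z \<in> E - F \<longrightarrow> z \<in> F - E"
    using exchange_involution[OF sets.Diff[OF E F] sets.Diff[OF F E] _ le'] by blast
  have IF: "indicator E \<circ> \<phi> \<in> Linf"
    by (rule Linf_comp[OF Linf_indicator[OF E] imp])
  have "\<alpha> (indicator E) = \<alpha> (indicator E \<circ> \<phi>)"
    by (rule seminorm_comp[OF S Linf_indicator[OF E] imp, symmetric])
  also have "\<dots> \<le> \<alpha> (indicator F)"
  proof (rule seminorm_mono[OF IF Linf_indicator[OF F]])
    show "AE z in arc_measure. norm ((indicator E \<circ> \<phi>) z :: complex) \<le> norm (indicator F z :: complex)"
      using AE AE_space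
    proof eventually_elim
      case (elim z)
      have "z \<in> F" if "\<phi> z \<in> E"
      proof (cases "\<phi> z \<in> F")
        case True
        then have "\<phi> (\<phi> z) = \<phi> z" using that by (intro ident) auto
        then show ?thesis using inv[of z] elim(2) True by simp
      qed (use elim(1) that in auto)
      then show ?case by (auto simp: indicator_def)
    qed
  qed
  finally show ?thesis .
qed

lemma discontinuous_symmetric_iff:
  assumes S: "\<alpha> \<in> symmetric_gauge_seminorms"
  shows "\<not> continuous_seminorm \<alpha> \<longleftrightarrow> equivalent_to_Linf_norm \<alpha>"
proof
  assume "\<not> continuous_seminorm \<alpha>"
  then obtain \<eta> where "0 < \<eta>"
    and \<eta>: "\<not> (\<forall>\<^sub>F E in small_sets. dist (\<alpha> (indicator E)) 0 < \<eta>)"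
    unfolding continuous_seminorm_def tendsto_iff by blast
  have lower: "\<eta> \<le> \<alpha> (indicator F)" if F: "F \<in> sets arc_measure" "0 < measure arc_measure F" for F
  proof -
    \<comment> \<open>Failure of the limit, tested with \<open>\<delta>\<close> equal to the measure
      of F, yields a smaller set E with value at least \<open>\<eta>\<close>.\<close>
    obtain E where E: "E \<in> sets arc_measure" "measure arc_measure E < measure arc_measure F"
      "\<not> dist (\<alpha> (indicator E)) 0 < \<eta>"
      using \<eta> F(2) unfolding eventually_small_sets by blast
    have "\<eta> \<le> \<alpha> (indicator E)"
      using E(3) seminorm_nonneg[OF Linf_indicator[OF E(1)]] by simp
    also have "\<dots> \<le> \<alpha> (indicator F)"
      using E(2) by (intro seminorm_indicator_mono_measure S E F) simp
    finally show ?thesis .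
  qed
  have "ennreal \<eta> * Linf_norm f \<le> ennreal (\<alpha> f) \<and> ennreal (\<alpha> f) \<le> ennreal 1 * Linf_norm f"
    if "f \<in> Linf" for f
    using Linf_norm_lower_bound[OF \<open>0 < \<eta>\<close> lower Linf_measurable[OF that]]
      ext_seminorm_le_Linf_norm[OF Linf_measurable[OF that]]
    by (simp add: ext_seminorm_Linf[OF that])
  then show "equivalent_to_Linf_norm \<alpha>"
    unfolding equivalent_to_Linf_norm_def using \<open>0 < \<eta>\<close> zero_less_one by blast
next
  assume "equivalent_to_Linf_norm \<alpha>"
  then obtain c where "0 < c" and c: "\<And>f. f \<in> Linf \<Longrightarrow> ennreal c * Linf_norm f \<le> ennreal (\<alpha> f)"
    unfolding equivalent_to_Linf_norm_def by blast
  have lower: "c \<le> \<alpha> (indicator E)" if E: "E \<in> sets arc_measure" "0 < measure arc_measure E" for E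
  proof -
    have "ennreal c = ennreal c * 1" by simp
    also have "\<dots> \<le> ennreal c * Linf_norm (indicator E)"
      by (intro mult_left_mono Linf_norm_indicator_ge E) simp
    also have "\<dots> \<le> ennreal (\<alpha> (indicator E))"
      by (rule c[OF Linf_indicator[OF E(1)]])
    finally show ?thesis
      using seminorm_nonneg[OF Linf_indicator[OF E(1)]] by (simp add: ennreal_le_iff)
  qed
  show "\<not> continuous_seminorm \<alpha>"
  proof
    assume "continuous_seminorm \<alpha>"
    then obtain \<delta> where \<delta>: "0 < \<delta>"
      "\<And>A. A \<in> sets arc_measure \<Longrightarrow> measure arc_measure A < \<delta> \<Longrightarrow> \<alpha> (indicator A) < c"
      using continuous_seminormD[OF _ \<open>0 < c\<close>] by metis
    obtain E where "E \<in> sets arc_measure" "0 < measure arc_measure E" "measure arc_measure E < \<delta>"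
      using exists_small_set[OF \<delta>(1)] .
    then show False using lower[of E] \<delta>(2)[of E] by simp
  qed
qed

section \<open>Monotone convergence and the norm on \<open>calL\<close>\<close>

lemma truncation_continuous:
  assumes "\<alpha> \<in> symmetric_gauge_seminorms \<union> continuous_rotation_symmetric_seminorms"
  shows truncation_continuous
  using assms truncation_continuous_symmetric truncation_continuous_continuous
  unfolding continuous_rotation_symmetric_seminorms_def by blast

text \<open>Monotonicity gives a limit that is at most the value at f; Fatou's lemma with the
  supremum as bound gives the reverse.\<close>

lemma ext_seminorm_monotone_convergence:
  assumes tc: truncation_continuous
    and fs: "\<And>n. fs n \<in> borel_measurable arc_measure"
    and mono: "AE z in arc_measure. \<forall>n. fs n z \<in> \<real>\<^sub>\<ge>\<^sub>0 \<and> Re (fs n z) \<le> Re (fs (Suc n) z)"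
    and lim: "AE z in arc_measure. (\<lambda>n. fs n z) \<longlonglongrightarrow> f z"
  shows "(\<lambda>n. ext_seminorm \<alpha> (fs n)) \<longlonglongrightarrow> ext_seminorm \<alpha> f"
proof -
  have norm: "norm z = Re z" if "z \<in> \<real>\<^sub>\<ge>\<^sub>0" for z :: complex
    using that by (auto simp: complex_nonneg_Reals_iff cmod_eq_Re)
  have "incseq (\<lambda>n. ext_seminorm \<alpha> (fs n))"
  proof (rule incseq_SucI, rule ext_seminorm_mono)
    show "AE z in arc_measure. norm (fs n z) \<le> norm (fs (Suc n) z)" for n
      using mono by eventually_elim (simp add: norm)
  qed
  then have "(\<lambda>n. ext_seminorm \<alpha> (fs n)) \<longlonglongrightarrow> (SUP n. ext_seminorm \<alpha> (fs n))"
    by (rule LIMSEQ_SUP)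
  also have "(SUP n. ext_seminorm \<alpha> (fs n)) = ext_seminorm \<alpha> f"
  proof (rule antisym)
    show "(SUP n. ext_seminorm \<alpha> (fs n)) \<le> ext_seminorm \<alpha> f"
    proof (rule SUP_least, rule ext_seminorm_mono)
      show "AE z in arc_measure. norm (fs n z) \<le> norm (f z)" for n
        using mono lim
      proof eventually_elim
        case (elim z)
        have "incseq (\<lambda>n. Re (fs n z))" using elim(1) by (intro incseq_SucI) simp
        then have "Re (fs n z) \<le> Re (f z)"
          using tendsto_Re[OF elim(2)] by (rule incseq_le)
        then show ?case
          using elim(1) norm[of "fs n z"] complex_Re_le_cmod[of "f z"] by simp
      qed
    qed
    show "ext_seminorm \<alpha> f \<le> (SUP n. ext_seminorm \<alpha> (fs n))"
      by (rule ext_seminorm_Fatou[OF tc fs lim always_eventually]) (intro allI SUP_upper UNIV_I)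
  qed
  finally show ?thesis .
qed

lemma calL_iff: "f \<in> calL \<alpha> \<longleftrightarrow> f \<in> borel_measurable arc_measure \<and> ext_seminorm \<alpha> f < \<infinity>"
  by (simp add: calL_def)

text \<open>Definiteness comes from the L^1 bound: a function of value 0 has vanishing L^1
  norm.\<close>

lemma norm_on_calL:
  assumes tc: truncation_continuous
  shows "norm_on (calL \<alpha>) (ext_seminorm \<alpha>)"
  unfolding norm_on_def
proof (intro conjI ballI allI impI)
  have zero: "ext_seminorm \<alpha> (\<lambda>z. 0) = 0"
    using ext_seminorm_Linf[OF Linf_const[of 0]] by (simp add: seminorm_const)
  then show "(\<lambda>z. 0) \<in> calL \<alpha>"
    by (simp add: calL_iff)
  fix f assume "f \<in> calL \<alpha>"
  then have f [measurable]: "f \<in> borel_measurable arc_measure" and ff: "ext_seminorm \<alpha> f < \<infinity>"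
    by (simp_all add: calL_iff)
  show "ext_seminorm \<alpha> f < \<infinity>" by (rule ff)
  show "(\<lambda>z. c * f z) \<in> calL \<alpha>" for c
    using ff by (simp add: calL_iff ext_seminorm_cmult ennreal_mult_less_top)
  show "ext_seminorm \<alpha> (\<lambda>z. c * f z) = ennreal (norm c) * ext_seminorm \<alpha> f" for c
    by (rule ext_seminorm_cmult)
  show "ext_seminorm \<alpha> f = 0 \<longleftrightarrow> (AE z in arc_measure. f z = 0)"
  proof
    assume "ext_seminorm \<alpha> f = 0"
    then have "(\<integral>\<^sup>+z. ennreal (norm (f z)) \<partial>arc_measure) = 0"
      using L1_norm_le_ext_seminorm[OF tc f] by (simp add: L1_norm_def)
    then show "AE z in arc_measure. f z = 0"
      by (subst (asm) nn_integral_0_iff_AE) auto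
  next
    assume "AE z in arc_measure. f z = 0"
    then have "ext_seminorm \<alpha> f \<le> ext_seminorm \<alpha> (\<lambda>z. 0)"
      by (intro ext_seminorm_mono) (auto elim: eventually_mono)
    then show "ext_seminorm \<alpha> f = 0" by (simp add: zero)
  qed
  fix g assume "g \<in> calL \<alpha>"
  then have g [measurable]: "g \<in> borel_measurable arc_measure" and fg: "ext_seminorm \<alpha> g < \<infinity>"
    by (simp_all add: calL_iff)
  show tri: "ext_seminorm \<alpha> (\<lambda>z. f z + g z) \<le> ext_seminorm \<alpha> f + ext_seminorm \<alpha> g"
    by (rule ext_seminorm_triangle[OF tc f g])
  have "ext_seminorm \<alpha> f + ext_seminorm \<alpha> g < \<infinity>"
    using ff fg by simp
  with tri have "ext_seminorm \<alpha> (\<lambda>z. f z + g z) < \<infinity>"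
    by (rule le_less_trans)
  then show "(\<lambda>z. f z + g z) \<in> calL \<alpha>"
    by (simp add: calL_iff)
  assume eq: "AE z in arc_measure. f z = g z"
  show "ext_seminorm \<alpha> f = ext_seminorm \<alpha> g"
    using eq by (intro antisym ext_seminorm_mono) (auto elim: eventually_mono)
qed

end

section \<open>Continuous functions and completeness\<close>

lemma continuous_functions_Linf: "continuous_functions \<subseteq> Linf"
proof
  fix f assume "f \<in> continuous_functions"
  then have f: "continuous_on unit_circle f" by (simp add: continuous_functions_def)
  have "f \<in> borel_measurable (restrict_space borel unit_circle)"
    using f by (rule borel_measurable_continuous_on_restrict)
  then have meas: "f \<in> borel_measurable arc_measure"
    by (simp add: measurable_cong_sets[OF sets_arc_measure refl])
  have "bounded (f ` unit_circle)"
    using f by (intro compact_imp_bounded compact_continuous_image) auto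
  then obtain K where "\<forall>x\<in>f ` unit_circle. norm x \<le> K"
    unfolding bounded_iff by blast
  then show "f \<in> Linf" using meas by (intro LinfI[where K = K]) auto
qed

text \<open>Finite Borel measures on the plane are regular. Arc length is pushed forward to the
  plane so that compact and open refer to its topology, as in the later use of Urysohn's
  lemma.\<close>

lemma arc_measure_regular:
  assumes E: "E \<in> sets arc_measure" and "0 < \<delta>"
  obtains K U where "compact K" "open U" "K \<subseteq> E" "E \<subseteq> U"
    "measure arc_measure (unit_circle \<inter> U - K) < \<delta>"
proof -
  define N where "N = distr arc_measure borel (\<lambda>z. z)"
  have N: "emeasure N B = emeasure arc_measure (B \<inter> unit_circle)" if "B \<in> sets borel" for B
    unfolding N_def using that by (subst emeasure_distr) auto
  have sets: "sets N = sets borel" by (simp add: N_def)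
  interpret N: prob_space N
    unfolding N_def by (rule arc.prob_space_distr) measurable
  have Eb: "E \<in> sets borel"
    using E by (auto simp: sets_arc_measure sets_restrict_space)
  have fin: "emeasure N (space N) \<noteq> \<infinity>" by simp
  have NE: "emeasure N E \<noteq> \<infinity>" by simp
  have "\<exists>K. compact K \<and> K \<subseteq> E \<and> emeasure N E < emeasure N K + ennreal (\<delta> / 2)"
  proof (rule ccontr)
    assume "\<not> ?thesis"
    then have *: "emeasure N K + ennreal (\<delta> / 2) \<le> emeasure N E" if "K \<subseteq> E" "compact K" for K
      using that by (auto simp: not_less)
    have "measure N K \<le> measure N E - \<delta> / 2" if "K \<subseteq> E" "compact K" for K
      using *[OF that] \<open>0 < \<delta>\<close>
      by (simp add: N.emeasure_eq_measure ennreal_plus[symmetric] del: ennreal_plus)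
    then have "emeasure N E \<le> ennreal (measure N E - \<delta> / 2)"
      unfolding inner_regular[OF sets fin Eb]
      by (auto intro!: SUP_least ennreal_leI simp: N.emeasure_eq_measure)
    moreover have "0 \<le> measure N E - \<delta> / 2"
      using *[of "{}"] \<open>0 < \<delta>\<close> by (simp add: N.emeasure_eq_measure)
    ultimately show False
      using \<open>0 < \<delta>\<close> by (simp add: N.emeasure_eq_measure ennreal_le_iff)
  qed
  then obtain K where K: "compact K" "K \<subseteq> E" "emeasure N E < emeasure N K + ennreal (\<delta> / 2)"
    by blast
  have "(INF U\<in>{U. E \<subseteq> U \<and> open U}. emeasure N U) < emeasure N E + ennreal (\<delta> / 2)"
    using \<open>0 < \<delta>\<close> unfolding outer_regular[OF sets fin Eb, symmetric]
    by (simp add: N.emeasure_eq_measure ennreal_plus[symmetric] ennreal_less_iff del: ennreal_plus)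
  then obtain U where U: "open U" "E \<subseteq> U" "emeasure N U < emeasure N E + ennreal (\<delta> / 2)"
    unfolding INF_less_iff by blast
  have KE: "measure N E < measure N K + \<delta> / 2" and UE: "measure N U < measure N E + \<delta> / 2"
    using K(3) U(3) \<open>0 < \<delta>\<close>
    by (simp_all add: N.emeasure_eq_measure ennreal_plus[symmetric] ennreal_less_iff del: ennreal_plus)
  have "measure arc_measure (unit_circle \<inter> U - K) = measure N (U - K)"
  proof -
    have "unit_circle \<inter> U - K = (U - K) \<inter> unit_circle" by auto
    moreover have "U - K \<in> sets borel" using U(1) K(1) by (simp add: compact_imp_closed)
    ultimately show ?thesis using N[of "U - K"] by (simp only: measure_def)
  qed
  also have "\<dots> = measure N U - measure N K"
    using K U by (intro N.finite_measure_Diff) (auto simp: sets compact_imp_closed)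
  finally have "measure arc_measure (unit_circle \<inter> U - K) < \<delta>"
    using KE UE by simp
  with K U show thesis by (intro that)
qed

context rotation_seminorm
begin

text \<open>A stepping stone towards \<open>closure_continuous_functions\<close>: the class is
  linear, so membership passes from indicators to simple functions, and uniform approximation then
  reaches all of \<open>Linf\<close>.\<close>

definition approximable :: "(complex \<Rightarrow> complex) \<Rightarrow> bool" where
  "approximable f \<longleftrightarrow> f \<in> Linf \<and> (\<forall>e>0. \<exists>g\<in>continuous_functions. \<alpha> (\<lambda>z. f z - g z) < e)"

lemma approximable_const: "approximable (\<lambda>z. c)"
  unfolding approximable_def
proof (intro conjI allI impI Linf_const bexI)
  show "(\<lambda>z. c) \<in> continuous_functions" by (simp add: continuous_functions_def)
  show "\<alpha> (\<lambda>z. c - c) < e" if "0 < e" for e using that by (simp add: seminorm_const)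
qed

lemma approximable_add:
  assumes "approximable f" "approximable g"
  shows "approximable (\<lambda>z. f z + g z)"
  unfolding approximable_def
proof (intro conjI allI impI)
  show "(\<lambda>z. f z + g z) \<in> Linf"
    using assms by (intro Linf_add) (auto simp: approximable_def)
  fix e :: real assume "0 < e"
  obtain f' where f': "f' \<in> continuous_functions" "\<alpha> (\<lambda>z. f z - f' z) < e / 2"
    using assms(1) half_gt_zero[OF \<open>0 < e\<close>] unfolding approximable_def by blast
  obtain g' where g': "g' \<in> continuous_functions" "\<alpha> (\<lambda>z. g z - g' z) < e / 2"
    using assms(2) half_gt_zero[OF \<open>0 < e\<close>] unfolding approximable_def by blast
  have L: "(\<lambda>z. f z - f' z) \<in> Linf" "(\<lambda>z. g z - g' z) \<in> Linf"
    using assms f'(1) g'(1) continuous_functions_Linf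
    by (auto simp: approximable_def intro!: Linf_diff)
  have "(\<lambda>z. f z + g z - (f' z + g' z)) = (\<lambda>z. (f z - f' z) + (g z - g' z))"
    by auto
  then have "\<alpha> (\<lambda>z. f z + g z - (f' z + g' z)) < e"
    using seminorm_triangle[OF L] f'(2) g'(2) by simp
  moreover have "(\<lambda>z. f' z + g' z) \<in> continuous_functions"
    using f'(1) g'(1) by (auto simp: continuous_functions_def intro: continuous_on_add)
  ultimately show "\<exists>h\<in>continuous_functions. \<alpha> (\<lambda>z. f z + g z - h z) < e"
    by (rule bexI)
qed

lemma approximable_cmult:
  assumes "approximable f"
  shows "approximable (\<lambda>z. c * f z)"
  unfolding approximable_def
proof (intro conjI allI impI)
  show "(\<lambda>z. c * f z) \<in> Linf"
    using assms by (intro Linf_cmult) (auto simp: approximable_def)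
  fix e :: real assume "0 < e"
  \<comment> \<open>The added 1 avoids division by zero when c = 0.\<close>
  then have "0 < e / (norm c + 1)" by (simp add: add_nonneg_pos)
  then obtain g where g: "g \<in> continuous_functions" "\<alpha> (\<lambda>z. f z - g z) < e / (norm c + 1)"
    using assms unfolding approximable_def by blast
  have L: "(\<lambda>z. f z - g z) \<in> Linf"
    using assms g(1) continuous_functions_Linf by (auto simp: approximable_def intro!: Linf_diff)
  have "\<alpha> (\<lambda>z. c * f z - c * g z) = norm c * \<alpha> (\<lambda>z. f z - g z)"
    using seminorm_cmult[OF L, of c] by (simp add: right_diff_distrib)
  also have "\<dots> \<le> (norm c + 1) * \<alpha> (\<lambda>z. f z - g z)"
    using seminorm_nonneg[OF L] by (intro mult_right_mono) auto
  also have "\<dots> < e"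
    using g(2) by (simp add: pos_less_divide_eq add_nonneg_pos mult.commute)
  finally have "\<alpha> (\<lambda>z. c * f z - c * g z) < e" .
  moreover have "(\<lambda>z. c * g z) \<in> continuous_functions"
    using g(1) by (auto simp: continuous_functions_def intro: continuous_on_mult_left)
  ultimately show "\<exists>h\<in>continuous_functions. \<alpha> (\<lambda>z. c * f z - h z) < e"
    by (rule bexI)
qed

lemma approximable_sum:
  "(\<And>i. i \<in> I \<Longrightarrow> approximable (F i)) \<Longrightarrow> approximable (\<lambda>z. \<Sum>i\<in>I. F i z)"
  by (induction I rule: infinite_finite_induct) (auto intro: approximable_const approximable_add)

text \<open>A Urysohn function equal to 1 on K and 0 off U differs from the indicator of E on the
  circle only in U - K, and there by at most 1; continuity of \<alpha> makes the indicator of this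
  small set negligible.\<close>

lemma approximable_indicator:
  assumes cont: "continuous_seminorm \<alpha>" and E: "E \<in> sets arc_measure"
  shows "approximable (indicator E)"
  unfolding approximable_def
proof (intro conjI allI impI)
  show EL: "indicator E \<in> Linf" using E by (rule Linf_indicator)
  fix e :: real assume "0 < e"
  then obtain \<delta> where "0 < \<delta>"
    and \<delta>: "\<And>A. A \<in> sets arc_measure \<Longrightarrow> measure arc_measure A < \<delta> \<Longrightarrow> \<alpha> (indicator A) < e"
    using continuous_seminormD[OF cont] by metis
  obtain K U where KU: "compact K" "open U" "K \<subseteq> E" "E \<subseteq> U"
    and small: "measure arc_measure (unit_circle \<inter> U - K) < \<delta>"
    using arc_measure_regular[OF E \<open>0 < \<delta>\<close>] .
  have KU_sets: "unit_circle \<inter> U - K \<in> sets arc_measure"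
    using KU by (auto simp: sets_arc_measure sets_restrict_space image_iff compact_imp_closed
        intro!: bexI[of _ "U - K"])
  obtain p :: "complex \<Rightarrow> real" where p: "continuous_on UNIV p" "\<And>z. p z \<in> closed_segment 1 0"
    "\<And>z. z \<in> K \<Longrightarrow> p z = 1" "\<And>z. z \<in> - U \<Longrightarrow> p z = 0"
    using Urysohn[of K "- U" 1 0] KU by (auto simp: compact_imp_closed)
  have p01: "0 \<le> p z" "p z \<le> 1" for z
    using p(2)[of z] by (auto simp: closed_segment_eq_real_ivl split: if_splits)
  define g where "g z = complex_of_real (p z)" for z
  have g: "g \<in> continuous_functions"
    unfolding continuous_functions_def g_def
    using continuous_on_subset[OF p(1)] by (auto intro!: continuous_on_of_real)
  have "\<alpha> (\<lambda>z. indicator E z - g z) \<le> \<alpha> (indicator (unit_circle \<inter> U - K))"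
  proof (rule seminorm_mono)
    show "(\<lambda>z. indicator E z - g z) \<in> Linf"
      using EL g continuous_functions_Linf by (intro Linf_diff) auto
    show "indicator (unit_circle \<inter> U - K) \<in> Linf" by (rule Linf_indicator[OF KU_sets])
    show "AE z in arc_measure. norm (indicator E z - g z)
        \<le> norm (indicator (unit_circle \<inter> U - K) z :: complex)"
    proof (rule AE_I2)
      fix z assume z: "z \<in> space arc_measure"
      have eq: "norm (indicator E z - g z) = \<bar>indicator E z - p z\<bar>"
        unfolding g_def norm_of_real[symmetric, where 'a = complex]
        by (rule arg_cong[where f = norm]) (simp add: indicator_def)
      have "\<bar>indicator E z - p z\<bar> \<le> indicator (unit_circle \<inter> U - K) z"
        using p01[of z] p(3,4)[of z] z subsetD[OF KU(3), of z] subsetD[OF KU(4), of z]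
        by (cases "z \<in> K"; cases "z \<in> U"; cases "z \<in> E"; simp add: indicator_def)
      then show "norm (indicator E z - g z) \<le> norm (indicator (unit_circle \<inter> U - K) z :: complex)"
        unfolding eq by (cases "z \<in> unit_circle \<inter> U - K") (simp_all only: indicator_simps norm_one norm_zero not_False_eq_True)
    qed
  qed
  also have "\<dots> < e" by (rule \<delta>[OF KU_sets small])
  finally show "\<exists>g\<in>continuous_functions. \<alpha> (\<lambda>z. indicator E z - g z) < e"
    using g by blast
qed

lemma approximable_cong:
  assumes "approximable f" "g \<in> Linf" "AE z in arc_measure. f z = g z"
  shows "approximable g"
  unfolding approximable_def
proof (intro conjI allI impI assms(2))
  fix e :: real assume "0 < e"
  then obtain h where h: "h \<in> continuous_functions" "\<alpha> (\<lambda>z. f z - h z) < e"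
    using assms(1) unfolding approximable_def by blast
  have "\<alpha> (\<lambda>z. f z - h z) = \<alpha> (\<lambda>z. g z - h z)"
  proof (rule seminorm_cong)
    show "(\<lambda>z. f z - h z) \<in> Linf" "(\<lambda>z. g z - h z) \<in> Linf"
      using assms h(1) continuous_functions_Linf by (auto simp: approximable_def intro!: Linf_diff)
    show "AE z in arc_measure. f z - h z = g z - h z"
      using assms(3) by eventually_elim simp
  qed
  with h show "\<exists>h\<in>continuous_functions. \<alpha> (\<lambda>z. g z - h z) < e" by auto
qed

lemma approximable_Linf:
  assumes cont: "continuous_seminorm \<alpha>" and f: "f \<in> Linf"
  shows "approximable f"
  unfolding approximable_def
proof (intro conjI allI impI f)
  fix e :: real assume "0 < e"
  obtain s where s: "simple_function arc_measure s" "AE z in arc_measure. norm (f z - s z) \<le> e / 2"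
    using simple_approximation[OF f half_gt_zero[OF \<open>0 < e\<close>]] by metis
  have sL: "s \<in> Linf" using s(1) by (rule Linf_simple)
  have fin: "finite (s ` space arc_measure)" using s(1) by (rule simple_functionD)
  have "approximable (\<lambda>z. \<Sum>v\<in>s ` space arc_measure. v * indicator (s -` {v} \<inter> space arc_measure) z)"
    using simple_functionD(2)[OF s(1)]
    by (intro approximable_sum approximable_cmult approximable_indicator cont)
  \<comment> \<open>The sum over level sets represents s only on the circle; off the circle it is 0.
    Hence the passage through \<open>approximable_cong\<close>.\<close>
  then have "approximable s"
  proof (rule approximable_cong[OF _ sL], intro AE_I2)
    fix z assume z: "z \<in> space arc_measure"
    have "(\<Sum>v\<in>s ` space arc_measure. v * indicator (s -` {v} \<inter> space arc_measure) z)
        = (\<Sum>v\<in>s ` space arc_measure. if v = s z then v else 0)"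
      using z by (intro sum.cong) (auto simp: indicator_def)
    also have "\<dots> = s z" using fin z by simp
    finally show "(\<Sum>v\<in>s ` space arc_measure. v * indicator (s -` {v} \<inter> space arc_measure) z) = s z" .
  qed
  then obtain g where g: "g \<in> continuous_functions" "\<alpha> (\<lambda>z. s z - g z) < e / 2"
    using half_gt_zero[OF \<open>0 < e\<close>] unfolding approximable_def by blast
  have L: "(\<lambda>z. f z - s z) \<in> Linf" "(\<lambda>z. s z - g z) \<in> Linf"
    using f sL g(1) continuous_functions_Linf by (auto intro!: Linf_diff)
  have "\<alpha> (\<lambda>z. f z - g z) = \<alpha> (\<lambda>z. (f z - s z) + (s z - g z))" by simp
  also have "\<dots> \<le> \<alpha> (\<lambda>z. f z - s z) + \<alpha> (\<lambda>z. s z - g z)" by (rule seminorm_triangle[OF L])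
  also have "\<dots> < e / 2 + e / 2"
    using seminorm_le_const[OF L(1) s(2)] g(2) by (rule add_le_less_mono)
  finally show "\<exists>g\<in>continuous_functions. \<alpha> (\<lambda>z. f z - g z) < e" using g(1) by auto
qed

lemma closure_continuous_functions:
  assumes cont: "continuous_seminorm \<alpha>"
  shows "seminorm_closure \<alpha> continuous_functions = L_space \<alpha>"
proof
  show "seminorm_closure \<alpha> continuous_functions \<subseteq> L_space \<alpha>"
    using continuous_functions_Linf unfolding L_space_def seminorm_closure_def by blast
  show "L_space \<alpha> \<subseteq> seminorm_closure \<alpha> continuous_functions"
  proof
    fix f assume "f \<in> L_space \<alpha>"
    then have f: "f \<in> calL \<alpha>" and approx: "\<And>e. 0 < e \<Longrightarrow> \<exists>g\<in>Linf. ext_seminorm \<alpha> (\<lambda>z. f z - g z) < e"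
      by (auto simp: L_space_def seminorm_closure_def)
    have fm: "f \<in> borel_measurable arc_measure" using f by (simp add: calL_iff)
    have "\<exists>h\<in>continuous_functions. ext_seminorm \<alpha> (\<lambda>z. f z - h z) < e" if "0 < e" for e :: ennreal
    proof -
      \<comment> \<open>The tolerance e may be infinite; a positive real r below it can be
        halved.\<close>
      obtain d where d: "0 < d" "d < e" using dense[OF \<open>0 < e\<close>] by blast
      then obtain r where r: "0 < r" "ennreal r < e" by (cases d) auto
      obtain g where g: "g \<in> Linf" "ext_seminorm \<alpha> (\<lambda>z. f z - g z) < ennreal (r / 2)"
        using approx[of "ennreal (r / 2)"] r by auto
      obtain h where h: "h \<in> continuous_functions" "\<alpha> (\<lambda>z. g z - h z) < r / 2"
        using approximable_Linf[OF cont g(1)] half_gt_zero[OF r(1)] unfolding approximable_def by blast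
      have ghL: "(\<lambda>z. g z - h z) \<in> Linf"
        using g h(1) continuous_functions_Linf by (auto intro!: Linf_diff)
      have "ext_seminorm \<alpha> (\<lambda>z. f z - h z) = ext_seminorm \<alpha> (\<lambda>z. (f z - g z) + (g z - h z))"
        by simp
      also have "\<dots> \<le> ext_seminorm \<alpha> (\<lambda>z. f z - g z) + ext_seminorm \<alpha> (\<lambda>z. g z - h z)"
        using fm Linf_measurable[OF g(1)] Linf_measurable[OF ghL]
        by (intro ext_seminorm_triangle truncation_continuous_continuous cont) auto
      also have "\<dots> \<le> ennreal (r / 2) + ennreal (r / 2)"
        using g(2) h(2) by (intro add_mono) (auto simp: ext_seminorm_Linf[OF ghL] intro: ennreal_leI)
      also have "\<dots> = ennreal r"
        using r(1) by (simp add: ennreal_plus[symmetric] del: ennreal_plus)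
      finally show ?thesis using h(1) r(2) by (auto intro: le_less_trans)
    qed
    then show "f \<in> seminorm_closure \<alpha> continuous_functions"
      using f by (simp add: seminorm_closure_def)
  qed
qed

section \<open>Inclusions and completeness\<close>

lemma Linf_subset_L_space: "Linf \<subseteq> L_space \<alpha>"
proof
  fix f assume f: "f \<in> Linf"
  have "\<alpha> (\<lambda>z. f z - f z) = 0" by (simp add: seminorm_const)
  then have "ext_seminorm \<alpha> (\<lambda>z. f z - f z) = 0"
    using ext_seminorm_Linf[OF Linf_diff[OF f f]] by simp
  moreover have "f \<in> calL \<alpha>"
    using f by (simp add: calL_iff ext_seminorm_Linf Linf_measurable)
  ultimately show "f \<in> L_space \<alpha>"
    unfolding L_space_def seminorm_closure_def using f by (auto intro!: bexI[of _ f])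
qed

lemma calL_subset_L1:
  assumes truncation_continuous
  shows "calL \<alpha> \<subseteq> L1"
proof
  fix f assume f: "f \<in> calL \<alpha>"
  then have "L1_norm f < \<infinity>"
    using L1_norm_le_ext_seminorm[OF assms, of f] by (auto simp: calL_iff intro: le_less_trans)
  then show "f \<in> L1"
    using f by (auto simp: L1_def L1_norm_def calL_iff intro!: integrableI_bounded)
qed

text \<open>The L^1 bound turns an \<alpha>-Cauchy sequence into an L^1-Cauchy one, which has a
  subsequence converging almost everywhere to some h. Fatou's lemma, applied to F i - F (r n) with i
  fixed and n growing, then bounds F i - h for every large i and so handles the whole
  sequence.\<close>

lemma banach_space_on_calL:
  assumes tc: truncation_continuous
  shows "banach_space_on (calL \<alpha>) (ext_seminorm \<alpha>)"
  unfolding banach_space_on_def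
proof (intro conjI norm_on_calL[OF tc] allI impI, elim conjE)
  fix F :: "nat \<Rightarrow> complex \<Rightarrow> complex"
  assume F: "\<forall>n. F n \<in> calL \<alpha>"
    and Cauchy: "\<forall>e>0. \<exists>K. \<forall>i\<ge>K. \<forall>j\<ge>K. ext_seminorm \<alpha> (\<lambda>z. F i z - F j z) < e"
  have [measurable]: "F n \<in> borel_measurable arc_measure" for n
    using F by (simp add: calL_iff)
  have int: "integrable arc_measure (F n)" for n
    using F calL_subset_L1[OF tc] by (auto simp: L1_def)
  have L1_Cauchy: "\<exists>K. \<forall>i\<ge>K. \<forall>j\<ge>K. (LINT z|arc_measure. norm (F i z - F j z)) < e" if "0 < e" for e
  proof -
    have "0 < ennreal e" using that by simp
    then obtain K where K: "\<And>i j. K \<le> i \<Longrightarrow> K \<le> j \<Longrightarrow> ext_seminorm \<alpha> (\<lambda>z. F i z - F j z) < ennreal e"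
      using Cauchy by blast
    have "(LINT z|arc_measure. norm (F i z - F j z)) < e" if "K \<le> i" "K \<le> j" for i j
    proof -
      have "ennreal (LINT z|arc_measure. norm (F i z - F j z)) = L1_norm (\<lambda>z. F i z - F j z)"
        unfolding L1_norm_def using int by (intro nn_integral_eq_integral[symmetric]) auto
      also have "\<dots> \<le> ext_seminorm \<alpha> (\<lambda>z. F i z - F j z)"
        by (rule L1_norm_le_ext_seminorm[OF tc]) measurable
      also have "\<dots> < ennreal e" using that by (rule K)
      finally show ?thesis by (simp add: ennreal_less_iff)
    qed
    then show ?thesis by blast
  qed
  obtain r where r: "strict_mono r" "AE z in arc_measure. Cauchy (\<lambda>i. F (r i) z)"
    using cauchy_L1_AE_cauchy_subseq[OF int L1_Cauchy] .
  define h where "h z = lim (\<lambda>i. F (r i) z)" for z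
  have [measurable]: "h \<in> borel_measurable arc_measure"
    unfolding h_def by (rule borel_measurable_lim_metric) measurable
  have lim: "AE z in arc_measure. (\<lambda>i. F (r i) z) \<longlonglongrightarrow> h z"
    using r(2) by eventually_elim (simp add: h_def Cauchy_convergent_iff convergent_LIMSEQ_iff)
  have dist: "ext_seminorm \<alpha> (\<lambda>z. F i z - h z) \<le> e"
    if K: "\<And>i j. K \<le> i \<Longrightarrow> K \<le> j \<Longrightarrow> ext_seminorm \<alpha> (\<lambda>z. F i z - F j z) < e" and i: "K \<le> i" for i K e
  proof (rule ext_seminorm_Fatou[OF tc])
    show "AE z in arc_measure. (\<lambda>n. F i z - F (r n) z) \<longlonglongrightarrow> F i z - h z"
      using lim by eventually_elim (intro tendsto_intros)
    show "\<forall>\<^sub>F n in sequentially. ext_seminorm \<alpha> (\<lambda>z. F i z - F (r n) z) \<le> e"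
      using eventually_ge_at_top[of K]
    proof eventually_elim
      case (elim n)
      then have "K \<le> r n" using seq_suble[OF r(1), of n] by simp
      with i show ?case using K by (simp add: less_imp_le)
    qed
  qed measurable
  have "(\<lambda>i. ext_seminorm \<alpha> (\<lambda>z. F i z - h z)) \<longlonglongrightarrow> 0"
  proof (rule order_tendstoI)
    fix a :: ennreal assume "0 < a"
    then obtain e where e: "0 < e" "e < a" using dense by blast
    then obtain K where K: "\<And>i j. K \<le> i \<Longrightarrow> K \<le> j \<Longrightarrow> ext_seminorm \<alpha> (\<lambda>z. F i z - F j z) < e"
      using Cauchy by blast
    show "\<forall>\<^sub>F i in sequentially. ext_seminorm \<alpha> (\<lambda>z. F i z - h z) < a"
      using eventually_ge_at_top[of K]
    proof eventually_elim
      case (elim i)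
      show ?case using dist[OF K elim] e(2) by (rule le_less_trans)
    qed
  qed simp
  moreover have "h \<in> calL \<alpha>"
  proof -
    \<comment> \<open>Any finite tolerance would do: it places h at finite distance from a member of
      \<open>calL \<alpha>\<close>.\<close>
    obtain K where K: "\<And>i j. K \<le> i \<Longrightarrow> K \<le> j \<Longrightarrow> ext_seminorm \<alpha> (\<lambda>z. F i z - F j z) < 1"
      using Cauchy zero_less_one by blast
    have "ext_seminorm \<alpha> h = ext_seminorm \<alpha> (\<lambda>z. F K z + (h z - F K z))" by simp
    also have "\<dots> \<le> ext_seminorm \<alpha> (F K) + ext_seminorm \<alpha> (\<lambda>z. h z - F K z)"
      by (rule ext_seminorm_triangle[OF tc]) measurable
    also have "ext_seminorm \<alpha> (\<lambda>z. h z - F K z) \<le> ext_seminorm \<alpha> (\<lambda>z. F K z - h z)"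
      by (intro ext_seminorm_mono) (simp add: norm_minus_commute)
    also have "\<dots> \<le> 1" by (rule dist[OF K order_refl])
    also have "ext_seminorm \<alpha> (F K) + 1 < \<infinity>"
      using F by (simp add: calL_iff)
    finally show ?thesis by (simp add: calL_iff)
  qed
  ultimately show "\<exists>h\<in>calL \<alpha>. (\<lambda>n. ext_seminorm \<alpha> (\<lambda>z. F n z - h z)) \<longlonglongrightarrow> 0"
    by blast
qed

end

theorem proposition2p2:
  fixes \<alpha> :: "(complex \<Rightarrow> complex) \<Rightarrow> real"
    and f g :: "complex \<Rightarrow> complex"
    and fs :: "nat \<Rightarrow> complex \<Rightarrow> complex"
  assumes "\<alpha> \<in> rotation_symmetric_seminorms"
    and "f \<in> borel_measurable arc_measure"
    and "g \<in> borel_measurable arc_measure"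
    and "\<And>n. fs n \<in> borel_measurable arc_measure"
  shows
    "(((AE z in arc_measure. norm (f z) \<le> norm (g z)) \<longrightarrow> ext_seminorm \<alpha> f \<le> ext_seminorm \<alpha> g) \<and>
      ext_seminorm \<alpha> (\<lambda>z. f z * g z)
        \<le> (if Linf_norm g = \<infinity> then \<infinity> else ext_seminorm \<alpha> f * Linf_norm g) \<and>
      ext_seminorm \<alpha> f \<le> Linf_norm f)
     \<and>
     (\<alpha> \<in> continuous_rotation_symmetric_seminorms \<longleftrightarrow>
        Limsup small_sets (\<lambda>E. ennreal (\<alpha> (char_fun E))) = 0)
     \<and>
     (Liminf small_sets (\<lambda>E. ennreal (\<alpha> (char_fun E))) =
        (INF E \<in> {E \<in> sets arc_measure. 0 < measure arc_measure E}. ennreal (\<alpha> (char_fun E))))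
     \<and>
     (\<forall>t::real. 0 < t \<longrightarrow>
        (ennreal t \<le> Liminf small_sets (\<lambda>E. ennreal (\<alpha> (char_fun E))) \<longleftrightarrow>
         (\<forall>h \<in> borel_measurable arc_measure.
            ennreal t * Linf_norm h \<le> ext_seminorm \<alpha> h \<and> ext_seminorm \<alpha> h \<le> Linf_norm h)))
     \<and>
     (\<alpha> \<in> symmetric_gauge_seminorms \<longrightarrow>
        (\<alpha> \<notin> continuous_symmetric_gauge_seminorms \<longleftrightarrow> equivalent_to_Linf_norm \<alpha>))
     \<and>
     (\<alpha> \<in> symmetric_gauge_seminorms \<union> continuous_rotation_symmetric_seminorms \<and>
      (AE z in arc_measure. \<forall>n. fs n z \<in> \<real>\<^sub>\<ge>\<^sub>0 \<and> Re (fs n z) \<le> Re (fs (Suc n) z)) \<and>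
      (AE z in arc_measure. (\<lambda>n. fs n z) \<longlonglongrightarrow> f z) \<longrightarrow>
        (\<lambda>n. ext_seminorm \<alpha> (fs n)) \<longlonglongrightarrow> ext_seminorm \<alpha> f)
     \<and>
     (\<alpha> \<in> continuous_rotation_symmetric_seminorms \<longrightarrow>
        seminorm_closure \<alpha> continuous_functions = L_space \<alpha>)
     \<and>
     (\<alpha> \<in> symmetric_gauge_seminorms \<union> continuous_rotation_symmetric_seminorms \<longrightarrow>
        L1_norm f \<le> ext_seminorm \<alpha> f)
     \<and>
     (\<alpha> \<in> symmetric_gauge_seminorms \<union> continuous_rotation_symmetric_seminorms \<longrightarrow>
        ext_seminorm \<alpha> (\<lambda>z. f z + g z) \<le> ext_seminorm \<alpha> f + ext_seminorm \<alpha> g \<and>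
        (\<forall>c. ext_seminorm \<alpha> (\<lambda>z. c * f z) = ennreal (norm c) * ext_seminorm \<alpha> f) \<and>
        norm_on (calL \<alpha>) (ext_seminorm \<alpha>))
     \<and>
     (\<alpha> \<in> continuous_rotation_symmetric_seminorms \<longrightarrow>
        banach_space_on (calL \<alpha>) (ext_seminorm \<alpha>) \<and>
        Linf \<subseteq> L_space \<alpha> \<and> L_space \<alpha> \<subseteq> calL \<alpha> \<and> calL \<alpha> \<subseteq> L1)"
proof -
  interpret rotation_seminorm \<alpha>
    using assms(1) by unfold_locales
  have c: "continuous_seminorm \<alpha>" if "\<alpha> \<in> continuous_rotation_symmetric_seminorms"
    using that by (simp add: continuous_rotation_symmetric_seminorms_def)
  show ?thesis
  proof (intro conjI impI allI; (elim conjE)?)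
    show "ext_seminorm \<alpha> f \<le> ext_seminorm \<alpha> g"
      if "AE z in arc_measure. norm (f z) \<le> norm (g z)"
      using that by (rule ext_seminorm_mono)
    show "ext_seminorm \<alpha> (\<lambda>z. f z * g z)
        \<le> (if Linf_norm g = \<infinity> then \<infinity> else ext_seminorm \<alpha> f * Linf_norm g)"
      using ext_seminorm_mult_le[OF assms(3)] by auto
    show "ext_seminorm \<alpha> f \<le> Linf_norm f"
      by (rule ext_seminorm_le_Linf_norm[OF assms(2)])
    show "\<alpha> \<in> continuous_rotation_symmetric_seminorms \<longleftrightarrow>
        Limsup small_sets (\<lambda>E. ennreal (\<alpha> (char_fun E))) = 0"
      using assms(1) by (simp add: continuous_rotation_symmetric_seminorms_def continuous_seminorm_iff_Limsup)
    show "Liminf small_sets (\<lambda>E. ennreal (\<alpha> (char_fun E))) =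
        (INF E \<in> {E \<in> sets arc_measure. 0 < measure arc_measure E}. ennreal (\<alpha> (char_fun E)))"
      by (rule Liminf_small_sets)
    show "ennreal t \<le> Liminf small_sets (\<lambda>E. ennreal (\<alpha> (char_fun E))) \<longleftrightarrow>
         (\<forall>h \<in> borel_measurable arc_measure.
            ennreal t * Linf_norm h \<le> ext_seminorm \<alpha> h \<and> ext_seminorm \<alpha> h \<le> Linf_norm h)"
      if "0 < t" for t :: real
      using that by (rule Liminf_small_sets_ge_iff)
    show "\<alpha> \<notin> continuous_symmetric_gauge_seminorms \<longleftrightarrow> equivalent_to_Linf_norm \<alpha>"
      if "\<alpha> \<in> symmetric_gauge_seminorms"
      using discontinuous_symmetric_iff[OF that] that
      by (simp add: continuous_symmetric_gauge_seminorms_def)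
    show "(\<lambda>n. ext_seminorm \<alpha> (fs n)) \<longlonglongrightarrow> ext_seminorm \<alpha> f"
      if "\<alpha> \<in> symmetric_gauge_seminorms \<union> continuous_rotation_symmetric_seminorms"
        "AE z in arc_measure. \<forall>n. fs n z \<in> \<real>\<^sub>\<ge>\<^sub>0 \<and> Re (fs n z) \<le> Re (fs (Suc n) z)"
        "AE z in arc_measure. (\<lambda>n. fs n z) \<longlonglongrightarrow> f z"
      using truncation_continuous[OF that(1)] assms(4) that(2,3)
      by (rule ext_seminorm_monotone_convergence)
    show "seminorm_closure \<alpha> continuous_functions = L_space \<alpha>"
      if "\<alpha> \<in> continuous_rotation_symmetric_seminorms"
      using c[OF that] by (rule closure_continuous_functions)
    assume tc: "\<alpha> \<in> symmetric_gauge_seminorms \<union> continuous_rotation_symmetric_seminorms"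
    note tc = truncation_continuous[OF tc]
    show "L1_norm f \<le> ext_seminorm \<alpha> f"
      using tc assms(2) by (rule L1_norm_le_ext_seminorm)
    show "ext_seminorm \<alpha> (\<lambda>z. f z + g z) \<le> ext_seminorm \<alpha> f + ext_seminorm \<alpha> g"
      using tc assms(2,3) by (rule ext_seminorm_triangle)
    show "ext_seminorm \<alpha> (\<lambda>z. k * f z) = ennreal (norm k) * ext_seminorm \<alpha> f" for k
      by (rule ext_seminorm_cmult)
    show "norm_on (calL \<alpha>) (ext_seminorm \<alpha>)"
      using tc by (rule norm_on_calL)
  next
    assume R: "\<alpha> \<in> continuous_rotation_symmetric_seminorms"
    then have tc: truncation_continuous
      by (intro truncation_continuous) simp
    show "banach_space_on (calL \<alpha>) (ext_seminorm \<alpha>)"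
      using tc by (rule banach_space_on_calL)
    show "Linf \<subseteq> L_space \<alpha>" by (rule Linf_subset_L_space)
    show "L_space \<alpha> \<subseteq> calL \<alpha>" by (auto simp: L_space_def seminorm_closure_def)
    show "calL \<alpha> \<subseteq> L1" using tc by (rule calL_subset_L1)
  qed
qed

end
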